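(* For any finitely generated group $F$ and any integer $n\geq 1$, there exists a finite subset $L\subseteq F$ that is a Burnside set for $\mathrm{Hom}(F,\mathrm{GL}_n(\mathbb{C}))$.
   Context: Let $F$ be a group, let $\mathcal{C}$ be a class of group homomorphisms with domain $F$, and let $L\subseteq F$ be a subset. We say that $L$ is a Burnside set for $\mathcal{C}$ if the following two conditions are equivalent for every $\rho\in\mathcal{C}$: (1) $\rho(\gamma)$ is torsion (i.e. has finite order) for all $\gamma\in L$; (2) $\rho$ has finite image. Here $\mathrm{Hom}(F,\mathrm{GL}_n(\mathbb{C}))$ is the set of all group homomorphisms $F\to\mathrm{GL}_n(\mathbb{C})$. *)

theory Defs
  imports
    "HOL-Algebra.Generated_Groups"
    "HOL-Algebra.Multiplicative_Group"
    "Jordan_Normal_Form.Matrix"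
begin

definition finitely_generated :: "('a, 'c) monoid_scheme \<Rightarrow> bool" where
  "finitely_generated F \<longleftrightarrow> (\<exists>S. finite S \<and> S \<subseteq> carrier F \<and> generate F S = carrier F)"

definition torsion :: "('a, 'c) monoid_scheme \<Rightarrow> 'a \<Rightarrow> bool" where
  "torsion G x \<longleftrightarrow> (\<exists>k::nat. k > 0 \<and> x [^]\<^bsub>G\<^esub> k = \<one>\<^bsub>G\<^esub>)"

lemma (in group) torsion_iff_ord:
  assumes "x \<in> carrier G"
  shows "torsion G x \<longleftrightarrow> ord x \<noteq> 0"
  unfolding torsion_def pow_eq_id[OF assms] by (auto intro: exI[of _ "ord x"])

(* A class of homomorphisms with domain F is a set of pairs (H, \<rho>) of a codomain H and
   a map \<rho> from F to H, since the codomain cannot be read off from \<rho>. *)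
definition burnside_set ::
    "('a, 'c) monoid_scheme \<Rightarrow> ('b monoid \<times> ('a \<Rightarrow> 'b)) set \<Rightarrow> 'a set \<Rightarrow> bool" where
  "burnside_set F \<C> L \<longleftrightarrow> L \<subseteq> carrier F \<and>
    (\<forall>(H, \<rho>) \<in> \<C>. (\<forall>\<gamma>\<in>L. torsion H (\<rho> \<gamma>)) \<longleftrightarrow> finite (\<rho> ` carrier F))"

definition Hom ::
    "('a, 'c) monoid_scheme \<Rightarrow> 'b monoid \<Rightarrow> ('b monoid \<times> ('a \<Rightarrow> 'b)) set" where
  "Hom F H = {H} \<times> hom F H"

definition GL :: "nat \<Rightarrow> complex mat monoid" where
  "GL n = units_of (ring_mat TYPE(complex) n ())"

lemma group_GL: "group (GL n)"
proof -
  interpret ring "ring_mat TYPE(complex) n ()"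
    by (rule ring_mat)
  show ?thesis
    unfolding GL_def by (rule units_group)
qed

lemma carrier_GL: "carrier (GL n) = {A \<in> carrier_mat n n. invertible_mat A}"
proof (intro Set.set_eqI iffI)
  fix A :: "complex mat" assume "A \<in> carrier (GL n)"
  then obtain B where "A \<in> carrier_mat n n" "B \<in> carrier_mat n n" "B * A = 1\<^sub>m n" "A * B = 1\<^sub>m n"
    by (auto simp: GL_def units_of_carrier Units_def ring_mat_def)
  then show "A \<in> {A \<in> carrier_mat n n. invertible_mat A}"
    by (auto simp: invertible_mat_def inverts_mat_def)
next
  fix A :: "complex mat" assume "A \<in> {A \<in> carrier_mat n n. invertible_mat A}"
  then obtain B where A: "A \<in> carrier_mat n n"
    and B: "A * B = 1\<^sub>m n" "B * A = 1\<^sub>m (dim_row B)"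
    by (auto simp: invertible_mat_def inverts_mat_def)
  have "dim_col B = n" "dim_row B = n"
    using A arg_cong[OF B(1), of dim_col] arg_cong[OF B(2), of dim_col] by auto
  then have "B \<in> carrier_mat n n" by auto
  then show "A \<in> carrier (GL n)"
    using A B by (auto simp: GL_def units_of_carrier Units_def ring_mat_def)
qed

end

theory Submission
  imports
    Defs
    "HOL-Analysis.Analysis"
    "HOL-Number_Theory.Number_Theory"
    "HOL-Library.Function_Algebras"
    "Jordan_Normal_Form.Schur_Decomposition"
begin

text \<open>Suppose that no finite set works, and exhaust the group by finite sets \<open>B k\<close>. Then there are
  representations \<open>\<rho> k\<close> with infinite image that are torsion on \<open>B k\<close>, so that the eigenvalues of
  \<open>\<rho> k \<gamma>\<close> are roots of unity for almost all \<open>k\<close>. Fix a nonprincipal ultrafilter. The sequence of the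
  angles of an eigenvalue has a part that is constant modulo integers (its torsion part \<open>\<tau>\<close>), and,
  as the units modulo \<open>N\<close> are well distributed on characters of large order, Galois conjugations can
  be chosen that move the rest to \<open>h\<close> of it in the limit, for any additive \<open>h\<close> that kills torsion.
  The limits of the conjugated eigenvalues still satisfy the identities of the eigenvalues of a
  representation.

  For \<open>h = 0\<close> the limit character has roots of unity as eigenvalues. Finite generation puts them
  into one cyclotomic field up to bounded degree, so their orders are bounded, the character takes
  finitely many values, and it is trivial on a subgroup of finite index. For \<open>a\<close> and \<open>b\<close> in that
  subgroup, replacing \<open>h\<close> by \<open>h / J\<close> makes their eigenvalues \<open>O(1 / J)\<close>-close to \<open>1\<close>; those of their
  commutator \<open>c\<close> are then \<open>O(1 / J\<^sup>2)\<close>-close in trace, so that \<open>c\<^sup>J\<close> has trace near \<open>n\<close>, although its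
  angles are \<open>h\<close> of those of \<open>c\<close>. Hence \<open>h\<close> kills the angles of \<open>c\<close> for every \<open>h\<close>, these are
  torsion, and \<open>\<rho> k c = 1\<close> for almost all \<open>k\<close>. So \<open>\<rho> k\<close> maps a finitely generated subgroup of
  finite index to an abelian group generated by torsion elements, and has finite image.\<close>

hide_const (open) up_ring.monom module.smult up_ring.coeff Finite_Cartesian_Product.mat Determinants.det
hide_type (open) Finite_Cartesian_Product.vec

section \<open>Conjugates of roots of unity\<close>

text \<open>The matrices \<open>\<rho> k \<gamma>\<close> have no useful limit: nothing bounds their
  entries, and conjugating roots of unity does not act on them. Eigenvalues do not have this defect:
  they are bounded and are powers of one root of unity \<open>z\<close>, which a conjugation
  replaces by \<open>z ^ m\<close>. What survives of linearity is Cayley-Hamilton for traces and the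
  singularity of trace Gram matrices of size \<open>n * n + 1\<close>; the latter recovers a
  multiplication law for the limit character without a representation behind it.

  Since \<open>m\<close> is coprime to the orders, a nontrivial torsion part can never be moved to
  \<open>0\<close>, only multiplied by a unit. Hence the detour through \<open>h = 0\<close>: on the
  subgroup found there the torsion parts of the angles are integral, and \<open>h\<close> alone
  determines the limits.

  A nontorsion angle of \<open>c\<close> is excluded by normalising \<open>h\<close> to
  \<open>1 / 2\<close> on it: the limit of \<open>c ^ J\<close> then has an eigenvalue
  \<open>- 1\<close>, and its trace stays at distance at least \<open>2\<close> from
  \<open>n\<close>, however large \<open>J\<close> is.\<close>

abbreviation ipoly :: "int poly \<Rightarrow> complex \<Rightarrow> complex" where
  "ipoly p z \<equiv> poly (map_poly of_int p) z"

lemma ipoly_add: "ipoly (p + q) z = ipoly p z + ipoly q z"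
  and ipoly_mult: "ipoly (p * q) z = ipoly p z * ipoly q z"
  and ipoly_diff: "ipoly (p - q) z = ipoly p z - ipoly q z"
  and ipoly_power: "ipoly (p ^ k) z = ipoly p z ^ k"
  and ipoly_smult: "ipoly (smult c p) z = of_int c * ipoly p z"
  and ipoly_const: "ipoly [:c:] z = of_int c"
  and ipoly_monom: "ipoly (monom c k) z = of_int c * z ^ k"
  and ipoly_1: "ipoly 1 z = 1"
  and ipoly_0: "ipoly 0 z = 0"
  by (simp_all add: hom_distribs poly_monom)

lemma comm_ring_hom_ipoly: "comm_ring_hom (\<lambda>p. ipoly p z)"
  by unfold_locales (simp_all add: ipoly_add ipoly_mult ipoly_1 ipoly_0)

text \<open>Gauss's lemma: the constant is invertible over the fraction field, and divisibility by a
  primitive polynomial descends from there.\<close>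

lemma primitive_dvd_smultD:
  fixes f g :: "int poly"
  assumes "f dvd smult c g" "content f = 1" "c \<noteq> 0"
  shows "f dvd g"
proof -
  have "fract_poly f dvd fract_poly (smult c g)" using assms(1) by (rule fract_poly_dvd)
  then have "fract_poly f dvd smult (to_fract c) (fract_poly g)" by simp
  then have "fract_poly f dvd fract_poly g" using assms(3)
    by (simp add: dvd_smult_iff)
  then show ?thesis using assms(2) by (rule fract_poly_dvdD)
qed

text \<open>A primitive polynomial of least degree among those vanishing at \<open>z\<close> divides
  all of them: pseudo-division leaves no remainder, and Gauss's lemma removes the power of the
  leading coefficient. As it divides \<open>X^N - 1\<close>, its leading coefficient is a
  unit.\<close>

lemma int_minimal_polynomial:
  fixes z :: complex
  assumes "z ^ N = 1" "N > 0"
  obtains f :: "int poly" where "\<And>P. ipoly P z = 0 \<Longrightarrow> f dvd P" "ipoly f z = 0" "f \<noteq> 0"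
    "lead_coeff f = 1"
proof -
  define Q where "Q = (\<lambda>f::int poly. f \<noteq> 0 \<and> ipoly f z = 0)"
  have Q0: "Q (monom 1 N - 1)"
  proof -
    have "coeff (monom (1::int) N - 1) N = 1" using assms(2) by (simp add: coeff_monom)
    then have "monom (1::int) N - 1 \<noteq> 0" by (metis coeff_0 zero_neq_one)
    then show ?thesis using assms by (simp add: Q_def ipoly_diff ipoly_monom ipoly_1 poly_monom)
  qed
  obtain f0 where f0: "Q f0" "\<And>g. Q g \<Longrightarrow> degree f0 \<le> degree g"
    using Q0 ex_has_least_nat[of Q _ degree] by metis
  define f1 where "f1 = primitive_part f0"
  have cont: "content f0 \<noteq> 0" using f0(1) by (simp add: Q_def)
  have f0eq: "f0 = smult (content f0) f1" by (simp add: f1_def)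
  have f1: "Q f1"
  proof -
    have "f1 \<noteq> 0" using f0(1) f0eq by (auto simp: Q_def)
    moreover have "of_int (content f0) * ipoly f1 z = 0"
      using f0(1) by (metis f0eq ipoly_smult Q_def)
    ultimately show ?thesis using cont by (simp add: Q_def)
  qed
  have deg1: "degree f1 = degree f0" by (simp add: f1_def)
  have cont1: "content f1 = 1" using f0(1) by (simp add: f1_def Q_def)
  have dvd1: "f1 dvd P" if P: "ipoly P z = 0" for P
  proof -
    obtain q r where qr: "pseudo_divmod P f1 = (q, r)" by (cases "pseudo_divmod P f1")
    have nz: "f1 \<noteq> 0" using f1 by (simp add: Q_def)
    define c where "c = lead_coeff f1 ^ (Suc (degree P) - degree f1)"
    from pseudo_divmod[OF nz qr] have eq: "smult c P = f1 * q + r" and d: "r = 0 \<or> degree r < degree f1"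
      by (auto simp: c_def)
    have "ipoly r z = 0"
    proof -
      have "ipoly (smult c P) z = ipoly f1 z * ipoly q z + ipoly r z"
        unfolding eq by (simp add: ipoly_add ipoly_mult)
      then show ?thesis using P f1 by (simp add: ipoly_smult Q_def)
    qed
    then have "r = 0" using d f0(2)[of r] deg1 by (force simp: Q_def)
    then have "f1 dvd smult c P" using eq by simp
    moreover have "c \<noteq> 0" using nz by (simp add: c_def)
    ultimately show ?thesis using cont1 primitive_dvd_smultD by blast
  qed
  have "f1 dvd monom 1 N - 1" using dvd1 Q0 by (simp add: Q_def)
  then obtain g where g: "monom 1 N - 1 = f1 * g" by (auto simp: dvd_def)
  have "lead_coeff (monom (1::int) N - 1) = 1"
  proof -
    have "degree (monom (1::int) N - 1) = N"
      using assms(2) by (subst diff_conv_add_uminus, subst degree_add_eq_left) (simp_all add: degree_monom_eq)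
    then show ?thesis using assms(2) by simp
  qed
  then have lc: "lead_coeff f1 * lead_coeff g = 1" by (simp add: g lead_coeff_mult)
  then have unit: "lead_coeff f1 * lead_coeff f1 = 1"
    by (metis mult.commute zmult_eq_1_iff mult_1 mult_minus_left minus_minus)
  define f where "f = smult (lead_coeff f1) f1"
  have ff: "f1 = smult (lead_coeff f1) f" by (simp add: f_def unit)
  have "f dvd f1" by (subst ff) (rule dvd_smult, simp)
  then have "f dvd P" if "ipoly P z = 0" for P using dvd1[OF that] dvd_trans by blast
  moreover have "ipoly f z = 0" using f1 by (simp add: f_def ipoly_smult Q_def)
  moreover have lcf: "lead_coeff f = 1" using f1 by (simp add: f_def unit Q_def)
  moreover from lcf have "f \<noteq> 0" by auto
  ultimately show ?thesis using that by blast
qed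

text \<open>Fermat's little theorem treats the coefficients, and the divisibility of the inner
  binomial coefficients by \<open>p\<close> makes the \<open>p\<close>-th power additive modulo
  \<open>p\<close>.\<close>

lemma int_poly_frobenius:
  assumes "prime (p::nat)"
  shows "\<exists>h :: int poly. pcompose f (monom 1 p) = f ^ p + smult (int p) h"
proof (induction f)
  case 0
  have "p > 0" using assms prime_gt_0_nat by blast
  then show ?case by (intro exI[of _ 0]) simp
next
  case (pCons a f)
  have p0: "p > 0" using assms prime_gt_0_nat by blast
  then obtain h where h: "pcompose f (monom 1 p) = f ^ p + smult (int p) h" using pCons by blast
  let ?X = "monom (1::int) 1"
  have eq: "pCons a f = [:a:] + ?X * f" by (simp add: monom_altdef)
  have fermat: "\<exists>c. a = a ^ p + int p * c"
  proof -
    have "[a ^ p = a] (mod int p)"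
    proof (cases "int p dvd a")
      case True
      then show ?thesis using p0 by (simp add: cong_def mod_0_imp_dvd dvd_imp_mod_0 dvd_power_same dvd_trans[OF True dvd_power])
    next
      case False
      have "[a ^ (p - 1) = 1] (mod int p)"
      proof -
        have "coprime a (int p)" using False assms
          by (metis coprime_commute prime_imp_coprime prime_nat_int_transfer)
        then have "[a ^ totient p = 1] (mod int p)" 
          using residues.euler_theorem[of "int p" a] assms prime_gt_1_nat by (auto simp: residues_def)
        then show ?thesis using assms by (simp add: totient_prime)
      qed
      then have "[a * a ^ (p - 1) = a * 1] (mod int p)" by (rule cong_scalar_left)
      then show ?thesis using p0 by (simp add: power_eq_if)
    qed
    then have "int p dvd a - a ^ p" by (metis cong_iff_dvd_diff cong_sym)
    then obtain c where "a - a ^ p = int p * c" by (auto simp: dvd_def)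
    then have "a = a ^ p + int p * c" by simp
    then show ?thesis by blast
  qed
  then obtain c where c: "a = a ^ p + int p * c" by blast
  have binom: "\<exists>k. ([:a:] + ?X * f) ^ p = [:a:] ^ p + (?X * f) ^ p + smult (int p) k"
  proof -
    have "([:a:] + ?X * f) ^ p = (\<Sum>i\<le>p. of_nat (p choose i) * [:a:] ^ i * (?X * f) ^ (p - i))"
      by (rule binomial_ring)
    also have "{..p} = insert 0 (insert p {0<..<p})" using p0 by auto
    also have "(\<Sum>i\<in>insert 0 (insert p {0<..<p}). of_nat (p choose i) * [:a:] ^ i * (?X * f) ^ (p - i))
       = (?X * f) ^ p + ([:a:] ^ p + (\<Sum>i\<in>{0<..<p}. of_nat (p choose i) * [:a:] ^ i * (?X * f) ^ (p - i)))"
      using p0 by simp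
    also have "(\<Sum>i\<in>{0<..<p}. of_nat (p choose i) * [:a:] ^ i * (?X * f) ^ (p - i))
      = (\<Sum>i\<in>{0<..<p}. smult (int p) (of_nat ((p choose i) div p) * [:a:] ^ i * (?X * f) ^ (p - i)))"
    proof (rule sum.cong[OF refl])
      fix i assume "i \<in> {0<..<p}"
      then have "p dvd (p choose i)" using assms by (intro dvd_choose_prime) auto
      then have "(p choose i) = p * ((p choose i) div p)" by simp
      then have "(of_nat (p choose i) :: int poly) = of_nat p * of_nat ((p choose i) div p)"
        by (metis of_nat_mult)
      then show "of_nat (p choose i) * [:a:] ^ i * (?X * f) ^ (p - i) = 
         smult (int p) (of_nat ((p choose i) div p) * [:a:] ^ i * (?X * f) ^ (p - i))"
        by (simp add: of_nat_poly mult.assoc mult.commute[of "int p"])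
    qed
    also have "\<dots> = smult (int p) (\<Sum>i\<in>{0<..<p}. (of_nat ((p choose i) div p) * [:a:] ^ i * (?X * f) ^ (p - i)))"
      by (simp add: smult_sum2)
    finally show ?thesis by (auto simp: algebra_simps)
  qed
  then obtain k where k: "(pCons a f) ^ p = [:a:] ^ p + (?X * f) ^ p + smult (int p) k"
    using eq by auto
  have "pcompose (pCons a f) (monom 1 p) = [:a:] + monom 1 p * (f ^ p + smult (int p) h)"
    by (simp add: pcompose_pCons h)
  also have "[:a:] = [:a:] ^ p + smult (int p) [:c:]"
    using c by (metis poly_const_pow add_pCons add_0 smult_pCons smult_0_right)
  also have "monom 1 p * (f ^ p + smult (int p) h) = ?X ^ p * (f ^ p + smult (int p) h)"
    by (simp add: monom_power)
  also have "[:a:] ^ p + smult (int p) [:c:] + ?X ^ p * (f ^ p + smult (int p) h) =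
     (pCons a f) ^ p + smult (int p) ([:c:] + ?X ^ p * h - k)"
    by (simp add: k power_mult_distrib algebra_simps smult_add_right smult_diff_right)
  finally show ?case by blast
qed

text \<open>Dedekind's argument for the irreducibility of cyclotomic polynomials. If the minimal
  polynomial \<open>f\<close> did not vanish at \<open>z ^ p\<close>, the derivative of
  \<open>X^N - 1 = f * g\<close> at \<open>z ^ p\<close> would exhibit \<open>N\<close> as
  \<open>p\<close> times an element of \<open>Z[z]\<close>, because \<open>f\<close> at
  \<open>z ^ p\<close> is itself such a multiple by Frobenius.\<close>

lemma root_of_unity_prime_conjugate:
  fixes z :: complex
  assumes z: "z ^ N = 1" "N > 0" and p: "prime p" "\<not> p dvd N" and P: "ipoly P z = 0"
  shows "ipoly P (z ^ p) = 0"
proof -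
  obtain f :: "int poly" where f: "\<And>P. ipoly P z = 0 \<Longrightarrow> f dvd P" "ipoly f z = 0" "f \<noteq> 0"
    "lead_coeff f = 1" using int_minimal_polynomial[OF z] by metis
  have "ipoly f (z ^ p) = 0"
  proof (rule ccontr)
    assume nz: "ipoly f (z ^ p) \<noteq> 0"
    obtain g where g: "monom 1 N - 1 = f * g"
      using f(1)[of "monom 1 N - 1"] z by (auto simp: dvd_def ipoly_diff ipoly_monom ipoly_1 poly_monom)
    have zp: "(z ^ p) ^ N = 1" using z by (metis power_mult power_one mult.commute)
    have "ipoly (f * g) (z ^ p) = 0" using zp
      by (simp add: g[symmetric] ipoly_diff ipoly_1 poly_monom)
    then have g0: "ipoly g (z ^ p) = 0" using nz by (simp add: ipoly_mult)
    obtain h where h: "pcompose f (monom 1 p) = f ^ p + smult (int p) h"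
      using int_poly_frobenius[OF p(1)] by blast
    have "ipoly (pcompose f (monom 1 p)) z = ipoly f (z ^ p)"
      by (simp add: of_int_hom.map_poly_pcompose poly_pcompose poly_monom)
    then have fp: "ipoly f (z ^ p) = of_nat p * ipoly h z"
      using f(2) prime_gt_0_nat[OF p(1)] by (simp add: h ipoly_add ipoly_smult ipoly_power zero_power)
    have "pderiv (monom 1 N - 1) = pderiv (f * g)" by (simp add: g)
    then have "monom (of_nat N) (N - 1) = pderiv f * g + f * pderiv g"
      by (simp add: pderiv_diff pderiv_monom pderiv_mult pderiv_1 algebra_simps)
    then have "ipoly (monom (of_nat N) (N - 1)) (z ^ p) = ipoly (pderiv f * g + f * pderiv g) (z ^ p)"
      by simp
    then have "of_nat N * (z ^ p) ^ (N - 1) = ipoly f (z ^ p) * ipoly (pderiv g) (z ^ p)"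
      using g0 by (simp add: poly_monom ipoly_add ipoly_mult)
    then have "of_nat N * (z ^ p) ^ (N - 1) * z ^ p = of_nat p * ipoly h z * ipoly (pderiv g) (z ^ p) * z ^ p"
      unfolding fp by simp
    then have "of_nat N * ((z ^ p) ^ (N - 1) * z ^ p) = of_nat p * ipoly h z * ipoly (pderiv g) (z ^ p) * z ^ p"
      by (simp only: mult.assoc)
    moreover have "(z ^ p) ^ (N - 1) * z ^ p = 1" using zp z(2)
      by (metis power_minus_mult)
    ultimately have N: "of_nat N = of_nat p * ipoly h z * ipoly (pderiv g) (z ^ p) * z ^ p"
      by (metis mult.right_neutral)
    define w where "w = h * pcompose (pderiv g) (monom 1 p) * monom 1 p"
    have "ipoly w z = ipoly h z * ipoly (pderiv g) (z ^ p) * z ^ p"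
      by (simp add: w_def ipoly_mult ipoly_monom of_int_hom.map_poly_pcompose poly_pcompose poly_monom)
    then have "ipoly ([:int N:] - smult (int p) w) z = 0"
      using N by (simp add: ipoly_diff ipoly_smult ipoly_const)
    then have "f dvd [:int N:] - smult (int p) w" by (rule f(1))
    then have dvd_w: "f dvd [:int N:] - smult (int p) w" .
    \<comment> \<open>Reducing \<open>w\<close> modulo the monic \<open>f\<close> brings the
      difference of \<open>N\<close> and \<open>p * r\<close> below the degree of \<open>f\<close>,
      so that divisibility by \<open>f\<close> makes it zero and the constant terms give
      \<open>p dvd N\<close>.\<close>
    obtain q r where qr: "pseudo_divmod w f = (q, r)" by (cases "pseudo_divmod w f")
    from pseudo_divmod[OF f(3) qr] f(4)
    have w: "w = f * q + r" and dr: "r = 0 \<or> degree r < degree f" by auto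
    have "[:int N:] - smult (int p) r =
        ([:int N:] - smult (int p) w) + f * smult (int p) q"
      by (simp add: w smult_add_right)
    then have "f dvd [:int N:] - smult (int p) r" using dvd_w by (simp only: dvd_add dvd_triv_left)
    moreover have deg_f: "degree f > 0"
    proof (rule ccontr)
      assume "\<not> degree f > 0"
      then have "f = [:1:]" using f(4) by (metis degree_eq_zeroE gr0I lead_coeff_pCons(2) degree_pCons_0 coeff_pCons_0)
      then show False using f(2) by simp
    qed
    moreover have "degree ([:int N:] - smult (int p) r) < degree f"
      using dr deg_f by (intro degree_diff_less) auto
    ultimately have "[:int N:] - smult (int p) r = 0"
      by (metis dvd_imp_degree_le not_le)
    then have "coeff ([:int N:] - smult (int p) r) 0 = 0" by simp
    then have "int N = int p * coeff r 0" by simp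
    then have "p dvd N" by (metis dvd_triv_left int_dvd_int_iff)
    then show False using p(2) by simp
  qed
  moreover obtain q where "P = f * q" using f(1)[OF P] by (auto simp: dvd_def)
  ultimately show ?thesis by (simp add: ipoly_mult)
qed

lemma root_of_unity_conjugate:
  fixes z :: complex
  assumes z: "z ^ N = 1" "N > 0" and m: "coprime m N" and P: "ipoly P z = 0"
  shows "ipoly P (z ^ m) = 0"
  using m
proof (induction m rule: prime_divisors_induct)
  case zero
  then have "N = 1" by simp
  then show ?case using z P by simp
next
  case (unit x)
  then show ?case using P by simp
next
  case (factor p x)
  have "ipoly P (z ^ x) = 0" using factor by simp
  moreover have "(z ^ x) ^ N = 1" using z by (metis power_mult power_one mult.commute)
  moreover have "\<not> p dvd N" using factor(1,3)
    by (metis coprime_common_divisor_nat coprime_mult_left_iff dvd_refl not_prime_1 One_nat_def)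
  ultimately have "ipoly P ((z ^ x) ^ p) = 0" using root_of_unity_prime_conjugate z(2) factor(1) by blast
  then show ?case by (simp add: power_mult[symmetric] mult.commute)
qed

section \<open>Character sums over units\<close>

text \<open>The primes dividing \<open>n\<close> have product at most \<open>n\<close>, so
  \<open>totient n ^ 4 / n ^ 3\<close> is at least the product of \<open>p * (1 - 1 / p) ^ 4\<close>
  over them. This factor is at least \<open>1\<close> from \<open>p = 5\<close> on, while
  \<open>p = 2\<close> and \<open>p = 3\<close> give \<open>1 / 8\<close> and
  \<open>16 / 27\<close>, with product \<open>2 / 27\<close>.\<close>

lemma totient_lower_bound:
  fixes n :: nat
  assumes "n > 0"
  shows "27 * real (totient n) ^ 4 \<ge> 2 * real n ^ 3"
proof -
  define A where "A = prime_factors n"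
  have fin: "finite A" by (simp add: A_def)
  have pA: "prime p" if "p \<in> A" for p using that by (auto simp: A_def)
  have "(\<Prod>p\<in>A. p) dvd n"
    using assms prime_factors_dvd unfolding A_def
    by (metis (no_types, lifting) prod_dvd_prod_subset2 prime_factorization_nat prod.cong dvd_power prime_factors_multiplicity mem_Collect_eq finite_set_mset order_refl)
  then have "(\<Prod>p\<in>A. p) \<le> n" using assms by (rule dvd_imp_le)
  then have le: "(\<Prod>p\<in>A. real p) \<le> real n" by (simp flip: of_nat_prod)
  define f where "f = (\<lambda>p::nat. real p * (1 - 1 / real p) ^ 4)"
  define c where "c = (\<lambda>p::nat. if p = 2 then 1/8 else if p = 3 then 16/27 else 1 :: real)"
  have cf: "c p \<le> f p" if pin: "p \<in> A" for p
  proof -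
    consider "p = 2" | "p = 3" | "p = 4" | "p \<ge> 5" using prime_ge_2_nat[OF pA[OF pin]] by linarith
    then show ?thesis
    proof cases
      case 4
      have "(1 - 1 / real p) ^ 4 \<ge> (4 / 5) ^ 4"
        using 4 by (intro power_mono) (auto simp: field_simps)
      then have "f p \<ge> real p * (4/5)^4" by (simp add: f_def mult_left_mono)
      moreover have "real p * (4/5)^4 \<ge> 1" using 4 by (simp add: field_simps)
      ultimately show ?thesis using 4 by (simp add: c_def)
    qed (use pA[OF pin] in \<open>auto simp: c_def f_def power_divide eval_nat_numeral\<close>)
  qed
  have "2/27 \<le> (\<Prod>p\<in>A. c p)"
  proof -
    have "(\<Prod>p\<in>A. c p) = (\<Prod>p\<in>A \<inter> {2,3}. c p)"
      using fin by (intro prod.mono_neutral_right) (auto simp: c_def)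
    moreover have "A \<inter> {2,3} \<in> {{},{2},{3},{2,3}}" by auto
    then have "2/27 \<le> (\<Prod>p\<in>A \<inter> {2,3}. c p)" by (auto simp: c_def)
    ultimately show ?thesis by simp
  qed
  also have "(\<Prod>p\<in>A. c p) \<le> (\<Prod>p\<in>A. f p)"
    using cf by (intro prod_mono) (auto simp: c_def)
  also have "\<dots> = (\<Prod>p\<in>A. real p) * (\<Prod>p\<in>A. 1 - 1 / real p) ^ 4"
    by (simp add: f_def prod.distrib prod_power_distrib)
  also have "\<dots> \<le> real n * (\<Prod>p\<in>A. 1 - 1 / real p) ^ 4"
    by (intro mult_right_mono le) simp
  also have "\<dots> = real (totient n) ^ 4 / real n ^ 3"
    using assms by (simp add: totient_formula2 A_def field_simps eval_nat_numeral)
  finally show ?thesis using assms by (simp add: field_simps)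
qed

text \<open>This is used as: \<open>R / totient R ^ 2\<close> becomes arbitrarily small for large
  \<open>R\<close>. The constant \<open>14\<close> rounds up \<open>27 / 2\<close> from the totient
  bound.\<close>

lemma totient_square_dominates:
  fixes B :: real
  assumes "B \<ge> 0" "real n \<ge> 14 * B\<^sup>2" "n > 0"
  shows "B * real n \<le> real (totient n) ^ 2"
proof -
  have "27 * (B * real n)^2 \<le> 27 * (real (totient n) ^ 2)^2"
  proof -
    have "27 * (B * real n)^2 = 27 * B\<^sup>2 * real n ^ 2" by (simp add: power_mult_distrib)
    also have "\<dots> \<le> 2 * real n * real n ^ 2" using assms
      by (intro mult_right_mono) (auto simp: zero_le_power2 order.trans[of _ "28 * B\<^sup>2"])
    also have "\<dots> = 2 * real n ^ 3" by (simp add: eval_nat_numeral)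
    also have "\<dots> \<le> 27 * real (totient n) ^ 4" by (rule totient_lower_bound[OF assms(3)])
    finally show ?thesis by simp
  qed
  then have "(B * real n)^2 \<le> (real (totient n) ^ 2)^2" by simp
  then show ?thesis by (rule power2_le_imp_le) simp
qed

text \<open>Each prime of \<open>N\<close> divides exactly one of \<open>d\<close> and
  \<open>R * t\<close>, where \<open>t\<close> collects the primes of \<open>N\<close> that divide
  neither \<open>d\<close> nor \<open>R\<close>. Hence none divides the sum
  \<open>d + R * t\<close>.\<close>

lemma coprime_lift:
  fixes R N d :: nat
  assumes "R dvd N" "N > 0" "coprime d R"
  obtains x where "x < N" "coprime x N" "[x = d] (mod R)"
proof -
  define A where "A = {p \<in> prime_factors N. \<not> p dvd d \<and> \<not> p dvd R}"
  define t where "t = \<Prod>A"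
  define y where "y = d + R * t"
  have finA: "finite A" by (simp add: A_def)
  have t_dvd: "p dvd t \<longleftrightarrow> p \<in> A" if p: "prime p" for p
  proof
    assume "p dvd t"
    then obtain q where "q \<in> A" "p dvd q"
      using prime_dvd_prod_iff[OF finA p, of id] by (auto simp: t_def)
    moreover from this have "q = p" using p primes_dvd_imp_eq[of p q] by (auto simp: A_def)
    ultimately show "p \<in> A" by simp
  next
    assume "p \<in> A"
    then show "p dvd t" unfolding t_def by (rule dvd_prodI[OF finA])
  qed
  have "coprime y N"
  proof (rule ccontr)
    assume "\<not> coprime y N"
    then have "gcd y N \<noteq> 1" by (metis coprime_iff_gcd_eq_1)
    then obtain p where p: "prime p" "p dvd y" "p dvd N"
      using prime_factor_nat by (metis gcd_dvd1 gcd_dvd2 dvd_trans)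
    have pN: "p \<in> prime_factors N" using p assms(2) by (simp add: prime_factors_dvd)
    show False
    proof (cases "p dvd R")
      case True
      then have "p dvd d" using p(2) by (simp add: y_def dvd_add_left_iff)
      then show False using True assms(3) p(1) by (metis coprime_common_divisor_nat not_prime_1 One_nat_def)
    next
      case False
      show False
      proof (cases "p dvd d")
        case True
        then have "p dvd R * t" using p(2) by (simp add: y_def dvd_add_right_iff)
        then have "p dvd t" using False p(1) by (simp add: prime_dvd_mult_iff)
        then have "p \<in> A" using t_dvd p(1) by blast
        then show False using True by (simp add: A_def)
      next
        case d: False
        then have "p dvd t" using t_dvd p(1) pN False by (simp add: A_def)
        then have "p dvd d" using p(2) by (simp add: y_def dvd_add_left_iff)
        then show False using d by simp
      qed
    qed
  qed
  then have "coprime (y mod N) N" using assms(2) by simp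
  moreover have "y mod N < N" using assms(2) by simp
  moreover have "[y mod N = d] (mod R)"
    using assms(1) by (simp add: Cong.cong_def mod_mod_cancel y_def)
  ultimately show ?thesis using that by blast
qed

text \<open>Representatives are taken below \<open>N\<close>, unlike in \<open>totatives\<close>, so
  that reduction modulo \<open>N\<close> stays inside the set even for \<open>N = 1\<close>.\<close>

definition units_mod :: "nat \<Rightarrow> nat set" where
  "units_mod N = {x. x < N \<and> coprime x N}"

lemma finite_units_mod [simp]: "finite (units_mod N)"
  by (simp add: units_mod_def)

lemma card_units_mod: 
  assumes "N > 0"
  shows "card (units_mod N) = totient N"
proof (cases "N = 1")
  case True
  then have "units_mod N = {0}" by (auto simp: units_mod_def)
  then show ?thesis using True by simp
next
  case False
  have "units_mod N = totatives N"
    using False assms by (auto simp: units_mod_def in_totatives_iff intro!: Nat.gr0I le_neq_implies_less)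
  then show ?thesis by (simp add: totient_def)
qed

lemma bij_betw_mult_units_mod:
  assumes "g \<in> units_mod N"
  shows "bij_betw (\<lambda>m. g * m mod N) (units_mod N) (units_mod N)"
proof -
  have N: "N > 0" using assms by (auto simp: units_mod_def)
  have "inj_on (\<lambda>m. g * m mod N) (units_mod N)"
  proof (rule inj_onI)
    fix x y assume xy: "x \<in> units_mod N" "y \<in> units_mod N" "g * x mod N = g * y mod N"
    then have "[g * x = g * y] (mod N)" by (simp only: Cong.cong_def)
    then have "[x = y] (mod N)" using assms by (simp add: cong_mult_lcancel_nat units_mod_def)
    then show "x = y" using xy by (simp add: Cong.cong_def units_mod_def)
  qed
  moreover have "(\<lambda>m. g * m mod N) ` units_mod N \<subseteq> units_mod N"
    using assms N by (auto simp: units_mod_def)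
  ultimately show ?thesis 
    by (simp add: bij_betw_def endo_inj_surj)
qed

text \<open>A crude bound for a Ramanujan sum. Multiplication by lifted units shows that all
  \<open>\<omega> ^ d\<close> with \<open>d\<close> coprime to \<open>R\<close> have the same sum,
  and Parseval over all \<open>R\<close> powers bounds the total of the squares, since a class
  modulo \<open>R\<close> contains at most \<open>totient N / totient R\<close> units.\<close>

lemma norm_unit_sum_le:
  fixes \<omega> :: complex
  assumes R: "R dvd N" "N > 0" and ord: "\<And>x y. \<omega> ^ x = \<omega> ^ y \<longleftrightarrow> [x = y] (mod R)"
  shows "(norm (\<Sum>m\<in>units_mod N. \<omega> ^ m))\<^sup>2 * real (totient R) ^ 2 \<le> real R * real (totient N) ^ 2"
proof -
  let ?U = "units_mod N" and ?V = "units_mod R"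
  define S where "S = (\<lambda>c. \<Sum>m\<in>?U. (\<omega> ^ c) ^ m)"
  have R0: "R > 0" using R by (auto intro: Nat.gr0I)
  have wR: "\<omega> ^ R = 1" using ord[of R 0] by (simp add: cong_0_iff)
  have nw: "norm \<omega> = 1" using power_eq_1_iff[OF wR] R0 by simp
  have lift: "\<exists>x. x \<in> ?U \<and> [x = d] (mod R)" if "d \<in> ?V" for d
    using coprime_lift[OF R, of d] that by (auto simp: units_mod_def)
  then obtain l where l: "\<And>d. d \<in> ?V \<Longrightarrow> l d \<in> ?U \<and> [l d = d] (mod R)" by metis
  have Sconst: "S d = S 1" if "d \<in> ?V" for d
  proof -
    have b: "bij_betw (\<lambda>m. l d * m mod N) ?U ?U" using l[OF that] by (intro bij_betw_mult_units_mod) simp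
    have "S 1 = (\<Sum>m\<in>?U. \<omega> ^ (l d * m mod N))"
      unfolding S_def using sum.reindex_bij_betw[OF b, of "\<lambda>m. \<omega> ^ m"] by simp
    also have "\<dots> = (\<Sum>m\<in>?U. (\<omega> ^ d) ^ m)"
    proof (rule sum.cong[OF refl])
      fix m
      have "[l d * m mod N = l d * m] (mod R)" using R(1) by (simp add: Cong.cong_def mod_mod_cancel)
      also have "[l d * m = d * m] (mod R)" using l[OF that] by (simp add: cong_scalar_right)
      finally have "\<omega> ^ (l d * m mod N) = \<omega> ^ (d * m)" using ord by blast
      then show "\<omega> ^ (l d * m mod N) = (\<omega> ^ d) ^ m" by (simp add: power_mult)
    qed
    finally show ?thesis by (simp add: S_def)
  qed
  \<comment> \<open>Multiplication by the lifts \<open>l d\<close> carries the class of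
    \<open>m\<close> injectively to pairwise disjoint sets of units, one for each
    \<open>d\<close>.\<close>
  have fibre: "card {m' \<in> ?U. [m' = m] (mod R)} * totient R \<le> totient N" if m: "m \<in> ?U" for m
  proof -
    let ?F = "{m' \<in> ?U. [m' = m] (mod R)}"
    have cm: "coprime m R" using m R coprime_divisors[OF dvd_refl R(1)] by (auto simp: units_mod_def)
    have "inj_on (\<lambda>(d, m'). l d * m' mod N) (?V \<times> ?F)"
    proof (rule inj_onI, clarify)
      fix d a e b assume h: "d \<in> ?V" "e \<in> ?V" "a \<in> ?U" "b \<in> ?U" "[a = m] (mod R)" "[b = m] (mod R)"
        and eq: "l d * a mod N = l e * b mod N"
      have "[l d * a = l e * b] (mod N)" using eq by (simp only: Cong.cong_def)
      then have "[l d * a = l e * b] (mod R)" using R(1) by (rule cong_dvd_modulus_nat)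
      moreover have "[l d * a = d * m] (mod R)" using l[OF h(1)] h(5) by (simp add: cong_mult)
      moreover have "[l e * b = e * m] (mod R)" using l[OF h(2)] h(6) by (simp add: cong_mult)
      ultimately have "[d * m = e * m] (mod R)" by (meson cong_sym cong_trans)
      then have "[d = e] (mod R)" using cm by (simp add: cong_mult_rcancel_nat)
      then have de: "d = e" using h by (simp add: Cong.cong_def units_mod_def)
      then have "[l d * a = l d * b] (mod N)" using eq by (simp only: Cong.cong_def)
      then have "[a = b] (mod N)" using l[OF h(1)] by (simp add: cong_mult_lcancel_nat units_mod_def)
      then show "d = e \<and> a = b" using h de by (simp add: Cong.cong_def units_mod_def)
    qed
    moreover have "(\<lambda>(d, m'). l d * m' mod N) ` (?V \<times> ?F) \<subseteq> ?U"
      using l R(2) by (auto simp: units_mod_def)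
    ultimately have "card (?V \<times> ?F) \<le> card ?U" by (intro card_inj_on_le) auto
    then show ?thesis using R R0 by (simp add: card_cartesian_product card_units_mod mult.commute)
  qed
  have orth: "(\<Sum>c<R. (\<omega> ^ c) ^ m * cnj ((\<omega> ^ c) ^ m')) = (if [m' = m] (mod R) then of_nat R else 0)" for m m'
  proof -
    define z where "z = \<omega> ^ m * cnj (\<omega> ^ m')"
    have "(\<omega> ^ c) ^ m * cnj ((\<omega> ^ c) ^ m') = z ^ c" for c
      by (simp add: z_def power_mult_distrib power_mult[symmetric] mult.commute)
    then have eq: "(\<Sum>c<R. (\<omega> ^ c) ^ m * cnj ((\<omega> ^ c) ^ m')) = (\<Sum>c<R. z ^ c)" by simp
    have nz: "cnj (\<omega> ^ m') = inverse (\<omega> ^ m')"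
      using nw by (intro inverse_unique[symmetric]) (simp add: complex_norm_square[symmetric] norm_power del: complex_cnj_power)
    have z1: "z = 1 \<longleftrightarrow> [m' = m] (mod R)"
    proof -
      have "\<omega> \<noteq> 0" using nw by auto
      then have "z = 1 \<longleftrightarrow> \<omega> ^ m = \<omega> ^ m'" unfolding z_def nz by (auto simp: field_simps)
      then show ?thesis using ord cong_sym by blast
    qed
    have "(\<omega> ^ k) ^ R = 1" for k using wR by (metis power_commutes power_mult power_one mult.commute)
    then have zR: "z ^ R = 1" unfolding z_def power_mult_distrib
      by (metis complex_cnj_one complex_cnj_power mult_1)
    show ?thesis
    proof (cases "z = 1")
      case True
      then show ?thesis using z1 eq by simp
    next
      case False
      then have "(\<Sum>c<R. z ^ c) = 0" using zR by (simp add: geometric_sum)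
      then show ?thesis using False z1 eq by simp
    qed
  qed
  have "complex_of_real (\<Sum>c<R. (norm (S c))\<^sup>2) = (\<Sum>c<R. S c * cnj (S c))"
    by (simp only: of_real_sum complex_norm_square)
  also have "\<dots> = (\<Sum>c<R. \<Sum>m\<in>?U. \<Sum>m'\<in>?U. (\<omega> ^ c) ^ m * cnj ((\<omega> ^ c) ^ m'))"
    by (simp add: S_def sum_product)
  also have "\<dots> = (\<Sum>m\<in>?U. \<Sum>c<R. \<Sum>m'\<in>?U. (\<omega> ^ c) ^ m * cnj ((\<omega> ^ c) ^ m'))"
    by (rule sum.swap)
  also have "\<dots> = (\<Sum>m\<in>?U. \<Sum>m'\<in>?U. \<Sum>c<R. (\<omega> ^ c) ^ m * cnj ((\<omega> ^ c) ^ m'))"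
    by (intro sum.cong refl sum.swap)
  also have "\<dots> = (\<Sum>m\<in>?U. \<Sum>m'\<in>?U. (if [m' = m] (mod R) then of_nat R else 0))"
    by (simp only: orth)
  also have "\<dots> = (\<Sum>m\<in>?U. of_nat (R * card {m' \<in> ?U. [m' = m] (mod R)}))"
    by (intro sum.cong refl) (simp add: sum.If_cases Int_def mult.commute)
  also have "\<dots> = complex_of_real (\<Sum>m\<in>?U. real R * real (card {m' \<in> ?U. [m' = m] (mod R)}))" by simp
  finally have parseval: "(\<Sum>c<R. (norm (S c))\<^sup>2) = (\<Sum>m\<in>?U. real R * real (card {m' \<in> ?U. [m' = m] (mod R)}))"
    using of_real_eq_iff by blast
  have "real (totient R) * (norm (S 1))\<^sup>2 = (\<Sum>c\<in>?V. (norm (S c))\<^sup>2)"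
    using Sconst R0 by (simp add: card_units_mod)
  also have "\<dots> \<le> (\<Sum>c<R. (norm (S c))\<^sup>2)"
    by (intro sum_mono2) (auto simp: units_mod_def)
  finally have "real (totient R) * (norm (S 1))\<^sup>2 * real (totient R) \<le> 
     (\<Sum>m\<in>?U. real R * real (card {m' \<in> ?U. [m' = m] (mod R)})) * real (totient R)"
    unfolding parseval by (intro mult_right_mono) auto
  also have "\<dots> = (\<Sum>m\<in>?U. real R * real (card {m' \<in> ?U. [m' = m] (mod R)} * totient R))"
    by (simp add: sum_distrib_right mult.assoc)
  also have "\<dots> \<le> (\<Sum>m\<in>?U. real R * real (totient N))"
    using fibre by (intro sum_mono mult_left_mono) (auto simp del: of_nat_mult)
  also have "\<dots> = real R * real (totient N) ^ 2"
    using R(2) by (simp add: card_units_mod power2_eq_square)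
  finally show ?thesis by (simp add: S_def power2_eq_square mult_ac)
qed

section \<open>Simultaneous approximation on the circle\<close>

text \<open>Angles stay rational throughout, since \<open>\<tau>\<close> and \<open>h\<close> have
  rational values. So even the limits of the conjugated eigenvalues are roots of unity, and
  arguments with periodic sequences apply to them.\<close>

definition ee :: "rat \<Rightarrow> complex" where
  "ee q = cis (2 * pi * of_rat q)"

lemma ee_add: "ee (p + q) = ee p * ee q"
  by (simp add: ee_def cis_mult of_rat_add distrib_left)

lemma ee_0 [simp]: "ee 0 = 1"
  by (simp add: ee_def)

lemma ee_minus: "ee (- q) = cnj (ee q)"
  by (simp add: ee_def of_rat_minus cis_cnj)

lemma norm_ee [simp]: "norm (ee q) = 1"
  by (simp add: ee_def)

lemma ee_nonzero [simp]: "ee q \<noteq> 0"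
  by (metis norm_ee norm_zero zero_neq_one)

lemma ee_diff: "ee (p - q) = ee p / ee q"
proof -
  have "ee p = ee (p - q) * ee q" by (simp flip: ee_add)
  then show ?thesis by simp
qed

lemma ee_of_nat_mult: "ee (of_nat m * q) = ee q ^ m"
  by (induction m) (simp_all add: distrib_right ee_add)

lemma ee_sum: "ee (sum f A) = (\<Prod>j\<in>A. ee (f j))"
  by (induction A rule: infinite_finite_induct) (simp_all add: ee_add)

lemma ee_eq_1_iff: "ee q = 1 \<longleftrightarrow> q \<in> \<int>"
proof
  assume "ee q = 1"
  then have "cos (2 * pi * of_rat q) = 1"
    by (simp add: ee_def complex_eq_iff)
  then obtain n :: int where "2 * pi * of_rat q = of_int n * 2 * pi"
    using cos_one_2pi_int by auto
  then have "of_rat q = (of_int n :: real)" by simp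
  then have "q = of_int n" by (metis of_rat_eq_iff of_rat_of_int_eq)
  then show "q \<in> \<int>" by simp
next
  assume "q \<in> \<int>"
  then obtain n where "q = of_int n" by (auto elim: Ints_cases)
  then show "ee q = 1" by (simp add: ee_def cis_multiple_2pi)
qed

lemma ee_eq_iff: "ee p = ee q \<longleftrightarrow> p - q \<in> \<int>"
  by (metis ee_diff ee_eq_1_iff ee_nonzero right_inverse_eq)

lemma norm_ee_minus_1_le: "norm (ee q - 1) \<le> 2 * pi * \<bar>of_rat q\<bar>"
proof -
  define x :: real where "x = pi * of_rat q"
  have "(norm (ee q - 1))\<^sup>2 = (cos (2 * x) - 1)\<^sup>2 + (sin (2 * x))\<^sup>2"
    by (simp add: ee_def x_def cmod_power2 mult.assoc)
  also have "\<dots> = (sin (2 * x))\<^sup>2 + (cos (2 * x))\<^sup>2 + 1 - 2 * cos (2 * x)"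
    by (simp add: power2_eq_square algebra_simps)
  also have "\<dots> = 2 - 2 * cos (2 * x)" by (simp only: sin_cos_squared_add)
  also have "\<dots> = (2 * sin x)\<^sup>2"
    by (simp add: cos_double_sin power2_eq_square)
  finally have "norm (ee q - 1) = \<bar>2 * sin x\<bar>"
    by (metis norm_ge_zero power2_eq_iff_nonneg abs_ge_zero power2_abs)
  also have "\<dots> \<le> 2 * \<bar>x\<bar>" by (simp add: abs_mult abs_sin_x_le_abs_x)
  finally show ?thesis by (simp add: x_def abs_mult)
qed

text \<open>Exponential decay beats polynomial decay. The left side will bound a product of kernels
  with one coordinate off its target, the right side is half the lower bound for the weight of the
  constant terms.\<close>

lemma simultaneous_kernel_parameters:
  fixes \<epsilon> :: real
  assumes "0 < \<epsilon>" "\<epsilon> \<le> 1"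
  obtains Q :: nat where "Q > 0" "(1 - \<epsilon>\<^sup>2 / 4) ^ Q < (1 / (2 * real Q)) ^ r / 2"
proof -
  define q where "q = 1 - \<epsilon>\<^sup>2 / 4"
  have "\<epsilon>\<^sup>2 \<le> 1" using assms by (simp add: power_le_one)
  then have q: "0 < q" "q < 1" using assms by (auto simp: q_def)
  \<comment> \<open>With \<open>s ^ (r + 1) = q\<close>, each of the \<open>r\<close> factors
    \<open>2 * n\<close> is absorbed by its own \<open>s ^ n\<close>, and one \<open>s ^ n\<close>
    is left over for the factor \<open>1 / 2\<close>.\<close>
  define s where "s = root (Suc r) q"
  have s: "0 < s" "s < 1" "s ^ Suc r = q"
    using q real_root_pow_pos2[of "Suc r" q] by (auto simp: s_def)
  have "(\<lambda>n. real n * s ^ n) \<longlonglongrightarrow> 0"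
    by (rule powser_times_n_limit_0) (use s in auto)
  then have "eventually (\<lambda>n. real n * s ^ n < 1 / 4) sequentially"
    by (rule order_tendstoD) simp
  moreover have "eventually (\<lambda>n. n > 0) sequentially" by (rule eventually_gt_at_top)
  moreover have "(\<lambda>n. s ^ n) \<longlonglongrightarrow> 0" using s by (intro LIMSEQ_power_zero) simp
  then have "eventually (\<lambda>n. s ^ n < 1 / 2) sequentially" by (rule order_tendstoD) simp
  ultimately have "eventually (\<lambda>n. n > 0 \<and> real n * s ^ n < 1 / 4 \<and> s ^ n < 1 / 2) sequentially"
    by eventually_elim auto
  then obtain n where n: "n > 0" "real n * s ^ n < 1 / 4" "s ^ n < 1 / 2"
    by (metis (no_types, lifting) eventually_sequentially order_refl)
  have "q ^ n * (2 * real n) ^ r = s ^ n * (2 * (real n * s ^ n)) ^ r"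
    unfolding s(3)[symmetric] by (simp add: power_mult_distrib power_mult[symmetric] power_add algebra_simps)
  also have "\<dots> \<le> s ^ n * 1"
    using n s by (intro mult_left_mono power_le_one) auto
  also have "\<dots> < 1 / 2" using n by simp
  finally have "q ^ n < (1 / (2 * real n)) ^ r / 2" using n(1) by (simp add: field_simps power_divide)
  then show ?thesis using that[OF n(1)] by (simp add: q_def)
qed

text \<open>A quantitative Kronecker theorem over the units. The kernel \<open>K\<close> peaks at
  \<open>1\<close> and has nonnegative Fourier coefficients. Without a good \<open>m\<close> the sum
  \<open>A\<close> of its products would be tiny. But the constant terms contribute at least
  \<open>2 * \<eta> * totient N\<close>, frequencies that are integral on both \<open>v\<close> and
  \<open>h\<close> contribute nonnegatively, and by \<open>small\<close> all others take away at
  most \<open>\<eta> * totient N\<close>.\<close>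

lemma simultaneous_kernel_approximation:
  fixes v h :: "nat \<Rightarrow> rat" and \<epsilon> :: real
  assumes eps: "0 < \<epsilon>" "\<epsilon> \<le> 1" and Q: "Q > 0" "(1 - \<epsilon>\<^sup>2 / 4) ^ Q < (1 / (2 * real Q)) ^ r / 2"
    and N: "N > 0"
    and small: "\<And>e. (\<And>j. j < r \<Longrightarrow> \<bar>e j\<bar> \<le> int Q) \<Longrightarrow>
        ((\<Sum>j<r. of_int (e j) * v j) \<in> \<int> \<and> (\<Sum>j<r. of_int (e j) * h j) \<in> \<int>)
        \<or> norm (\<Sum>m\<in>units_mod N. ee (of_nat m * (\<Sum>j<r. of_int (e j) * v j)))
            \<le> (1 / (2 * real Q)) ^ r / 2 * real (totient N)"
  shows "\<exists>m\<in>units_mod N. \<forall>j<r. norm (ee (of_nat m * v j) - ee (h j)) < \<epsilon>"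
proof (rule ccontr)
  assume contra: "\<not> ?thesis"
  define \<eta> where "\<eta> = (1 / (2 * real Q)) ^ r / 2"
  let ?U = "units_mod N" and ?P = "{..Q} \<times> {..Q}"
  \<comment> \<open>The coefficient of \<open>z ^ a * cnj z ^ b\<close> in the binomial expansion of
    \<open>K z\<close>.\<close>
  define C where "C = (\<lambda>(a::nat,b::nat). real ((Q choose a) * (Q choose b)) / 4 ^ Q)"
  define z where "z = (\<lambda>m j. ee (of_nat m * v j - h j))"
  define K where "K = (\<lambda>z::complex. (norm (1 + z))\<^sup>2 ^ Q / 4 ^ Q)"
  define w where "w = (\<lambda>f :: nat \<Rightarrow> nat \<times> nat. \<Prod>j<r. C (f j))"
  define E where "E = (\<lambda>(f :: nat \<Rightarrow> nat \<times> nat) j. int (fst (f j)) - int (snd (f j)))"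
  define V where "V = (\<lambda>f. \<Sum>j<r. of_int (E f j) * v j)"
  define H where "H = (\<lambda>f. \<Sum>j<r. of_int (E f j) * h j)"
  let ?I = "PiE {..<r} (\<lambda>_. ?P)"
  have finI: "finite ?I" by (intro finite_PiE) auto
  have C0: "C p \<ge> 0" for p by (auto simp: C_def split: prod.split)
  have w0: "w f \<ge> 0" for f by (auto simp: w_def intro!: prod_nonneg C0)
  have K_expand: "complex_of_real (K (ee q)) = (\<Sum>p\<in>?P. of_real (C p) * ee (of_int (int (fst p) - int (snd p)) * q))" for q
  proof -
    have "complex_of_real (K (ee q)) = ((1 + ee q) * cnj (1 + ee q)) ^ Q / 4 ^ Q"
      unfolding K_def using complex_norm_square[of "1 + ee q"]
      by (simp only: of_real_divide of_real_power of_real_numeral)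
    also have "\<dots> = (ee q + 1) ^ Q * (cnj (ee q) + 1) ^ Q / 4 ^ Q"
      by (simp add: power_mult_distrib add.commute)
    also have "\<dots> = (\<Sum>a\<le>Q. of_nat (Q choose a) * ee q ^ a) * (\<Sum>b\<le>Q. of_nat (Q choose b) * cnj (ee q) ^ b) / 4 ^ Q"
      by (simp add: binomial_ring)
    also have "\<dots> = (\<Sum>(a,b)\<in>?P. of_nat (Q choose a) * ee q ^ a * (of_nat (Q choose b) * cnj (ee q) ^ b)) / 4 ^ Q"
      by (simp add: sum_product sum.cartesian_product)
    also have "\<dots> = (\<Sum>p\<in>?P. of_real (C p) * ee (of_int (int (fst p) - int (snd p)) * q))"
      unfolding sum_divide_distrib
    proof (rule sum.cong[OF refl], clarify)
      fix a b
      have "ee (of_int (int a - int b) * q) = ee (of_nat a * q + - (of_nat b * q))"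
        by (simp add: algebra_simps)
      also have "\<dots> = ee q ^ a * cnj (ee q) ^ b"
        by (simp only: ee_add ee_minus ee_of_nat_mult complex_cnj_power)
      finally show "of_nat (Q choose a) * ee q ^ a * (of_nat (Q choose b) * cnj (ee q) ^ b) / 4 ^ Q
          = of_real (C (a, b)) * ee (of_int (int (fst (a,b)) - int (snd (a,b))) * q)"
        by (simp add: C_def)
    qed
    finally show ?thesis .
  qed
  have prod_K: "complex_of_real (\<Prod>j<r. K (z m j)) = (\<Sum>f\<in>?I. of_real (w f) * (ee (of_nat m * V f) * cnj (ee (H f))))" for m
  proof -
    have "complex_of_real (\<Prod>j<r. K (z m j)) = 
      (\<Prod>j<r. \<Sum>p\<in>?P. of_real (C p) * ee (of_int (int (fst p) - int (snd p)) * (of_nat m * v j - h j)))"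
      by (simp add: z_def K_expand)
    also have "\<dots> = (\<Sum>f\<in>?I. \<Prod>j<r. of_real (C (f j)) * ee (of_int (E f j) * (of_nat m * v j - h j)))"
      by (subst prod_sum_PiE) (auto simp: E_def)
    also have "\<dots> = (\<Sum>f\<in>?I. of_real (w f) * (ee (of_nat m * V f) * cnj (ee (H f))))"
    proof (rule sum.cong[OF refl])
      fix f
      have "(\<Prod>j<r. ee (of_int (E f j) * (of_nat m * v j - h j))) = ee (of_nat m * V f - H f)"
        by (simp add: ee_sum[symmetric] V_def H_def sum_distrib_left sum_subtractf[symmetric] algebra_simps)
      also have "\<dots> = ee (of_nat m * V f) * cnj (ee (H f))"
        unfolding diff_conv_add_uminus ee_add ee_minus ..
      finally show "(\<Prod>j<r. of_real (C (f j)) * ee (of_int (E f j) * (of_nat m * v j - h j)))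
        = of_real (w f) * (ee (of_nat m * V f) * cnj (ee (H f)))"
        by (simp add: prod.distrib w_def)
    qed
    finally show ?thesis .
  qed
  define A where "A = (\<Sum>m\<in>?U. \<Prod>j<r. K (z m j))"
  define c where "c = (\<lambda>f. Re ((\<Sum>m\<in>?U. ee (of_nat m * V f)) * cnj (ee (H f))))"
  have A_eq: "A = (\<Sum>f\<in>?I. w f * c f)"
  proof -
    have "complex_of_real A = (\<Sum>m\<in>?U. \<Sum>f\<in>?I. of_real (w f) * (ee (of_nat m * V f) * cnj (ee (H f))))"
      unfolding A_def of_real_sum prod_K ..
    also have "\<dots> = (\<Sum>f\<in>?I. of_real (w f) * ((\<Sum>m\<in>?U. ee (of_nat m * V f)) * cnj (ee (H f))))"
      by (subst sum.swap) (simp add: sum_distrib_left sum_distrib_right)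
    finally have "Re (complex_of_real A) = Re (\<Sum>f\<in>?I. of_real (w f) * ((\<Sum>m\<in>?U. ee (of_nat m * V f)) * cnj (ee (H f))))"
      by simp
    then show ?thesis by (simp add: c_def del: complex_cnj_mult)
  qed
  have c_lower: "c f \<ge> - \<eta> * real (totient N)" if f: "f \<in> ?I" for f
  proof -
    have "\<bar>E f j\<bar> \<le> int Q" if "j < r" for j
    proof -
      have "f j \<in> ?P" using f that by auto
      then show ?thesis by (auto simp: E_def mem_Times_iff)
    qed
    then consider "V f \<in> \<int>" "H f \<in> \<int>" 
      | "norm (\<Sum>m\<in>?U. ee (of_nat m * V f)) \<le> \<eta> * real (totient N)"
      using small[of "E f"] by (auto simp: V_def H_def \<eta>_def)
    then show ?thesis
    proof cases
      case 1
      then have "ee (V f) = 1" "ee (H f) = 1" by (auto simp: ee_eq_1_iff)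
      then have "c f = real (card ?U)" by (simp add: c_def ee_of_nat_mult)
      moreover have "\<eta> \<ge> 0" by (simp add: \<eta>_def)
      ultimately show ?thesis by (simp add: order.trans[of _ 0])
    next
      case 2
      have "\<bar>c f\<bar> \<le> norm ((\<Sum>m\<in>?U. ee (of_nat m * V f)) * cnj (ee (H f)))"
        unfolding c_def by (rule abs_Re_le_cmod)
      also have "\<dots> \<le> \<eta> * real (totient N)" using 2 by (simp add: norm_mult)
      finally show ?thesis by linarith
    qed
  qed
  \<comment> \<open>Pairs with equal exponents have frequency \<open>0\<close>. In each coordinate
    their weight is the central binomial coefficient over \<open>4 ^ Q\<close>, which is at least
    \<open>1 / (2 * Q)\<close>.\<close>
  let ?D = "(\<lambda>a. (a, a)) ` {..Q}"
  let ?ID = "PiE {..<r} (\<lambda>_. ?D)"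
  have D_sub: "?ID \<subseteq> ?I" by (intro PiE_mono) auto
  have c_diag: "c f = real (totient N)" if f: "f \<in> ?ID" for f
  proof -
    have "E f j = 0" if "j < r" for j
    proof -
      have "f j \<in> ?D" using f that by auto
      then show ?thesis by (auto simp: E_def)
    qed
    then have "V f = 0" "H f = 0" by (simp_all add: V_def H_def)
    then show ?thesis using N by (simp add: c_def card_units_mod)
  qed
  have sum_w: "(\<Sum>f\<in>?I. w f) = 1"
  proof -
    have "(\<Sum>p\<in>?P. C p) = 1"
    proof -
      have "(\<Sum>p\<in>?P. C p) = (\<Sum>a\<le>Q. real (Q choose a)) * (\<Sum>a\<le>Q. real (Q choose a)) / 4 ^ Q"
        by (simp add: C_def sum_product sum.cartesian_product sum_divide_distrib split_beta)
      also have "(\<Sum>a\<le>Q. real (Q choose a)) = 2 ^ Q"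
        using choose_row_sum[of Q] by (metis of_nat_sum of_nat_power of_nat_numeral)
      finally show ?thesis by (simp add: power_mult_distrib[symmetric])
    qed
    moreover have "(\<Prod>j<r. \<Sum>p\<in>?P. C p) = (\<Sum>f\<in>?I. \<Prod>j<r. C (f j))"
      by (subst prod_sum_PiE) auto
    ultimately show ?thesis by (simp add: w_def)
  qed
  have sum_diag: "(\<Sum>f\<in>?ID. w f) \<ge> 2 * \<eta>"
  proof -
    have "(\<Sum>p\<in>?D. C p) \<ge> 1 / (2 * real Q)"
    proof -
      have "(\<Sum>p\<in>?D. C p) = (\<Sum>a\<le>Q. C (a, a))" by (subst sum.reindex) (auto simp: inj_on_def)
      also have "\<dots> = real (\<Sum>a\<le>Q. (Q choose a)\<^sup>2) / 4 ^ Q"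
        by (simp add: C_def sum_divide_distrib power2_eq_square)
      also have "\<dots> = real ((2 * Q) choose Q) / 4 ^ Q" by (simp only: choose_square_sum)
      finally show ?thesis using divide_right_mono[OF central_binomial_lower_bound[OF Q(1)], of "4 ^ Q"] by simp
    qed
    then have "(1 / (2 * real Q)) ^ r \<le> (\<Sum>p\<in>?D. C p) ^ r" by (intro power_mono) auto
    also have "\<dots> = (\<Prod>j<r. \<Sum>p\<in>?D. C p)" by simp
    also have "\<dots> = (\<Sum>f\<in>?ID. \<Prod>j<r. C (f j))"
      by (subst prod_sum_PiE) auto
    finally show ?thesis by (simp add: w_def \<eta>_def)
  qed
  have "A \<ge> \<eta> * real (totient N)"
  proof -
    have "A = (\<Sum>f\<in>?ID. w f * c f) + (\<Sum>f\<in>?I - ?ID. w f * c f)"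
      unfolding A_eq using sum.subset_diff[OF D_sub finI] by (simp add: add.commute)
    also have "(\<Sum>f\<in>?ID. w f * c f) = (\<Sum>f\<in>?ID. w f) * real (totient N)"
      by (simp add: c_diag sum_distrib_right)
    also have "(\<Sum>f\<in>?ID. w f) * real (totient N) \<ge> 2 * \<eta> * real (totient N)"
      by (intro mult_right_mono sum_diag) simp
    moreover have "(\<Sum>f\<in>?I - ?ID. w f * c f) \<ge> - \<eta> * real (totient N)"
    proof -
      have "(\<Sum>f\<in>?I - ?ID. w f * c f) \<ge> (\<Sum>f\<in>?I - ?ID. w f * (- \<eta> * real (totient N)))"
        using c_lower w0 by (intro sum_mono mult_left_mono) auto
      also have "(\<Sum>f\<in>?I - ?ID. w f * (- \<eta> * real (totient N))) = - ((\<Sum>f\<in>?I - ?ID. w f) * (\<eta> * real (totient N)))"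
        by (simp add: sum_distrib_right sum_negf)
      moreover have "(\<Sum>f\<in>?I - ?ID. w f) \<le> 1" unfolding sum_w[symmetric]
        using finI w0 by (intro sum_mono2) auto
      then have "(\<Sum>f\<in>?I - ?ID. w f) * (\<eta> * real (totient N)) \<le> 1 * (\<eta> * real (totient N))"
        by (rule mult_right_mono) (simp add: \<eta>_def)
      ultimately show ?thesis by linarith
    qed
    ultimately show ?thesis by (simp add: algebra_simps)
  qed
  moreover have "A \<le> real (totient N) * (1 - \<epsilon>\<^sup>2 / 4) ^ Q"
  proof -
    have "(\<Prod>j<r. K (z m j)) \<le> (1 - \<epsilon>\<^sup>2 / 4) ^ Q" if m: "m \<in> ?U" for m
    proof -
      obtain j where j: "j < r" "norm (ee (of_nat m * v j) - ee (h j)) \<ge> \<epsilon>"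
        using contra m by (auto simp: not_less)
      have nz: "norm (z m j) = 1" for j by (simp add: z_def)
      have sq: "(norm (1 + z m j))\<^sup>2 = 4 - (norm (z m j - 1))\<^sup>2" for j
      proof -
        have "(Re (z m j))\<^sup>2 + (Im (z m j))\<^sup>2 = 1" using nz[of j] by (metis cmod_power2 power_one)
        then show ?thesis unfolding cmod_power2 by (simp add: power2_eq_square algebra_simps)
      qed
      have K1: "K (z m j) \<le> 1" for j
        unfolding K_def sq by (auto simp: divide_le_eq_1 intro!: power_mono) (metis sq zero_le_power2 diff_ge_0_iff_ge)
      have K0: "K (z m j) \<ge> 0" for j by (simp add: K_def)
      have "norm (z m j - 1) = norm (ee (of_nat m * v j) - ee (h j))"
      proof -
        have "ee (of_nat m * v j) - ee (h j) = ee (h j) * (z m j - 1)"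
          by (simp add: z_def ee_diff right_diff_distrib)
        then show ?thesis by (simp add: norm_mult)
      qed
      then have "(norm (z m j - 1))\<^sup>2 \<ge> \<epsilon>\<^sup>2" using j(2) eps by (intro power_mono) auto
      then have "(norm (1 + z m j))\<^sup>2 / 4 \<le> 1 - \<epsilon>\<^sup>2 / 4" unfolding sq by simp
      then have "K (z m j) \<le> (1 - \<epsilon>\<^sup>2 / 4) ^ Q"
        unfolding K_def by (metis power_divide power_mono zero_le_power2 divide_nonneg_nonneg zero_le_numeral)
      moreover have "(\<Prod>j<r. K (z m j)) = K (z m j) * (\<Prod>j\<in>{..<r} - {j}. K (z m j))"
        using j(1) by (subst prod.remove[of _ j]) auto
      moreover have "(\<Prod>j\<in>{..<r} - {j}. K (z m j)) \<le> 1" using K0 K1 by (intro prod_le_1) auto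
      ultimately show ?thesis using K0[of j] by (smt (verit) mult_left_le)
    qed
    then have "A \<le> (\<Sum>m\<in>?U. (1 - \<epsilon>\<^sup>2 / 4) ^ Q)" unfolding A_def by (rule sum_mono)
    then show ?thesis using N by (simp add: card_units_mod)
  qed
  moreover have "real (totient N) * (1 - \<epsilon>\<^sup>2 / 4) ^ Q < real (totient N) * \<eta>"
    using Q(2) N unfolding \<eta>_def by (intro mult_strict_left_mono) auto
  ultimately show False by (simp add: mult.commute)
qed

section \<open>Sequences of angles modulo an ultrafilter\<close>

locale seq_ultrafilter =
  fixes \<omega> :: "nat filter"
  assumes nonbot: "\<omega> \<noteq> bot"
    and le_sequentially: "\<omega> \<le> sequentially"
    and ultra: "eventually P \<omega> \<or> eventually (\<lambda>k. \<not> P k) \<omega>"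

text \<open>In the order of filters the finer one is smaller and \<open>bot\<close> is the improper
  one, so an ultrafilter is a minimal proper filter, found by Zorn's lemma with infima of chains.
  Lying below \<open>sequentially\<close> makes it nonprincipal.\<close>

lemma seq_ultrafilter_exists: "\<exists>\<omega>. seq_ultrafilter \<omega>"
proof -
  define A :: "nat filter set" where "A = {F. F \<noteq> bot \<and> F \<le> sequentially}"
  have "\<exists>m\<in>A. \<forall>a\<in>A. a \<le> m \<longrightarrow> a = m"
  proof (rule predicate_Zorn)
    show "partial_order_on A (relation_of (\<lambda>F G. G \<le> F) A)"
      by (rule partial_order_on_relation_ofI) auto
    fix C assume C: "C \<in> Chains (relation_of (\<lambda>F G. G \<le> F) A)"
    then have CA: "C \<subseteq> A" and chain: "\<And>F G. F \<in> C \<Longrightarrow> G \<in> C \<Longrightarrow> F \<le> G \<or> G \<le> F"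
      by (auto simp: Chains_def relation_of_def)
    show "\<exists>u\<in>A. \<forall>a\<in>C. u \<le> a"
    proof (cases "C = {}")
      case True
      then show ?thesis by (intro bexI[of _ sequentially]) (auto simp: A_def)
    next
      case False
      have "eventually P (Inf C) \<longleftrightarrow> (\<exists>b\<in>C. eventually P b)" for P
        using False chain by (intro eventually_Inf_base) (metis le_inf_iff order_refl)+
      then have "Inf C \<noteq> bot" using CA by (auto simp: A_def trivial_limit_def)
      moreover obtain F0 where F0: "F0 \<in> C" using False by blast
      then have "Inf C \<le> F0" by (rule Inf_lower)
      then have "Inf C \<le> sequentially" using F0 CA by (auto simp: A_def intro: order_trans)
      ultimately have "Inf C \<in> A" by (simp add: A_def)
      then show ?thesis using Inf_lower by blast
    qed
  qed
  then obtain m where m: "m \<noteq> bot" "m \<le> sequentially" "\<And>a. a \<noteq> bot \<Longrightarrow> a \<le> m \<Longrightarrow> a = m"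
    by (auto simp: A_def)
  have "eventually P m \<or> eventually (\<lambda>k. \<not> P k) m" for P
  proof (cases "inf m (principal {k. P k}) = bot")
    case True
    then have "eventually (\<lambda>k. \<not> P k) m"
      by (simp add: trivial_limit_def eventually_inf_principal)
    then show ?thesis by simp
  next
    case False
    then have "inf m (principal {k. P k}) = m" by (intro m(3)) auto
    then have "m \<le> principal {k. P k}" by (metis inf.cobounded2)
    then have "eventually P m" by (simp add: le_principal)
    then show ?thesis by simp
  qed
  then show ?thesis using m by (auto simp: seq_ultrafilter_def)
qed

context seq_ultrafilter
begin

lemma eventually_finite_cases:
  assumes "finite A" "eventually (\<lambda>k. \<exists>i\<in>A. P i k) \<omega>"
  shows "\<exists>i\<in>A. eventually (P i) \<omega>"
proof (rule ccontr)
  assume "\<not> ?thesis"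
  then have "\<forall>i\<in>A. eventually (\<lambda>k. \<not> P i k) \<omega>" using ultra by blast
  then have "eventually (\<lambda>k. \<forall>i\<in>A. \<not> P i k) \<omega>" using assms(1) by (simp add: eventually_ball_finite)
  with assms(2) have "eventually (\<lambda>k. False) \<omega>" by eventually_elim auto
  then show False using nonbot by (simp add: trivial_limit_def)
qed

lemma eventually_const: "eventually (\<lambda>k. P) \<omega> \<longleftrightarrow> P"
  using nonbot by (simp add: eventually_const)

text \<open>Sequences of angles are considered modulo integers: \<open>tors\<close> consists of those whose class
  is eventually constant, i.e. of the torsion of the ultrapower of the group of roots of unity.
  Since finitely many residues can be separated by the ultrafilter, it is a rational subspace.\<close>

definition tors :: "(nat \<Rightarrow> rat) set" where
  "tors = {w. \<exists>c. eventually (\<lambda>k. w k - c \<in> \<int>) \<omega>}"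

lemma tors_combination:
  assumes "\<And>j. j \<in> A \<Longrightarrow> eventually (\<lambda>k. w j k - c j \<in> \<int>) \<omega>" "finite A"
  shows "eventually (\<lambda>k. (\<Sum>j\<in>A. of_int (e j) * w j k) - (\<Sum>j\<in>A. of_int (e j) * c j) \<in> \<int>) \<omega>"
proof -
  have "eventually (\<lambda>k. \<forall>j\<in>A. w j k - c j \<in> \<int>) \<omega>"
    using assms by (simp add: eventually_ball_finite)
  then show ?thesis
  proof eventually_elim
    case (elim k)
    have "(\<Sum>j\<in>A. of_int (e j) * w j k) - (\<Sum>j\<in>A. of_int (e j) * c j) = (\<Sum>j\<in>A. of_int (e j) * (w j k - c j))"
      by (simp add: sum_subtractf right_diff_distrib)
    also have "\<dots> \<in> \<int>" using elim by (intro Ints_sum) auto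
    finally show ?case .
  qed
qed

lemma tors_scale:
  assumes "w \<in> tors"
  shows "(\<lambda>k. r * w k) \<in> tors"
proof -
  obtain c where c: "eventually (\<lambda>k. w k - c \<in> \<int>) \<omega>" using assms by (auto simp: tors_def)
  obtain p q :: int where r: "r = of_int p / of_int q" "q > 0"
    by (metis Rat_cases Fract_of_int_quotient)
  have "eventually (\<lambda>k. \<exists>s\<in>{0..<q}. (w k - c - of_int s) / of_int q \<in> \<int>) \<omega>"
    using c
  proof eventually_elim
    case (elim k)
    then obtain z where z: "w k - c = of_int z" by (auto elim: Ints_cases)
    have "w k - c - of_int (z mod q) = of_int (q * (z div q))"
      unfolding z by (simp flip: of_int_diff add: minus_mod_eq_mult_div)
    then have "(w k - c - of_int (z mod q)) / of_int q = of_int (z div q)" using r(2) by simp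
    then have "(w k - c - of_int (z mod q)) / of_int q \<in> \<int>" by simp
    moreover have "z mod q \<in> {0..<q}" using r(2) by simp
    ultimately show ?case by blast
  qed
  then obtain s where s: "eventually (\<lambda>k. (w k - c - of_int s) / of_int q \<in> \<int>) \<omega>"
    using eventually_finite_cases[of "{0..<q}" "\<lambda>s k. (w k - c - of_int s) / of_int q \<in> \<int>"] by auto
  have "eventually (\<lambda>k. r * w k - r * (c + of_int s) \<in> \<int>) \<omega>"
    using s
  proof eventually_elim
    case (elim k)
    have "r * w k - r * (c + of_int s) = of_int p * ((w k - c - of_int s) / of_int q)"
      using r(2) by (simp add: r(1) field_simps)
    then show ?case using elim by (simp only: Ints_mult Ints_of_int)
  qed
  then show ?thesis by (auto simp: tors_def)
qed

end

section \<open>Sequences of angles as a rational vector space\<close>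

abbreviation (input) seq_scale :: "rat \<Rightarrow> (nat \<Rightarrow> rat) \<Rightarrow> (nat \<Rightarrow> rat)" where
  "seq_scale c w \<equiv> (\<lambda>k. c * w k)"

lemma vector_space_seq_scale: "vector_space seq_scale"
  by unfold_locales (auto simp: fun_eq_iff algebra_simps)

lemma vector_space_rat: "vector_space ((*) :: rat \<Rightarrow> rat \<Rightarrow> rat)"
  by unfold_locales (auto simp: algebra_simps)

interpretation seq_vs: vector_space seq_scale
  by (rule vector_space_seq_scale)

interpretation seq_seq: vector_space_pair seq_scale seq_scale ..

interpretation rat_seq: vector_space_pair "(*) :: rat \<Rightarrow> rat \<Rightarrow> rat" seq_scale ..

lemma sum_fun_eq: "(\<Sum>j\<in>A. seq_scale (f j) (w j)) = (\<lambda>k. \<Sum>j\<in>A. f j * w j k)"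
  by (induction A rule: infinite_finite_induct) (auto simp: fun_eq_iff)

context seq_ultrafilter
begin

lemma subspace_tors: "seq_vs.subspace tors"
proof (rule seq_vs.subspaceI)
  show "0 \<in> tors" by (auto simp: tors_def intro!: exI[of _ 0])
  fix x y assume "x \<in> tors" "y \<in> tors"
  then obtain c d where cd: "eventually (\<lambda>k. x k - c \<in> \<int>) \<omega>" "eventually (\<lambda>k. y k - d \<in> \<int>) \<omega>"
    by (auto simp: tors_def)
  have "eventually (\<lambda>k. (x + y) k - (c + d) \<in> \<int>) \<omega>"
    using cd
  proof eventually_elim
    case (elim k)
    then have "(x k - c) + (y k - d) \<in> \<int>" by (rule Ints_add)
    then show ?case by (simp add: algebra_simps)
  qed
  then show "x + y \<in> tors" by (auto simp: tors_def)
next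
  fix c x assume "x \<in> tors"
  then show "seq_scale c x \<in> tors" by (rule tors_scale)
qed

text \<open>A linear left inverse of the inclusion of \<open>tors\<close>. Its kernel is an
  arbitrary complement, which is enough to split angles coherently into a torsion part and a
  rest.\<close>

lemma tors_projection:
  obtains \<pi> where "Vector_Spaces.linear seq_scale seq_scale \<pi>" "\<And>w. \<pi> w \<in> tors" "\<And>w. w \<in> tors \<Longrightarrow> \<pi> w = w"
proof -
  have "Vector_Spaces.linear seq_scale seq_scale (\<lambda>x. x)"
    using seq_vs.linear_ident by simp
  from seq_seq.linear_exists_left_inverse_on[OF this subspace_tors] 
  show ?thesis using that by auto
qed

text \<open>\<open>\<tau> w\<close> is a constant that represents the projection of \<open>w\<close>
  modulo integers. The constants are chosen separately for each \<open>w\<close>, whence additivity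
  only modulo integers.\<close>

lemma torsion_part_exists:
  "\<exists>\<tau> :: (nat \<Rightarrow> rat) \<Rightarrow> rat. (\<forall>w\<in>tors. eventually (\<lambda>k. w k - \<tau> w \<in> \<int>) \<omega>)
    \<and> (\<forall>(r::nat) e w. \<tau> (\<lambda>k. \<Sum>j<r. of_int (e j) * w j k) - (\<Sum>j<r. of_int (e j) * \<tau> (w j)) \<in> \<int>)"
proof -
  obtain \<pi> where \<pi>: "Vector_Spaces.linear seq_scale seq_scale \<pi>" "\<And>w. \<pi> w \<in> tors" "\<And>w. w \<in> tors \<Longrightarrow> \<pi> w = w"
    using tors_projection by blast
  have "\<exists>c. eventually (\<lambda>k. \<pi> w k - c \<in> \<int>) \<omega>" for w using \<pi>(2) by (auto simp: tors_def)
  then obtain \<tau> where \<tau>: "\<And>w. eventually (\<lambda>k. \<pi> w k - \<tau> w \<in> \<int>) \<omega>" by metis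
  have "\<tau> (\<lambda>k. \<Sum>j<r. of_int (e j) * w j k) - (\<Sum>j<r. of_int (e j) * \<tau> (w j)) \<in> \<int>" for r :: nat and e w
  proof -
    let ?s = "\<lambda>k. \<Sum>j<r. of_int (e j) * w j k"
    have "\<pi> ?s = (\<Sum>j<r. seq_scale (of_int (e j)) (\<pi> (w j)))"
    proof -
      interpret Vector_Spaces.linear seq_scale seq_scale \<pi> by fact
      have "?s = (\<Sum>j<r. seq_scale (of_int (e j)) (w j))" by (simp only: sum_fun_eq)
      then show ?thesis by (simp only: sum scale)
    qed
    then have eq: "\<pi> ?s = (\<lambda>k. \<Sum>j<r. of_int (e j) * \<pi> (w j) k)" by (simp only: sum_fun_eq)
    have "eventually (\<lambda>k. \<pi> ?s k - (\<Sum>j<r. of_int (e j) * \<tau> (w j)) \<in> \<int>) \<omega>"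
      unfolding eq by (rule tors_combination) (use \<tau> in auto)
    with \<tau>[of ?s] have "eventually (\<lambda>k. \<tau> ?s - (\<Sum>j<r. of_int (e j) * \<tau> (w j)) \<in> \<int>) \<omega>"
    proof eventually_elim
      case (elim k)
      from Ints_diff[OF elim(2) elim(1)] show ?case by simp
    qed
    then show ?thesis by (simp add: eventually_const)
  qed
  moreover have "\<forall>w\<in>tors. eventually (\<lambda>k. w k - \<tau> w \<in> \<int>) \<omega>" using \<tau> \<pi>(3) by metis
  ultimately show ?thesis by blast
qed

text \<open>The value \<open>1 / 2\<close> is chosen because \<open>ee (1 / 2) = - 1\<close> is the
  point of the unit circle farthest from \<open>1\<close>.\<close>

lemma nontorsion_functional:
  assumes "w \<notin> tors"
  shows "\<exists>h :: (nat \<Rightarrow> rat) \<Rightarrow> rat. (\<forall>v\<in>tors. h v = 0) \<and> h w = 1 / 2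
    \<and> (\<forall>(r::nat) e v. h (\<lambda>k. \<Sum>j<r. of_int (e j) * v j k) = (\<Sum>j<r. of_int (e j) * h (v j)))"
proof -
  obtain \<pi> where \<pi>: "Vector_Spaces.linear seq_scale seq_scale \<pi>" "\<And>w. \<pi> w \<in> tors" "\<And>w. w \<in> tors \<Longrightarrow> \<pi> w = w"
    using tors_projection by blast
  define u where "u = w - \<pi> w"
  have "u \<noteq> 0" using assms \<pi>(2)[of w] by (auto simp: u_def)
  then obtain k0 where k0: "u k0 \<noteq> 0" by (auto simp: fun_eq_iff)
  \<comment> \<open>The factor \<open>2\<close> makes a left inverse of this map take the value
    \<open>1 / 2\<close> at \<open>u\<close>.\<close>
  have lin: "Vector_Spaces.linear (*) seq_scale (\<lambda>c. seq_scale (2 * c) u)"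
    unfolding Vector_Spaces.linear_iff
  proof (intro conjI allI)
    show "vector_space ((*) :: rat \<Rightarrow> rat \<Rightarrow> rat)" by (rule vector_space_rat)
    show "vector_space seq_scale" by (rule vector_space_seq_scale)
    show "seq_scale (2 * (x + y)) u = seq_scale (2 * x) u + seq_scale (2 * y) u" for x y
      by (rule ext) (simp add: distrib_left distrib_right)
    show "seq_scale (2 * (c * x)) u = seq_scale c (seq_scale (2 * x) u)" for c x
      by (rule ext) simp
  qed
  have inj: "inj_on (\<lambda>c. seq_scale (2 * c) u) UNIV"
  proof (rule inj_onI)
    fix c d assume "seq_scale (2 * c) u = seq_scale (2 * d) u"
    then have "2 * c * u k0 = 2 * d * u k0" by metis
    then show "c = d" using k0 by simp
  qed
  obtain g where g: "Vector_Spaces.linear seq_scale (*) g" "\<And>c. g (seq_scale (2 * c) u) = c"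
    using rat_seq.linear_exists_left_inverse_on[OF lin vector_space_over_itself.subspace_UNIV inj] by auto
  define h where "h = (\<lambda>v. g (v - \<pi> v))"
  have \<pi>_add: "\<pi> (x + y) = \<pi> x + \<pi> y" and \<pi>_scale: "\<pi> (seq_scale c x) = seq_scale c (\<pi> x)" for x y c
    using \<pi>(1) unfolding Vector_Spaces.linear_iff by blast+
  have g_add: "g (x + y) = g x + g y" and g_scale: "g (seq_scale c x) = c * g x" for x y c
    using g(1) unfolding Vector_Spaces.linear_iff by blast+
  have h_add: "h (x + y) = h x + h y" for x y
  proof -
    have "x + y - \<pi> (x + y) = (x - \<pi> x) + (y - \<pi> y)" unfolding \<pi>_add by (rule add_diff_add)
    then show ?thesis unfolding h_def by (simp only: g_add)
  qed
  have h_scale: "h (seq_scale c x) = c * h x" for c x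
  proof -
    have "seq_scale c x - \<pi> (seq_scale c x) = seq_scale c (x - \<pi> x)"
      unfolding \<pi>_scale by (rule ext) (simp add: right_diff_distrib)
    then show ?thesis unfolding h_def by (simp only: g_scale)
  qed
  have h_tors: "h v = 0" if "v \<in> tors" for v
  proof -
    have "v - \<pi> v = seq_scale (2 * 0) u" using \<pi>(3)[OF that] by (simp add: fun_eq_iff)
    then show ?thesis unfolding h_def using g(2)[of 0] by metis
  qed
  have hw: "h w = 1 / 2"
  proof -
    have "w - \<pi> w = seq_scale (2 * (1 / 2)) u" by (rule ext) (simp add: u_def)
    then show ?thesis unfolding h_def using g(2)[of "1 / 2"] by metis
  qed
  have "h (\<lambda>k. \<Sum>j<r. of_int (e j) * v j k) = (\<Sum>j<r. of_int (e j) * h (v j))" for r :: nat and e v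
  proof (induction r)
    case 0
    have "(\<lambda>k. 0) \<in> tors" by (auto simp: tors_def intro!: exI[of _ 0])
    then show ?case using h_tors by simp
  next
    case (Suc r)
    have "(\<lambda>k. \<Sum>j<Suc r. of_int (e j) * v j k) = (\<lambda>k. \<Sum>j<r. of_int (e j) * v j k) + seq_scale (of_int (e r)) (v r)"
      by (simp add: fun_eq_iff)
    then show ?case using Suc by (simp only: h_add h_scale sum.lessThan_Suc)
  qed
  then show ?thesis using h_tors hw by blast
qed

end

section \<open>Orders of roots of unity as reduced denominators of their angles\<close>

lemma ee_power_eq_iff: "ee u ^ x = ee u ^ y \<longleftrightarrow> [x = y] (mod nat (snd (quotient_of u)))"
proof -
  define R where R: "R = nat (snd (quotient_of u))"
  define p where "p = fst (quotient_of u)"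
  have qu: "quotient_of u = (p, int R)"
    using quotient_of_denom_pos'[of u] by (simp add: p_def R)
  have R0: "R > 0" using quotient_of_denom_pos[OF qu] by simp
  have u: "u = of_int p / of_int (int R)" using quotient_of_div[OF qu] .
  have cop: "coprime p (int R)" using quotient_of_coprime[OF qu] .
  have "ee u ^ x = ee u ^ y \<longleftrightarrow> of_nat x * u - of_nat y * u \<in> \<int>"
    by (simp flip: ee_of_nat_mult ee_eq_iff)
  also have "of_nat x * u - of_nat y * u = of_int ((int x - int y) * p) / of_int (int R)"
    by (simp add: u algebra_simps diff_divide_distrib)
  also have "of_int ((int x - int y) * p) / of_int (int R) \<in> (\<int> :: rat set) \<longleftrightarrow> int R dvd (int x - int y) * p"
  proof
    assume "of_int ((int x - int y) * p) / of_int (int R) \<in> (\<int> :: rat set)"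
    then obtain z where "of_int ((int x - int y) * p) / of_int (int R) = (of_int z :: rat)"
      by (auto elim: Ints_cases)
    then have "of_int ((int x - int y) * p) = (of_int (z * int R) :: rat)" using R0
      by (simp add: field_simps)
    then have "(int x - int y) * p = z * int R" by (simp only: of_int_eq_iff)
    then show "int R dvd (int x - int y) * p" by simp
  next
    assume "int R dvd (int x - int y) * p"
    then obtain z where z: "(int x - int y) * p = int R * z" by (auto simp: dvd_def)
    have "of_int ((int x - int y) * p) / of_int (int R) = (of_int z :: rat)"
      unfolding z using R0 by simp
    then show "of_int ((int x - int y) * p) / of_int (int R) \<in> (\<int> :: rat set)" by (metis Ints_of_int)
  qed
  also have "\<dots> \<longleftrightarrow> int R dvd int x - int y"
    using cop by (simp add: coprime_dvd_mult_left_iff coprime_commute)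
  also have "\<dots> \<longleftrightarrow> [x = y] (mod R)"
    by (metis cong_iff_dvd_diff cong_int_iff)
  finally show ?thesis unfolding R .
qed

text \<open>The totient bound with \<open>B = 1 / \<eta>\<^sup>2\<close> turns the Ramanujan sum
  bound into this one; \<open>14 * B\<^sup>2\<close> is the threshold
  \<open>14 / \<eta> ^ 4\<close>.\<close>

lemma unit_character_average_small:
  fixes u :: rat and \<eta> :: real
  assumes "\<eta> > 0" and R: "R = nat (snd (quotient_of u))" "real R \<ge> 14 / \<eta> ^ 4" and N: "R dvd N" "N > 0"
  shows "norm (\<Sum>m\<in>units_mod N. ee (of_nat m * u)) \<le> \<eta> * real (totient N)"
proof -
  have R0: "R > 0" using quotient_of_denom_pos'[of u] by (simp add: R(1))
  have ord: "ee u ^ x = ee u ^ y \<longleftrightarrow> [x = y] (mod R)" for x y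
    unfolding R(1) by (rule ee_power_eq_iff)
  define S where "S = norm (\<Sum>m\<in>units_mod N. ee u ^ m)"
  have main: "S\<^sup>2 * real (totient R) ^ 2 \<le> real R * real (totient N) ^ 2"
    unfolding S_def by (rule norm_unit_sum_le[OF N ord])
  have "(1 / \<eta>\<^sup>2) * real R \<le> real (totient R) ^ 2"
    using R(2) R0 by (intro totient_square_dominates) (auto simp: power_divide power_mult[symmetric])
  then have "S\<^sup>2 * ((1 / \<eta>\<^sup>2) * real R) \<le> S\<^sup>2 * real (totient R) ^ 2" by (intro mult_left_mono) auto
  with main have "S\<^sup>2 * ((1 / \<eta>\<^sup>2) * real R) \<le> real R * real (totient N) ^ 2" by linarith
  then have "real R * S\<^sup>2 \<le> real R * (\<eta> * real (totient N)) ^ 2"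
    using assms(1) by (simp add: field_simps power_mult_distrib)
  then have "S\<^sup>2 \<le> (\<eta> * real (totient N)) ^ 2" using R0 by simp
  then have "S \<le> \<eta> * real (totient N)" by (rule power2_le_imp_le) (use assms(1) in auto)
  then show ?thesis by (simp add: S_def ee_of_nat_mult)
qed

lemma quotient_of_dvd:
  assumes "of_nat N * u \<in> (\<int> :: rat set)"
  shows "nat (snd (quotient_of u)) dvd N"
proof -
  obtain p q where qu: "quotient_of u = (p, q)" by (cases "quotient_of u")
  have q: "q > 0" "coprime p q" "u = of_int p / of_int q"
    using quotient_of_denom_pos[OF qu] quotient_of_coprime[OF qu] quotient_of_div[OF qu] by auto
  obtain z where "of_nat N * u = of_int z" using assms by (auto elim: Ints_cases)
  then have "of_int (int N * p) = (of_int (z * q) :: rat)" using q by (simp add: field_simps)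
  then have "int N * p = z * q" by (simp only: of_int_eq_iff)
  then have "q dvd int N * p" by simp
  then have "q dvd int N" using q(2) by (simp add: coprime_dvd_mult_left_iff coprime_commute)
  then show ?thesis using q(1) qu by (simp add: nat_dvd_iff)
qed

lemma denominator_mult_Ints: "of_nat (nat (snd (quotient_of u))) * u \<in> (\<int> :: rat set)"
proof -
  obtain p q where qu: "quotient_of u = (p, q)" by (cases "quotient_of u")
  have q: "q > 0" "u = of_int p / of_int q"
    using quotient_of_denom_pos[OF qu] quotient_of_div[OF qu] by auto
  have "of_nat (nat q) * u = of_int p" using q(1) unfolding q(2) by simp
  then show ?thesis by (simp add: qu)
qed

section \<open>Conjugations that move angles to prescribed limits\<close>

context seq_ultrafilter
begin

text \<open>Denominators up to \<open>R0\<close> leave finitely many classes modulo integers. The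
  ultrafilter would select one of them, and \<open>w\<close> would be in
  \<open>tors\<close>.\<close>

lemma denominators_unbounded:
  assumes "w \<notin> tors"
  shows "eventually (\<lambda>k. nat (snd (quotient_of (w k))) > R0) \<omega>"
proof (rule ccontr)
  assume "\<not> ?thesis"
  then have "eventually (\<lambda>k. \<not> nat (snd (quotient_of (w k))) > R0) \<omega>" using ultra by blast
  then have "eventually (\<lambda>k. \<exists>ab\<in>{0..int R0} \<times> {0..int R0}. w k - of_int (fst ab) / of_int (snd ab) \<in> \<int>) \<omega>"
  proof eventually_elim
    case (elim k)
    obtain p q where qu: "quotient_of (w k) = (p, q)" by (cases "quotient_of (w k)")
    have q: "q > 0" "w k = of_int p / of_int q"
      using quotient_of_denom_pos[OF qu] quotient_of_div[OF qu] by auto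
    have "of_int p = of_int (q * (p div q)) + (of_int (p mod q) :: rat)" by (simp flip: of_int_add of_int_mult)
    then have "w k - of_int (p mod q) / of_int q = of_int (p div q)"
      using q by (simp add: field_simps)
    moreover have "p mod q \<in> {0..int R0}" "q \<in> {0..int R0}"
      using q(1) elim qu order.trans[OF less_imp_le[OF pos_mod_bound[of q p]]] by (auto simp: not_less nat_le_iff)
    ultimately show ?case by (intro bexI[of _ "(p mod q, q)"]) auto
  qed
  then obtain ab where "eventually (\<lambda>k. w k - of_int (fst ab) / of_int (snd ab) \<in> \<int>) \<omega>"
    using eventually_finite_cases[of "{0..int R0} \<times> {0..int R0}" "\<lambda>ab k. w k - of_int (fst ab) / of_int (snd ab) \<in> \<int>"]
    by auto
  then show False using assms by (auto simp: tors_def)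
qed

text \<open>Only finitely many integer relations \<open>e\<close> have to be checked. If the
  combination of the \<open>w j\<close> is in \<open>tors\<close>, then subtracting
  \<open>\<tau>\<close> makes it integral and \<open>h\<close> kills it. Otherwise its denominator
  exceeds every bound, so that its average over the units is small.\<close>

lemma conjugates_dense_finite:
  fixes w :: "nat \<Rightarrow> nat \<Rightarrow> rat" and \<tau> h :: "(nat \<Rightarrow> rat) \<Rightarrow> rat" and \<epsilon> :: real
  assumes \<tau>: "\<And>w. w \<in> tors \<Longrightarrow> eventually (\<lambda>k. w k - \<tau> w \<in> \<int>) \<omega>"
    "\<And>(r::nat) e w. \<tau> (\<lambda>k. \<Sum>j<r. of_int (e j) * w j k) - (\<Sum>j<r. of_int (e j) * \<tau> (w j)) \<in> \<int>"
    and h: "\<And>v. v \<in> tors \<Longrightarrow> h v = 0"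
    "\<And>(r::nat) e v. h (\<lambda>k. \<Sum>j<r. of_int (e j) * v j k) = (\<Sum>j<r. of_int (e j) * h (v j))"
    and N: "\<And>k. N k > 0" and eps: "0 < \<epsilon>" "\<epsilon> \<le> 1"
  shows "eventually (\<lambda>k. \<exists>m. coprime m (N k) \<and>
    (\<forall>j<r. norm (ee (of_nat m * (w j k - \<tau> (w j))) - ee (h (w j))) < \<epsilon>)) \<omega>"
proof -
  obtain Q where Q: "Q > 0" "(1 - \<epsilon>\<^sup>2 / 4) ^ Q < (1 / (2 * real Q)) ^ r / 2"
    using simultaneous_kernel_parameters[OF eps] by blast
  define \<eta> where "\<eta> = (1 / (2 * real Q)) ^ r / 2"
  have \<eta>: "\<eta> > 0" using Q by (simp add: \<eta>_def)
  define v where "v = (\<lambda>j k. w j k - \<tau> (w j))"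
  define E where "E = PiE {..<r} (\<lambda>_. {-int Q..int Q})"
  define good where "good = (\<lambda>e k. ((\<Sum>j<r. of_int (e j) * v j k) \<in> \<int> \<and> (\<Sum>j<r. of_int (e j) * h (w j)) \<in> \<int>)
    \<or> real (nat (snd (quotient_of (\<Sum>j<r. of_int (e j) * v j k)))) \<ge> 14 / \<eta> ^ 4)"
  have finE: "finite E" by (simp add: E_def finite_PiE)
  have ev: "eventually (good e) \<omega>" for e
  proof (cases "(\<lambda>k. \<Sum>j<r. of_int (e j) * w j k) \<in> tors")
    case True
    from h(1)[OF True] have "(\<Sum>j<r. of_int (e j) * h (w j)) = 0" by (simp only: h(2))
    then have hz: "(\<Sum>j<r. of_int (e j) * h (w j)) \<in> \<int>" by simp
    from \<tau>(1)[OF True] show ?thesis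
    proof eventually_elim
      case (elim k)
      have "(\<Sum>j<r. of_int (e j) * v j k) = ((\<Sum>j<r. of_int (e j) * w j k) - \<tau> (\<lambda>k. \<Sum>j<r. of_int (e j) * w j k))
         + (\<tau> (\<lambda>k. \<Sum>j<r. of_int (e j) * w j k) - (\<Sum>j<r. of_int (e j) * \<tau> (w j)))"
        by (simp add: v_def right_diff_distrib sum_subtractf)
      also have "\<dots> \<in> \<int>" using elim \<tau>(2) by (rule Ints_add)
      finally show ?case using hz by (simp add: good_def)
    qed
  next
    case False
    have "(\<lambda>k. \<Sum>j<r. of_int (e j) * v j k) \<notin> tors"
    proof
      assume "(\<lambda>k. \<Sum>j<r. of_int (e j) * v j k) \<in> tors"
      then obtain c where c: "eventually (\<lambda>k. (\<Sum>j<r. of_int (e j) * v j k) - c \<in> \<int>) \<omega>"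
        by (auto simp: tors_def)
      have *: "(\<Sum>j<r. of_int (e j) * v j k) - c = (\<Sum>j<r. of_int (e j) * w j k) - (c + (\<Sum>j<r. of_int (e j) * \<tau> (w j)))" for k
        by (simp add: v_def right_diff_distrib sum_subtractf)
      then have "eventually (\<lambda>k. (\<Sum>j<r. of_int (e j) * w j k) - (c + (\<Sum>j<r. of_int (e j) * \<tau> (w j))) \<in> \<int>) \<omega>"
        using c by (simp only: *)
      then show False using False unfolding tors_def by blast
    qed
    from denominators_unbounded[OF this, of "nat \<lceil>14 / \<eta> ^ 4\<rceil>"] show ?thesis
      by eventually_elim (simp add: good_def, linarith)
  qed
  then have "eventually (\<lambda>k. \<forall>e\<in>E. good e k) \<omega>" using finE by (simp add: eventually_ball_finite)
  then show ?thesis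
  proof eventually_elim
    case (elim k)
    \<comment> \<open>Including these denominators makes the characters involved well defined modulo
      \<open>N'\<close>, and a unit modulo \<open>N'\<close> is still coprime to
      \<open>N k\<close>.\<close>
    define D where "D = (\<Prod>j<r. nat (snd (quotient_of (v j k))))"
    define N' where "N' = N k * D"
    have D0: "D > 0" unfolding D_def using quotient_of_denom_pos' by (intro prod_pos) simp
    have N': "N' > 0" using N D0 by (simp add: N'_def)
    have vI: "of_nat N' * v j k \<in> \<int>" if "j < r" for j
    proof -
      have "D = nat (snd (quotient_of (v j k))) * (\<Prod>j\<in>{..<r} - {j}. nat (snd (quotient_of (v j k))))"
        unfolding D_def using that by (subst prod.remove[of _ j]) auto
      then obtain c where "D = nat (snd (quotient_of (v j k))) * c" by blast
      then have "of_nat N' * v j k = of_nat (N k * c) * (of_nat (nat (snd (quotient_of (v j k)))) * v j k)"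
        by (simp add: N'_def)
      also have "\<dots> \<in> \<int>" by (intro Ints_mult denominator_mult_Ints) simp
      finally show ?thesis .
    qed
    have "\<exists>m\<in>units_mod N'. \<forall>j<r. norm (ee (of_nat m * v j k) - ee (h (w j))) < \<epsilon>"
    proof (rule simultaneous_kernel_approximation[OF eps Q N'])
      fix e :: "nat \<Rightarrow> int" assume e: "\<And>j. j < r \<Longrightarrow> \<bar>e j\<bar> \<le> int Q"
      define e' where "e' = restrict e {..<r}"
      have "e j \<in> {-int Q..int Q}" if "j < r" for j using e[OF that] by (simp add: abs_le_iff)
      then have "e' \<in> E" unfolding E_def e'_def by simp
      then have good: "good e' k" using elim by blast
      have eq: "(\<Sum>j<r. of_int (e' j) * x j) = (\<Sum>j<r. of_int (e j) * x j)" for x :: "nat \<Rightarrow> rat"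
        by (intro sum.cong) (auto simp: e'_def)
      have "of_nat N' * (\<Sum>j<r. of_int (e j) * v j k) = (\<Sum>j<r. of_int (e j) * (of_nat N' * v j k))"
        by (simp add: sum_distrib_left mult.left_commute)
      also have "\<dots> \<in> \<int>" using vI by (intro Ints_sum Ints_mult[OF Ints_of_int]) auto
      finally have dvd: "nat (snd (quotient_of (\<Sum>j<r. of_int (e j) * v j k))) dvd N'" by (rule quotient_of_dvd)
      show "((\<Sum>j<r. of_int (e j) * v j k) \<in> \<int> \<and> (\<Sum>j<r. of_int (e j) * h (w j)) \<in> \<int>)
        \<or> norm (\<Sum>m\<in>units_mod N'. ee (of_nat m * (\<Sum>j<r. of_int (e j) * v j k)))
            \<le> (1 / (2 * real Q)) ^ r / 2 * real (totient N')"
        using good[unfolded good_def eq]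
      proof
        assume "14 / \<eta> ^ 4 \<le> real (nat (snd (quotient_of (\<Sum>j<r. of_int (e j) * v j k))))"
        from unit_character_average_small[OF \<eta> refl this dvd N'] show ?thesis
          unfolding \<eta>_def ..
      qed simp
    qed
    then obtain m where m: "m \<in> units_mod N'" "\<forall>j<r. norm (ee (of_nat m * v j k) - ee (h (w j))) < \<epsilon>" by blast
    have "coprime m (N k)" using m(1) by (simp add: units_mod_def N'_def)
    then show ?case using m(2) by (auto simp: v_def)
  qed
qed

text \<open>A diagonal argument: \<open>J k\<close> is the largest \<open>r\<close> up to
  \<open>k\<close> for which the first \<open>r\<close> angles can be approximated within
  \<open>1 / (r + 1)\<close>. The case \<open>r = 0\<close> is always possible, and \<open>J\<close>
  exceeds every bound along \<open>\<omega>\<close>.\<close>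

lemma conjugates_dense:
  fixes w :: "nat \<Rightarrow> nat \<Rightarrow> rat" and \<tau> h :: "(nat \<Rightarrow> rat) \<Rightarrow> rat"
  assumes \<tau>: "\<And>w. w \<in> tors \<Longrightarrow> eventually (\<lambda>k. w k - \<tau> w \<in> \<int>) \<omega>"
    "\<And>(r::nat) e w. \<tau> (\<lambda>k. \<Sum>j<r. of_int (e j) * w j k) - (\<Sum>j<r. of_int (e j) * \<tau> (w j)) \<in> \<int>"
    and h: "\<And>v. v \<in> tors \<Longrightarrow> h v = 0"
    "\<And>(r::nat) e v. h (\<lambda>k. \<Sum>j<r. of_int (e j) * v j k) = (\<Sum>j<r. of_int (e j) * h (v j))"
    and N: "\<And>k. N k > 0"
  obtains m where "\<And>k. coprime (m k) (N k)"
    "\<And>j. ((\<lambda>k. ee (of_nat (m k) * (w j k - \<tau> (w j)))) \<longlongrightarrow> ee (h (w j))) \<omega>"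
proof -
  define P where "P = (\<lambda>r k m. coprime m (N k) \<and>
    (\<forall>j<r. norm (ee (of_nat m * (w j k - \<tau> (w j))) - ee (h (w j))) < 1 / real (Suc r)))"
  have evP: "eventually (\<lambda>k. \<exists>m. P r k m) \<omega>" for r
    unfolding P_def by (rule conjugates_dense_finite[OF \<tau> h N]) (auto simp: field_simps)
  define J where "J = (\<lambda>k. Max {r. r \<le> k \<and> (\<exists>m. P r k m)})"
  have P0: "P 0 k 1" for k by (simp add: P_def)
  have fin: "finite {r. r \<le> k \<and> (\<exists>m. P r k m)}" for k by simp
  have ne: "{r. r \<le> k \<and> (\<exists>m. P r k m)} \<noteq> {}" for k using P0[of k] by blast
  have "\<exists>m. P (J k) k m" for k using Max_in[OF fin ne, of k] by (auto simp: J_def)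
  then obtain m where m: "\<And>k. P (J k) k (m k)" by metis
  have J: "eventually (\<lambda>k. J k \<ge> r) \<omega>" for r
  proof -
    have "eventually (\<lambda>k. k \<ge> r) \<omega>"
      using le_sequentially eventually_ge_at_top by (rule filter_leD)
    with evP[of r] show ?thesis
      by eventually_elim (auto simp: J_def intro!: Max_ge)
  qed
  show ?thesis
  proof (rule that)
    show "coprime (m k) (N k)" for k using m[of k] by (simp add: P_def)
    show "((\<lambda>k. ee (of_nat (m k) * (w j k - \<tau> (w j)))) \<longlongrightarrow> ee (h (w j))) \<omega>" for j
    proof (rule tendstoI)
      fix e :: real assume "e > 0"
      then obtain r where r: "1 / real (Suc r) < e" using nat_approx_posE by blast
      show "eventually (\<lambda>k. dist (ee (of_nat (m k) * (w j k - \<tau> (w j)))) (ee (h (w j))) < e) \<omega>"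
        using J[of "max (Suc j) r"]
      proof eventually_elim
        case (elim k)
        then have "j < J k" "r \<le> J k" by auto
        then have "norm (ee (of_nat (m k) * (w j k - \<tau> (w j))) - ee (h (w j))) < 1 / real (Suc (J k))"
          using m[of k] by (auto simp: P_def)
        also have "\<dots> \<le> 1 / real (Suc r)" using \<open>r \<le> J k\<close> by (simp add: frac_le)
        finally show ?case using r by (simp add: dist_norm)
      qed
    qed
  qed
qed

end

section \<open>Bounded linear recurrences\<close>

text \<open>Polynomials act on sequences with \<open>X\<close> as the shift, so
  \<open>poly_act p s = (\<lambda>k. 0)\<close> is the linear recurrence with characteristic
  polynomial \<open>p\<close>.\<close>

definition poly_act :: "complex poly \<Rightarrow> (nat \<Rightarrow> complex) \<Rightarrow> nat \<Rightarrow> complex" where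
  "poly_act p s k = (\<Sum>j\<le>degree p. coeff p j * s (k + j))"

lemma poly_act_bound: "degree p \<le> N \<Longrightarrow> poly_act p s k = (\<Sum>j\<le>N. coeff p j * s (k + j))"
  unfolding poly_act_def by (rule sum.mono_neutral_left) (auto simp: coeff_eq_0)

lemma poly_act_0 [simp]: "poly_act 0 s = (\<lambda>k. 0)"
  by (simp add: poly_act_def fun_eq_iff)

lemma poly_act_pCons: "poly_act (pCons a p) s k = a * s k + poly_act p s (Suc k)"
proof -
  have "poly_act (pCons a p) s k = (\<Sum>j\<le>Suc (degree p). coeff (pCons a p) j * s (k + j))"
    by (rule poly_act_bound) (rule degree_pCons_le)
  also have "\<dots> = a * s k + poly_act p s (Suc k)"
    by (subst sum.atMost_Suc_shift) (simp add: poly_act_def)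
  finally show ?thesis .
qed

lemma poly_act_add: "poly_act (p + q) s k = poly_act p s k + poly_act q s k"
proof -
  have "poly_act (p + q) s k = (\<Sum>j\<le>max (degree p) (degree q). coeff (p + q) j * s (k + j))"
    by (rule poly_act_bound) (rule degree_add_le_max)
  also have "\<dots> = poly_act p s k + poly_act q s k"
    unfolding poly_act_bound[OF max.cobounded1[of "degree p" "degree q"]]
      poly_act_bound[OF max.cobounded2[of "degree q" "degree p"]]
    by (simp add: sum.distrib distrib_right)
  finally show ?thesis .
qed

lemma poly_act_smult: "poly_act (smult c p) s k = c * poly_act p s k"
  by (subst poly_act_bound[of _ "degree p"]) (auto simp: poly_act_def sum_distrib_left mult.assoc)

lemma poly_act_mult: "poly_act (p * q) s = poly_act p (poly_act q s)"
proof (induction p)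
  case (pCons a p)
  then show ?case
    by (simp add: fun_eq_iff poly_act_add poly_act_smult poly_act_pCons)
qed simp

lemma poly_act_zero_fun [simp]: "poly_act p (\<lambda>k. 0) = (\<lambda>k. 0)"
  by (simp add: poly_act_def fun_eq_iff)

lemma poly_act_linear: "poly_act [:- c, 1:] s k = s (Suc k) - c * s k"
  by (simp add: poly_act_pCons)

lemma poly_act_dvd_zero:
  assumes "p dvd q" "poly_act p s = (\<lambda>k. 0)"
  shows "poly_act q s = (\<lambda>k. 0)"
proof -
  obtain r where "q = r * p" using assms(1) by (metis dvd_def mult.commute)
  then show ?thesis using assms(2) by (simp add: poly_act_mult)
qed

text \<open>Descending induction on the order of the difference: a sequence with constant nonzero
  differences is unbounded.\<close>

lemma bounded_iterated_difference:
  fixes s :: "nat \<Rightarrow> complex" and L :: nat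
  defines "D \<equiv> \<lambda>s k. s (k + L) - s k"
  assumes "(D ^^ n) s = (\<lambda>k. 0)" "\<And>k. norm (s k) \<le> B" "n > 0"
  shows "s (k + L) = s k"
proof -
  have bounded: "\<exists>C. \<forall>k. norm ((D ^^ j) s k) \<le> C" for j
  proof (induction j)
    case 0
    then show ?case using assms(3) by auto
  next
    case (Suc j)
    then obtain C where C: "\<And>k. norm ((D ^^ j) s k) \<le> C" by blast
    have "norm ((D ^^ Suc j) s k) \<le> C + C" for k
      using norm_triangle_ineq4[of "(D ^^ j) s (k + L)" "(D ^^ j) s k"] C[of k] C[of "k + L"]
      by (simp add: D_def)
    then show ?case by blast
  qed
  have "(D ^^ n) s = (\<lambda>k. 0) \<Longrightarrow> n > 0 \<Longrightarrow> D s = (\<lambda>k. 0)" for n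
  proof (induction n)
    case (Suc n)
    show ?case
    proof (cases "n = 0")
      case True
      then show ?thesis using Suc.prems by simp
    next
      case False
      then obtain j where j: "n = Suc j" by (metis not0_implies_Suc)
      define u where "u = (D ^^ j) s"
      have DDu: "D (D u) = (\<lambda>k. 0)" using Suc.prems by (simp add: j u_def)
      obtain C where C: "\<And>k. norm (u k) \<le> C" using bounded[of j] by (auto simp: u_def)
      have "D u k = 0" for k
      proof (rule ccontr)
        assume nz: "D u k \<noteq> 0"
        have per: "D u (k + L * i) = D u k" for i
        proof (induction i)
          case (Suc i)
          have "D (D u) (k + L * i) = 0" using DDu by simp
          moreover have "D (D u) (k + L * i) = D u (k + L * Suc i) - D u (k + L * i)"
            by (simp add: D_def add_ac)
          ultimately show ?case using Suc by simp
        qed simp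
        have lin: "u (k + L * i) = u k + of_nat i * D u k" for i
        proof (induction i)
          case (Suc i)
          have "u (k + L * Suc i) = u (k + L * i) + D u (k + L * i)" by (simp add: D_def algebra_simps)
          then show ?case using Suc per by (simp add: algebra_simps)
        qed simp
        obtain i :: nat where i: "real i * norm (D u k) > 2 * C" using nz reals_Archimedean3[of "norm (D u k)"] by auto
        have "real i * norm (D u k) = norm (u (k + L * i) - u k)" using lin[of i] by (simp add: norm_mult)
        also have "\<dots> \<le> C + C" using C by (metis norm_triangle_ineq4 add_mono order_trans)
        finally show False using i by simp
      qed
      then have "(D ^^ n) s = (\<lambda>k. 0)" by (simp add: j u_def fun_eq_iff)
      then show ?thesis using Suc.IH False by simp
    qed
  qed simp
  then have "D s k = 0" using assms(2,4) by (simp add: fun_eq_iff)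
  then show ?thesis by (simp add: D_def)
qed

lemma linear_dvd_root: "[:- c, 1:] dvd p \<longleftrightarrow> poly p c = 0" for c :: complex
  by (simp add: poly_eq_0_iff_dvd)

text \<open>The characteristic polynomial divides \<open>(X ^ L - 1) ^ n\<close>, so an iterated
  difference of step \<open>L\<close> vanishes, and boundedness excludes the polynomial growth that
  multiple roots would allow.\<close>

lemma bounded_recurrence_periodic:
  fixes n :: nat
  assumes s: "\<And>k. norm (s k) \<le> B" and roots: "\<And>i. i < n \<Longrightarrow> z i ^ L = 1" 
    and act: "poly_act (\<Prod>i<n. [:- z i, 1:]) s = (\<lambda>k. 0)" and n: "n > 0"
  shows "s (k + L) = s k"
proof -
  define D where "D = (\<lambda>s :: nat \<Rightarrow> complex. \<lambda>k. s (k + L) - s k)"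
  have D: "poly_act (monom 1 L - 1) s = D s" for s
  proof -
    have "monom 1 L - 1 = monom 1 L + smult (-1) (1 :: complex poly)"
      by (metis diff_conv_add_uminus smult_minus_left smult_1_left)
    moreover have "poly_act (monom 1 L) s k = s (k + L)" for k
      by (subst poly_act_bound[of _ L]) (auto simp: degree_monom_le if_distrib[of "\<lambda>x. x * _"] cong: if_cong)
    moreover have "poly_act 1 s k = s k" for k by (simp add: poly_act_def)
    ultimately show ?thesis by (simp only: fun_eq_iff poly_act_add poly_act_smult D_def) simp
  qed
  have pow: "poly_act ((monom 1 L - 1) ^ j) s = (D ^^ j) s" for j
  proof (induction j)
    case 0
    then show ?case by (simp add: fun_eq_iff poly_act_def)
  next
    case (Suc j)
    then show ?case by (simp add: poly_act_mult D)
  qed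
  have "(\<Prod>i<n. [:- z i, 1:]) dvd (\<Prod>i<n. monom 1 L - 1)"
    using roots by (intro prod_dvd_prod) (simp add: linear_dvd_root poly_monom)
  then have "(\<Prod>i<n. [:- z i, 1:]) dvd (monom 1 L - 1) ^ n" by simp
  then have "(D ^^ n) s = (\<lambda>k. 0)" using poly_act_dvd_zero[OF _ act] pow by metis
  from bounded_iterated_difference[OF this[unfolded D_def] s n] show ?thesis .
qed

text \<open>A bounded solution is periodic, hence a sum of eigenvectors of the shift, each bounded
  by \<open>B\<close> as an average. Only roots of the characteristic polynomial occur as
  eigenvalues, and a component of eigenvalue \<open>ee (q i)\<close> changes by the factor
  \<open>ee (q i) - 1\<close>. The period, which is not controlled, drops out of the bound.\<close>

lemma bounded_recurrence_difference:
  fixes n :: nat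
  assumes s: "\<And>k. norm (s k) \<le> B"
    and act: "poly_act (\<Prod>i<n. [:- ee (q i), 1:]) s = (\<lambda>k. 0)" and n: "n > 0"
  shows "norm (s (Suc k) - s k) \<le> B * (\<Sum>i<n. norm (ee (q i) - 1))"
proof -
  define L where "L = (\<Prod>i<n. nat (snd (quotient_of (q i))))"
  have L: "L > 0" unfolding L_def using quotient_of_denom_pos' by (intro prod_pos) simp
  define \<zeta> where "\<zeta> = ee (1 / of_nat L)"
  have qL: "ee (q i) ^ L = 1" if "i < n" for i
  proof -
    obtain a b where qu: "quotient_of (q i) = (a, b)" by (cases "quotient_of (q i)")
    have b: "b > 0" "q i = of_int a / of_int b"
      using quotient_of_denom_pos[OF qu] quotient_of_div[OF qu] by auto
    have "nat b dvd L" unfolding L_def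
      using dvd_prodI[OF finite_lessThan, of i n "\<lambda>i. nat (snd (quotient_of (q i)))"] that qu by simp
    then obtain c where "L = nat b * c" by (auto simp: dvd_def)
    then have "of_nat L * q i = of_nat c * of_int a" using b by simp
    also have "\<dots> \<in> \<int>" by simp
    finally show ?thesis by (simp add: ee_of_nat_mult[symmetric] ee_eq_1_iff)
  qed
  have \<zeta>L: "\<zeta> ^ L = 1" using L by (simp add: \<zeta>_def ee_of_nat_mult[symmetric] ee_eq_1_iff)
  have \<zeta>0: "\<zeta> \<noteq> 0" by (simp add: \<zeta>_def)
  have \<zeta>norm: "norm \<zeta> = 1" by (simp add: \<zeta>_def)
  have \<zeta>inj: "x = y" if "\<zeta> ^ x = \<zeta> ^ y" "x < L" "y < L" for x y
  proof -
    have "of_nat x / of_nat L - of_nat y / of_nat L \<in> (\<int> :: rat set)"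
      using that(1) by (simp add: \<zeta>_def ee_of_nat_mult[symmetric] ee_eq_iff)
    then obtain z where z: "of_nat x / of_nat L - of_nat y / of_nat L = (of_int z :: rat)" by (auto elim: Ints_cases)
    then have "of_int (int x - int y) = (of_int (z * int L) :: rat)" using L by (simp add: field_simps)
    then have eq: "int x - int y = z * int L" by (simp only: of_int_eq_iff)
    have "\<bar>z * int L\<bar> < int L" unfolding eq[symmetric] using that by auto
    then have "z = 0" using L by (simp add: abs_mult)
    then show ?thesis using eq by simp
  qed
  have per: "s (k + L) = s k" for k by (rule bounded_recurrence_periodic[OF s qL act n])
  \<comment> \<open>The Fourier component of \<open>s\<close> on which the shift multiplies by
    \<open>\<zeta> ^ b\<close>.\<close>
  define c where "c = (\<lambda>b k. (\<Sum>j<L. inverse (\<zeta> ^ (b * j)) * s (k + j)) / of_nat L)"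
  have c_norm: "norm (c b k) \<le> B" for b k
  proof -
    have "norm (\<Sum>j<L. inverse (\<zeta> ^ (b * j)) * s (k + j)) \<le> (\<Sum>j<L. B)"
      using s by (intro order.trans[OF norm_sum] sum_mono) (simp add: norm_mult norm_inverse norm_power \<zeta>norm)
    then show ?thesis using L by (simp add: c_def norm_divide field_simps)
  qed
  have c_step: "c b (Suc k) = \<zeta> ^ b * c b k" for b k
  proof -
    define g where "g = (\<lambda>j. inverse (\<zeta> ^ (b * j)) * s (k + j))"
    have "(\<Sum>j<L. inverse (\<zeta> ^ (b * j)) * s (Suc k + j)) = (\<Sum>j<L. \<zeta> ^ b * g (Suc j))"
      using \<zeta>0 by (intro sum.cong refl) (simp add: g_def power_add)
    also have "\<dots> = \<zeta> ^ b * (\<Sum>j<L. g (Suc j))" by (simp add: sum_distrib_left)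
    also have "(\<Sum>j<L. g (Suc j)) = (\<Sum>j<L. g j)"
    proof -
      have "g L = g 0" using per[of k] \<zeta>L by (simp add: g_def power_mult mult.commute[of b])
      moreover have "(\<Sum>j<Suc L. g j) = g 0 + (\<Sum>j<L. g (Suc j))" by (rule sum.lessThan_Suc_shift)
      ultimately show ?thesis by simp
    qed
    finally show ?thesis by (simp add: c_def g_def)
  qed
  have c_pow: "c b (k + j) = \<zeta> ^ (b * j) * c b k" for b k j
    by (induction j) (simp_all add: c_step power_add)
  have c_sum: "s k = (\<Sum>b<L. c b k)" for k
  proof -
    have "(\<Sum>b<L. c b k) = (\<Sum>b<L. \<Sum>j<L. inverse (\<zeta> ^ (b * j)) * s (k + j)) / of_nat L"
      by (simp add: c_def sum_divide_distrib)
    also have "(\<Sum>b<L. \<Sum>j<L. inverse (\<zeta> ^ (b * j)) * s (k + j)) = (\<Sum>j<L. (\<Sum>b<L. (inverse \<zeta> ^ j) ^ b) * s (k + j))"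
      by (subst sum.swap) (simp add: sum_distrib_right sum_distrib_left power_mult[symmetric] power_inverse mult.commute)
    also have "\<dots> = (\<Sum>j<L. (if j = 0 then of_nat L else 0) * s (k + j))"
    proof (intro sum.cong refl arg_cong2[where f = "(*)"])
      fix j assume j: "j \<in> {..<L}"
      show "(\<Sum>b<L. (inverse \<zeta> ^ j) ^ b) = (if j = 0 then of_nat L else 0)"
      proof (cases "j = 0")
        case False
        have "inverse \<zeta> ^ j \<noteq> 1"
        proof
          assume "inverse \<zeta> ^ j = 1"
          then have "\<zeta> ^ j = \<zeta> ^ 0" by (simp add: power_inverse)
          then show False using \<zeta>inj[of j 0] j False L by auto
        qed
        moreover have "(inverse \<zeta> ^ j) ^ L = 1"
          using \<zeta>L by (metis inverse_1 power_commutes power_inverse power_mult power_one mult.commute)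
        ultimately show ?thesis using False by (simp add: geometric_sum)
      qed simp
    qed
    also have "\<dots> = of_nat L * s k" using L by (simp add: if_distrib[of "\<lambda>x. x * _"] cong: if_cong)
    finally show ?thesis using L by simp
  qed
  define p where "p = (\<Prod>i<n. [:- ee (q i), 1:])"
  have c_zero: "c b k = 0" if "\<zeta> ^ b \<notin> (\<lambda>i. ee (q i)) ` {..<n}" for b k
  proof -
    have "poly_act p (c b) k = poly p (\<zeta> ^ b) * c b k"
      by (simp add: poly_act_def c_pow poly_altdef sum_distrib_right power_mult mult.assoc)
    moreover have "poly_act p (c b) k = (\<Sum>i<L. inverse (\<zeta> ^ (b * i)) * poly_act p s (k + i)) / of_nat L"
    proof -
      have "poly_act p (c b) k = (\<Sum>j\<le>degree p. \<Sum>i<L. coeff p j * (inverse (\<zeta> ^ (b * i)) * s (k + j + i))) / of_nat L"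
        by (simp add: poly_act_def c_def sum_distrib_left sum_divide_distrib)
      also have "\<dots> = (\<Sum>i<L. \<Sum>j\<le>degree p. coeff p j * (inverse (\<zeta> ^ (b * i)) * s (k + j + i))) / of_nat L"
        by (subst sum.swap) simp
      also have "\<dots> = (\<Sum>i<L. inverse (\<zeta> ^ (b * i)) * poly_act p s (k + i)) / of_nat L"
        unfolding poly_act_def sum_distrib_left
        by (intro arg_cong2[where f = "(/)"] sum.cong refl) (simp add: mult.left_commute add_ac)
      finally show ?thesis .
    qed
    then have "poly_act p (c b) k = 0" using act by (simp add: p_def)
    moreover have "poly p (\<zeta> ^ b) \<noteq> 0" using that by (auto simp: p_def poly_prod)
    ultimately show ?thesis by simp
  qed
  \<comment> \<open>Different \<open>b\<close> below \<open>L\<close> give different roots, so the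
    sum over these frequencies counts each root once and is at most the sum over all
    \<open>i\<close>.\<close>
  let ?R = "{b. b < L \<and> \<zeta> ^ b \<in> (\<lambda>i. ee (q i)) ` {..<n}}"
  have "s (Suc k) - s k = (\<Sum>b<L. (\<zeta> ^ b - 1) * c b k)"
    by (simp add: c_sum c_step sum_subtractf left_diff_distrib)
  also have "\<dots> = (\<Sum>b\<in>?R. (\<zeta> ^ b - 1) * c b k)"
    using c_zero by (intro sum.mono_neutral_right) auto
  finally have "norm (s (Suc k) - s k) \<le> (\<Sum>b\<in>?R. norm ((\<zeta> ^ b - 1) * c b k))"
    by (metis norm_sum)
  also have "\<dots> \<le> (\<Sum>b\<in>?R. norm (\<zeta> ^ b - 1) * B)"
    using c_norm by (intro sum_mono) (auto simp: norm_mult intro!: mult_left_mono)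
  also have "\<dots> = (\<Sum>b\<in>?R. norm (\<zeta> ^ b - 1)) * B" by (simp add: sum_distrib_right)
  also have "(\<Sum>b\<in>?R. norm (\<zeta> ^ b - 1)) = (\<Sum>z\<in>(\<lambda>b. \<zeta> ^ b) ` ?R. norm (z - 1))"
    using \<zeta>inj by (subst sum.reindex) (auto simp: inj_on_def)
  also have "\<dots> \<le> (\<Sum>z\<in>(\<lambda>i. ee (q i)) ` {..<n}. norm (z - 1))" by (intro sum_mono2) auto
  also have "\<dots> \<le> (\<Sum>i<n. norm (ee (q i) - 1))"
    using sum_image_le[of "{..<n}" "\<lambda>z. norm (z - 1)" "\<lambda>i. ee (q i)"] by (simp add: o_def)
  finally have "norm (s (Suc k) - s k) \<le> (\<Sum>i<n. norm (ee (q i) - 1)) * B"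
    using mult_right_mono[OF _ order.trans[OF norm_ge_zero s[of 0]]] by blast
  then show ?thesis by (simp add: mult.commute)
qed

section \<open>Traces and eigenvalues of complex matrices\<close>

definition mtrace :: "complex mat \<Rightarrow> complex" where
  "mtrace A = (\<Sum>i<dim_row A. A $$ (i, i))"

lemma mtrace_mult:
  assumes "A \<in> carrier_mat n m" "B \<in> carrier_mat m n"
  shows "mtrace (A * B) = (\<Sum>i<n. \<Sum>j<m. A $$ (i, j) * B $$ (j, i))"
  using assms by (simp add: mtrace_def scalar_prod_def atLeast0LessThan)

lemma mtrace_comm:
  assumes "A \<in> carrier_mat n m" "B \<in> carrier_mat m n"
  shows "mtrace (A * B) = mtrace (B * A)"
  unfolding mtrace_mult[OF assms] mtrace_mult[OF assms(2,1)]
  by (subst sum.swap) (simp add: mult.commute)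

lemma mtrace_add:
  assumes "A \<in> carrier_mat n n" "B \<in> carrier_mat n n"
  shows "mtrace (A + B) = mtrace A + mtrace B"
  using assms by (simp add: mtrace_def sum.distrib)

lemma mtrace_smult:
  assumes "A \<in> carrier_mat n n"
  shows "mtrace (c \<cdot>\<^sub>m A) = c * mtrace A"
  using assms by (simp add: mtrace_def sum_distrib_left)

lemma mult_upper_triangular:
  fixes A B :: "complex mat"
  assumes A: "A \<in> carrier_mat n n" "upper_triangular A" and B: "B \<in> carrier_mat n n" "upper_triangular B"
  shows "upper_triangular (A * B)" "\<And>i. i < n \<Longrightarrow> (A * B) $$ (i, i) = A $$ (i, i) * B $$ (i, i)"
proof -
  have entry: "(A * B) $$ (i, j) = (\<Sum>l<n. A $$ (i, l) * B $$ (l, j))" if "i < n" "j < n" for i j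
    using A B that by (simp add: scalar_prod_def atLeast0LessThan)
  have zero: "A $$ (i, l) * B $$ (l, j) = 0" if "i < n" "l < n" "l < i \<or> j < l" for i j l
    using that A B upper_triangularD[of A] upper_triangularD[of B] by auto
  show "upper_triangular (A * B)"
  proof (rule upper_triangularI)
    fix i j assume ij: "j < i" "i < dim_row (A * B)"
    then have "(A * B) $$ (i, j) = (\<Sum>l<n. A $$ (i, l) * B $$ (l, j))" using A B by (intro entry) auto
    also have "\<dots> = 0" using ij A B by (intro sum.neutral ballI zero) auto
    finally show "(A * B) $$ (i, j) = 0" .
  qed
  show "(A * B) $$ (i, i) = A $$ (i, i) * B $$ (i, i)" if i: "i < n" for i
  proof -
    have "(A * B) $$ (i, i) = (\<Sum>l\<in>{i}. A $$ (i, l) * B $$ (l, i))"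
      unfolding entry[OF i i] using i by (intro sum.mono_neutral_right ballI zero) auto
    then show ?thesis by simp
  qed
qed

lemma pow_upper_triangular:
  fixes A :: "complex mat"
  assumes A: "A \<in> carrier_mat n n" "upper_triangular A"
  shows "upper_triangular (A ^\<^sub>m k) \<and> (\<forall>i<n. (A ^\<^sub>m k) $$ (i, i) = A $$ (i, i) ^ k)"
proof (induction k)
  case 0
  then show ?case using A by auto
next
  case (Suc k)
  have "A ^\<^sub>m k \<in> carrier_mat n n" using A by simp
  then show ?case using mult_upper_triangular[OF _ _ A, of "A ^\<^sub>m k"] Suc by (simp add: mult.commute)
qed

lemma pow_mat_add_exp:
  assumes "A \<in> carrier_mat n n"
  shows "A ^\<^sub>m (j + k) = A ^\<^sub>m j * A ^\<^sub>m k"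
proof (induction k)
  case (Suc k)
  then show ?case using assms by (simp add: assoc_mult_mat[of _ n n _ n _ n])
qed (use assms in auto)

lemma pow_mat_commute:
  assumes "A \<in> carrier_mat n n"
  shows "A * A ^\<^sub>m k = A ^\<^sub>m k * A"
proof (induction k)
  case (Suc k)
  have "A * A ^\<^sub>m Suc k = (A * A ^\<^sub>m k) * A"
    using assms by (simp add: assoc_mult_mat[of _ n n _ n _ n])
  then show ?case using Suc by simp
qed (use assms in auto)

text \<open>The product of the \<open>X - z i\<close>, evaluated at \<open>A\<close> factor by
  factor; for a list of eigenvalues, Cayley-Hamilton says that it vanishes.\<close>

fun char_prod :: "complex mat \<Rightarrow> (nat \<Rightarrow> complex) \<Rightarrow> nat \<Rightarrow> complex mat" where
  "char_prod A z 0 = 1\<^sub>m (dim_row A)"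
| "char_prod A z (Suc m) = char_prod A z m * (A - z m \<cdot>\<^sub>m 1\<^sub>m (dim_row A))"

lemma char_prod_carrier [simp]: "A \<in> carrier_mat n n \<Longrightarrow> char_prod A z m \<in> carrier_mat n n"
  by (induction m) auto

text \<open>Column \<open>m\<close> of the next factor has its nonzero entries in rows below index
  \<open>m\<close>, where the product so far already has zero columns. Thus every factor kills one
  more column.\<close>

lemma char_prod_upper_triangular:
  assumes B: "B \<in> carrier_mat n n" "upper_triangular B" and z: "\<And>i. i < n \<Longrightarrow> z i = B $$ (i, i)"
  shows "m \<le> n \<Longrightarrow> i < n \<Longrightarrow> j < m \<Longrightarrow> char_prod B z m $$ (i, j) = 0"
proof (induction m arbitrary: i j)
  case (Suc m)
  let ?C = "B - z m \<cdot>\<^sub>m 1\<^sub>m (dim_row B)"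
  have C: "?C \<in> carrier_mat n n" using B by auto
  have j: "j < n" "m < n" using Suc.prems by auto
  have dims: "dim_row (char_prod B z m) = n" "dim_col (char_prod B z m) = n"
    using char_prod_carrier[OF B(1), of z m] by auto
  have "char_prod B z (Suc m) $$ (i, j) = (\<Sum>l<n. char_prod B z m $$ (i, l) * ?C $$ (l, j))"
    using j Suc.prems C B dims by (simp add: scalar_prod_def atLeast0LessThan)
  also have "\<dots> = 0"
  proof (intro sum.neutral ballI)
    fix l assume l: "l \<in> {..<n}"
    show "char_prod B z m $$ (i, l) * ?C $$ (l, j) = 0"
    proof (cases "l < m")
      case True
      then show ?thesis using Suc by simp
    next
      case False
      have "?C $$ (l, j) = 0"
      proof (cases "l = j")
        case True
        then have "l = m" using False Suc.prems by simp
        then show ?thesis using True l B z[of m] by auto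
      next
        case lj: False
        then have "j < l" using False Suc.prems by simp
        then have "B $$ (l, j) = 0" using l B upper_triangularD[of B j l] by auto
        then show ?thesis using lj l j B by auto
      qed
      then show ?thesis by simp
    qed
  qed
  finally show ?case .
qed simp

lemma conjugate_mult_mat:
  fixes P Q M C :: "complex mat"
  assumes "P \<in> carrier_mat n n" "Q \<in> carrier_mat n n" "M \<in> carrier_mat n n" "C \<in> carrier_mat n n"
    and QP: "Q * P = 1\<^sub>m n"
  shows "(P * M * Q) * (P * C * Q) = P * (M * C) * Q"
proof -
  have "(P * M * Q) * (P * C * Q) = P * (M * (Q * (P * (C * Q))))"
    using assms(1-4) by (simp add: assoc_mult_mat[of _ n n _ n _ n])
  also have "Q * (P * (C * Q)) = (Q * P) * (C * Q)"
    using assms(1-4) by (simp add: assoc_mult_mat[of _ n n _ n _ n])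
  also have "\<dots> = C * Q" using assms(2,4) by (simp add: QP)
  also have "P * (M * (C * Q)) = P * (M * C) * Q"
    using assms(1-4) by (simp add: assoc_mult_mat[of _ n n _ n _ n])
  finally show ?thesis .
qed

lemma char_prod_similar:
  assumes A: "A \<in> carrier_mat n n" and sim: "similar_mat_wit A B P Q"
  shows "char_prod A z m = P * char_prod B z m * Q"
proof -
  from similar_mat_witD2[OF A sim] have PQ: "P * Q = 1\<^sub>m n" "Q * P = 1\<^sub>m n" "A = P * B * Q"
    "B \<in> carrier_mat n n" "P \<in> carrier_mat n n" "Q \<in> carrier_mat n n" by auto
  show ?thesis
  proof (induction m)
    case 0
    then show ?case using PQ A by simp
  next
    case (Suc m)
    let ?M = "char_prod B z m" and ?C = "B - z m \<cdot>\<^sub>m 1\<^sub>m n"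
    have M: "?M \<in> carrier_mat n n" using PQ by simp
    have C: "?C \<in> carrier_mat n n" by (rule minus_carrier_mat) simp
    have "A - z m \<cdot>\<^sub>m 1\<^sub>m n = P * ?C * Q"
    proof -
      have "P * (z m \<cdot>\<^sub>m 1\<^sub>m n) * Q = z m \<cdot>\<^sub>m 1\<^sub>m n"
        using PQ by (simp add: mult_smult_distrib[of P n n _ n] mult_smult_assoc_mat[of P n n _ n])
      then show ?thesis using PQ
        by (simp add: mult_minus_distrib_mat[of P n n] minus_mult_distrib_mat[of _ n n _ _ n])
    qed
    then have "char_prod A z (Suc m) = (P * ?M * Q) * (P * ?C * Q)"
      using Suc A by simp
    also have "\<dots> = P * (?M * ?C) * Q"
      by (rule conjugate_mult_mat[OF PQ(5,6) M C PQ(2)])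
    finally show ?case using PQ by simp
  qed
qed

text \<open>Each linear factor acts on the sequence as the corresponding matrix factor acts on the
  powers of \<open>A\<close>. With Cayley-Hamilton this yields a recurrence for every linear
  functional \<open>\<phi>\<close>, in particular for traces of \<open>X * M * Y\<close> and for
  single entries.\<close>

lemma poly_act_char_prod:
  fixes A :: "complex mat" and \<phi> :: "complex mat \<Rightarrow> complex"
  assumes A: "A \<in> carrier_mat n n"
    and add: "\<And>M N. M \<in> carrier_mat n n \<Longrightarrow> N \<in> carrier_mat n n \<Longrightarrow> \<phi> (M + N) = \<phi> M + \<phi> N"
    and scale: "\<And>c M. M \<in> carrier_mat n n \<Longrightarrow> \<phi> (c \<cdot>\<^sub>m M) = c * \<phi> M"
  shows "poly_act (\<Prod>i<m. [:- z i, 1:]) (\<lambda>k. \<phi> (A ^\<^sub>m k)) = (\<lambda>k. \<phi> (char_prod A z m * A ^\<^sub>m k))"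
proof (induction m)
  case 0
  have "1\<^sub>m (dim_row A) * A ^\<^sub>m k = A ^\<^sub>m k" for k using A by simp
  then show ?case by (simp add: poly_act_def fun_eq_iff)
next
  case (Suc m)
  have "poly_act (\<Prod>i<Suc m. [:- z i, 1:]) (\<lambda>k. \<phi> (A ^\<^sub>m k)) =
     poly_act [:- z m, 1:] (\<lambda>k. \<phi> (char_prod A z m * A ^\<^sub>m k))"
    by (subst prod.lessThan_Suc, subst mult.commute, subst poly_act_mult, subst Suc) simp
  also have "\<dots> = (\<lambda>k. \<phi> (char_prod A z (Suc m) * A ^\<^sub>m k))"
  proof
    fix k
    let ?M = "char_prod A z m" and ?K = "A ^\<^sub>m k"
    have M: "?M \<in> carrier_mat n n" and K: "?K \<in> carrier_mat n n" using A by auto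
    have "char_prod A z (Suc m) * ?K = ?M * A * ?K + (- z m) \<cdot>\<^sub>m (?M * ?K)"
    proof -
      have "?M * (A - z m \<cdot>\<^sub>m 1\<^sub>m n) * ?K = (?M * A - z m \<cdot>\<^sub>m ?M) * ?K"
        using M A right_mult_one_mat[OF M]
        by (simp add: mult_minus_distrib_mat[of _ n n _ n] mult_smult_distrib[of _ n n _ n])
      also have "\<dots> = ?M * A * ?K - z m \<cdot>\<^sub>m (?M * ?K)"
        using minus_mult_distrib_mat[OF mult_carrier_mat[OF M A] smult_carrier_mat[OF M] K]
          mult_smult_assoc_mat[OF M K] by simp
      also have "\<dots> = ?M * A * ?K + (- z m) \<cdot>\<^sub>m (?M * ?K)"
        using M A K by (intro eq_matI) auto
      finally show ?thesis using A by simp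
    qed
    moreover have "?M * A * ?K = ?M * A ^\<^sub>m Suc k"
      using M A K pow_mat_commute[OF A, of k] by (simp add: assoc_mult_mat[of _ n n _ n _ n])
    ultimately have "\<phi> (char_prod A z (Suc m) * ?K) = \<phi> (?M * A ^\<^sub>m Suc k) - z m * \<phi> (?M * ?K)"
      using add[OF mult_carrier_mat[OF M pow_carrier_mat[OF A, of "Suc k"]] smult_carrier_mat[OF mult_carrier_mat[OF M K]], of "- z m"]
        scale[OF mult_carrier_mat[OF M K], of "- z m"] by (simp del: char_prod.simps pow_mat.simps)
    then show "poly_act [:- z m, 1:] (\<lambda>k. \<phi> (char_prod A z m * A ^\<^sub>m k)) k = \<phi> (char_prod A z (Suc m) * ?K)"
      by (simp only: poly_act_linear)
  qed
  finally show ?case .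
qed

text \<open>The diagonal of a Schur triangulation serves for all three claims, which are stated
  together so that they refer to the same enumeration \<open>z\<close>.\<close>

lemma eigenvalues_exist:
  fixes A :: "complex mat"
  assumes A: "A \<in> carrier_mat n n"
  shows "\<exists>z. (\<forall>j. mtrace (A ^\<^sub>m j) = (\<Sum>i<n. z i ^ j))
    \<and> char_prod A z n = 0\<^sub>m n n
    \<and> (\<forall>N. A ^\<^sub>m N = 1\<^sub>m n \<longrightarrow> (\<forall>i<n. z i ^ N = 1))"
proof -
  obtain es where es: "char_poly A = (\<Prod>e\<leftarrow>es. [:- e, 1:])" "length es = n"
    using char_poly_factorized[OF A] by blast
  obtain B P Q where dec: "schur_decomposition A es = (B, P, Q)" by (cases "schur_decomposition A es")
  from schur_decomposition[OF A es(1) dec] have sim: "similar_mat_wit A B P Q" and ut: "upper_triangular B"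
    and diag: "diag_mat B = es" by auto
  from similar_mat_witD2[OF A sim] have PQ: "P * Q = 1\<^sub>m n" "Q * P = 1\<^sub>m n" "A = P * B * Q"
    "B \<in> carrier_mat n n" "P \<in> carrier_mat n n" "Q \<in> carrier_mat n n" by auto
  define z where "z = (\<lambda>i. B $$ (i, i))"
  have pow: "A ^\<^sub>m j = P * B ^\<^sub>m j * Q" for j
    using similar_mat_wit_pow_id[OF sim] by simp
  have Bj: "B ^\<^sub>m j \<in> carrier_mat n n" for j using PQ by simp
  have Bpow: "B ^\<^sub>m j = Q * A ^\<^sub>m j * P" for j
    using similar_mat_wit_pow_id[OF similar_mat_wit_sym[OF sim]] by simp
  have "mtrace (A ^\<^sub>m j) = (\<Sum>i<n. z i ^ j)" for j
  proof -
    have "mtrace (A ^\<^sub>m j) = mtrace (P * (B ^\<^sub>m j * Q))"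
      unfolding pow using PQ(4-6) Bj[of j] by (simp add: assoc_mult_mat[of _ n n _ n _ n])
    also have "\<dots> = mtrace (B ^\<^sub>m j * Q * P)"
      using PQ Bj[of j] by (intro mtrace_comm) auto
    also have "B ^\<^sub>m j * Q * P = B ^\<^sub>m j"
      using PQ Bj[of j] by (simp add: assoc_mult_mat[of _ n n _ n _ n])
    also have "mtrace (B ^\<^sub>m j) = (\<Sum>i<n. z i ^ j)"
      using pow_upper_triangular[OF PQ(4) ut, of j] Bj[of j] PQ(4) by (simp add: mtrace_def z_def)
    finally show ?thesis .
  qed
  moreover have "char_prod A z n = 0\<^sub>m n n"
  proof -
    have "char_prod B z n = 0\<^sub>m n n"
      using char_prod_upper_triangular[OF PQ(4) ut, of z n] char_prod_carrier[OF PQ(4), of z n]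
      by (intro eq_matI) (auto simp: z_def)
    then show ?thesis using char_prod_similar[OF A sim, of z n] PQ by simp
  qed
  moreover have "z i ^ N = 1" if "A ^\<^sub>m N = 1\<^sub>m n" "i < n" for i N
  proof -
    have "B ^\<^sub>m N = 1\<^sub>m n" using Bpow[of N] that PQ by simp
    then show ?thesis using pow_upper_triangular[OF PQ(4) ut, of N] that by (auto simp: z_def)
  qed
  ultimately show ?thesis by blast
qed

text \<open>Finite order makes the entries of the powers periodic, hence bounded, and they satisfy a
  recurrence whose roots are all \<open>1\<close>. The difference bound is then \<open>0\<close> and
  identifies the first power with the zeroth.\<close>

lemma torsion_unipotent_mat:
  fixes A :: "complex mat"
  assumes A: "A \<in> carrier_mat n n" and cp: "char_prod A (\<lambda>_. 1) n = 0\<^sub>m n n" and N: "A ^\<^sub>m N = 1\<^sub>m n" "N > 0"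
  shows "A = 1\<^sub>m n"
proof (cases "n = 0")
  case True
  then show ?thesis using A by auto
next
  case False
  have per: "A ^\<^sub>m k = A ^\<^sub>m (k mod N)" for k
  proof -
    have "A ^\<^sub>m (k mod N + N * j) = A ^\<^sub>m (k mod N)" for j
    proof (induction j)
      case (Suc j)
      have "A ^\<^sub>m (k mod N + N * Suc j) = A ^\<^sub>m (k mod N + N * j) * A ^\<^sub>m N"
        using pow_mat_add_exp[OF A, of "k mod N + N * j" N] by (simp add: algebra_simps)
      then show ?case using Suc N A by simp
    qed simp
    from this[of "k div N"] show ?thesis by simp
  qed
  show ?thesis
  proof (rule eq_matI)
    fix i j assume "i < dim_row (1\<^sub>m n :: complex mat)" "j < dim_col (1\<^sub>m n :: complex mat)"
    then have ij: "i < n" "j < n" by auto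
    define s where "s = (\<lambda>k. (A ^\<^sub>m k) $$ (i, j))"
    define B where "B = Max ((\<lambda>k. norm (s k)) ` {..<N})"
    have "norm (s k) \<le> B" for k
    proof -
      have "s k = s (k mod N)" by (simp add: s_def per[of k])
      moreover have "norm (s (k mod N)) \<le> B" unfolding B_def using N(2) by (intro Max_ge) auto
      ultimately show ?thesis by simp
    qed
    moreover have "poly_act (\<Prod>i<n. [:- ee 0, 1:]) s = (\<lambda>k. 0)"
    proof -
      have "poly_act (\<Prod>i<n. [:- ee 0, 1:]) s = (\<lambda>k. (char_prod A (\<lambda>_. 1) n * A ^\<^sub>m k) $$ (i, j))"
        unfolding s_def using poly_act_char_prod[OF A, of "\<lambda>M. M $$ (i, j)" "\<lambda>_. 1" n] ij by simp
      then show ?thesis using A ij by (simp add: cp)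
    qed
    ultimately have "norm (s (Suc 0) - s 0) \<le> B * (\<Sum>i<n. norm (ee 0 - 1))"
      using False by (intro bounded_recurrence_difference) auto
    then have "s (Suc 0) = s 0" by simp
    then show "A $$ (i, j) = 1\<^sub>m n $$ (i, j)" using A by (simp add: s_def)
  qed (use A in auto)
qed

text \<open>The trace form factors through the \<open>n * n\<close> coordinates of a matrix, so its
  Gram matrices have rank at most \<open>n * n\<close>.\<close>

lemma det_trace_form_zero:
  fixes X Y :: "nat \<Rightarrow> complex mat"
  assumes X: "\<And>i. X i \<in> carrier_mat n n" and Y: "\<And>j. Y j \<in> carrier_mat n n"
  shows "det (mat (Suc (n * n)) (Suc (n * n)) (\<lambda>(i, j). mtrace (X i * Y j))) = 0"
proof -
  let ?D = "Suc (n * n)"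
  obtain b where b: "bij_betw b {..<n * n} ({..<n} \<times> {..<n})"
    using ex_bij_betw_nat_finite[of "{..<n} \<times> {..<n}"] by (auto simp: card_cartesian_product atLeast0LessThan)
  \<comment> \<open>A zero column here and a zero row in \<open>V\<close> make both factors square,
    so that the determinant is multiplicative.\<close>
  define U where "U = mat ?D ?D (\<lambda>(i, p). if p < n * n then X i $$ b p else 0)"
  define V where "V = mat ?D ?D (\<lambda>(p, j). if p < n * n then Y j $$ prod.swap (b p) else 0)"
  have "mat ?D ?D (\<lambda>(i, j). mtrace (X i * Y j)) = U * V"
  proof (rule eq_matI)
    fix i j assume "i < dim_row (U * V)" "j < dim_col (U * V)"
    then have ij: "i < ?D" "j < ?D" by (auto simp: U_def V_def)
    have "(U * V) $$ (i, j) = (\<Sum>p<?D. U $$ (i, p) * V $$ (p, j))"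
      using ij by (simp add: U_def V_def scalar_prod_def atLeast0LessThan)
    also have "\<dots> = (\<Sum>p<n*n. X i $$ b p * Y j $$ prod.swap (b p))"
      using ij by (simp add: U_def V_def)
    also have "\<dots> = (\<Sum>q\<in>{..<n} \<times> {..<n}. X i $$ q * Y j $$ prod.swap q)"
      by (rule sum.reindex_bij_betw[OF b])
    also have "\<dots> = mtrace (X i * Y j)"
      unfolding mtrace_mult[OF X Y] sum.cartesian_product by (intro sum.cong) auto
    finally show "mat ?D ?D (\<lambda>(i, j). mtrace (X i * Y j)) $$ (i, j) = (U * V) $$ (i, j)" using ij by simp
  qed (auto simp: U_def V_def)
  moreover have "det U = 0"
  proof -
    have "U *\<^sub>v unit_vec ?D (n * n) = 0\<^sub>v ?D"
      by (intro eq_vecI) (auto simp: U_def)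
    moreover have "unit_vec ?D (n * n) \<noteq> (0\<^sub>v ?D :: complex vec)" by simp
    moreover have "U \<in> carrier_mat ?D ?D" by (simp add: U_def)
    ultimately show ?thesis using det_0_iff_vec_prod_zero unit_vec_carrier by blast
  qed
  moreover have "det (U * V) = det U * det V" by (rule det_mult[of _ ?D]) (simp_all add: U_def V_def)
  ultimately show ?thesis by (simp only: mult_zero_left)
qed

section \<open>Eigenvalue systems\<close>

lemma poly_act_diff: "poly_act p (\<lambda>k. s k - t k) k = poly_act p s k - poly_act p t k"
  by (simp add: poly_act_def right_diff_distrib sum_subtractf)

text \<open>The formal properties of the eigenvalues \<open>\<mu> \<gamma> 0, \<dots>, \<mu> \<gamma> (n - 1)\<close> of \<open>\<rho> \<gamma>\<close>, for a
  representation \<open>\<rho>\<close> of degree \<open>n\<close>, which are polynomial identities with integer coefficients and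
  hence survive both Galois conjugation of roots of unity and limits.\<close>

locale spectral_system = group G for G (structure) +
  fixes n :: nat and \<mu> :: "'a \<Rightarrow> nat \<Rightarrow> complex"
  assumes n_pos: "n > 0"
    and norm_eigenvalue: "\<gamma> \<in> carrier G \<Longrightarrow> i < n \<Longrightarrow> norm (\<mu> \<gamma> i) = 1"
    and power_sum: "\<gamma> \<in> carrier G \<Longrightarrow> (\<Sum>i<n. \<mu> (\<gamma> [^] j) i) = (\<Sum>i<n. \<mu> \<gamma> i ^ (j::nat))"
    and cayley_hamilton_0: "x \<in> carrier G \<Longrightarrow> \<gamma> \<in> carrier G \<Longrightarrow> y \<in> carrier G \<Longrightarrow>
      poly_act (\<Prod>i<n. [:- \<mu> \<gamma> i, 1:]) (\<lambda>k. \<Sum>i<n. \<mu> (x \<otimes> \<gamma> [^] k \<otimes> y) i) 0 = 0"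
    and gram_det: "(\<And>i. g i \<in> carrier G) \<Longrightarrow> (\<And>i. h i \<in> carrier G) \<Longrightarrow>
      det (mat (Suc (n * n)) (Suc (n * n)) (\<lambda>(i, j). \<Sum>l<n. \<mu> (g i \<otimes> h j) l)) = 0"
begin

definition chi :: "'a \<Rightarrow> complex" where
  "chi \<gamma> = (\<Sum>i<n. \<mu> \<gamma> i)"

lemma norm_chi: "\<gamma> \<in> carrier G \<Longrightarrow> norm (chi \<gamma>) \<le> n"
  unfolding chi_def using norm_eigenvalue by (intro order.trans[OF norm_sum]) (simp add: sum_bounded_above[where K = 1, simplified])

lemma chi_pow: "\<gamma> \<in> carrier G \<Longrightarrow> chi (\<gamma> [^] j) = (\<Sum>i<n. \<mu> \<gamma> i ^ (j::nat))"
  unfolding chi_def by (rule power_sum)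

lemma chi_one: "chi \<one> = n"
  using chi_pow[of \<one> 0] by simp

text \<open>The index \<open>k\<close> is absorbed into the left factor \<open>x\<close>, which is
  why the locale states the relation only at \<open>0\<close>.\<close>

lemma cayley_hamilton:
  assumes "x \<in> carrier G" "\<gamma> \<in> carrier G" "y \<in> carrier G"
  shows "poly_act (\<Prod>i<n. [:- \<mu> \<gamma> i, 1:]) (\<lambda>k. chi (x \<otimes> \<gamma> [^] k \<otimes> y)) = (\<lambda>k. 0)"
proof
  fix k
  have "poly_act (\<Prod>i<n. [:- \<mu> \<gamma> i, 1:]) (\<lambda>k. chi (x \<otimes> \<gamma> [^] k \<otimes> y)) k =
     poly_act (\<Prod>i<n. [:- \<mu> \<gamma> i, 1:]) (\<lambda>j. chi ((x \<otimes> \<gamma> [^] k) \<otimes> \<gamma> [^] j \<otimes> y)) 0"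
    using assms by (simp add: poly_act_def nat_pow_mult m_assoc)
  also have "\<dots> = 0" unfolding chi_def using assms by (intro cayley_hamilton_0) auto
  finally show "poly_act (\<Prod>i<n. [:- \<mu> \<gamma> i, 1:]) (\<lambda>k. chi (x \<otimes> \<gamma> [^] k \<otimes> y)) k = 0" .
qed

text \<open>Left and right multiplication by \<open>a - 1\<close> and \<open>b - 1\<close> contract by the spreads of the
  eigenvalues, and \<open>a b - b a\<close> equals \<open>(a - 1) (b - 1) - (b - 1) (a - 1)\<close>.\<close>

lemma double_difference_bound:
  assumes ab: "a \<in> carrier G" "b \<in> carrier G" and xy: "x \<in> carrier G" "y \<in> carrier G"
    and p: "\<And>i. i < n \<Longrightarrow> \<mu> a i = ee (p i)" and q: "\<And>i. i < n \<Longrightarrow> \<mu> b i = ee (q i)"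
  shows "norm ((chi (x \<otimes> a \<otimes> b \<otimes> y) - chi (x \<otimes> a \<otimes> y)) - (chi (x \<otimes> b \<otimes> y) - chi (x \<otimes> y)))
    \<le> (\<Sum>i<n. norm (ee (p i) - 1)) * (\<Sum>i<n. norm (ee (q i) - 1)) * n"
proof -
  define \<beta> where "\<beta> = (\<Sum>i<n. norm (ee (q i) - 1))"
  \<comment> \<open>The difference bound for \<open>b\<close> bounds \<open>u\<close> by a multiple
    of the spread of \<open>b\<close>, while \<open>u\<close> still satisfies the recurrence of
    \<open>a\<close>; applying the bound again multiplies the spreads.\<close>
  define u where "u = (\<lambda>k::nat. chi (x \<otimes> a [^] k \<otimes> (b \<otimes> y)) - chi (x \<otimes> a [^] k \<otimes> y))"
  have u_bound: "norm (u k) \<le> n * \<beta>" for k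
  proof -
    define s where "s = (\<lambda>l::nat. chi ((x \<otimes> a [^] k) \<otimes> b [^] l \<otimes> y))"
    have "norm (s (Suc 0) - s 0) \<le> real n * (\<Sum>i<n. norm (ee (q i) - 1))"
    proof (rule bounded_recurrence_difference)
      show "norm (s l) \<le> real n" for l unfolding s_def using ab xy by (intro norm_chi) auto
      have "(\<Prod>i<n. [:- ee (q i), 1:]) = (\<Prod>i<n. [:- \<mu> b i, 1:])" using q by simp
      then show "poly_act (\<Prod>i<n. [:- ee (q i), 1:]) s = (\<lambda>k. 0)"
        unfolding s_def using ab xy by (simp add: cayley_hamilton)
      show "n > 0" by (rule n_pos)
    qed
    then show ?thesis using ab xy by (simp add: s_def u_def \<beta>_def m_assoc)
  qed
  have "norm (u (Suc 0) - u 0) \<le> (n * \<beta>) * (\<Sum>i<n. norm (ee (p i) - 1))"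
  proof (rule bounded_recurrence_difference)
    have "(\<Prod>i<n. [:- ee (p i), 1:]) = (\<Prod>i<n. [:- \<mu> a i, 1:])" using p by simp
    then show "poly_act (\<Prod>i<n. [:- ee (p i), 1:]) u = (\<lambda>k. 0)"
      unfolding u_def using ab xy by (simp add: fun_eq_iff poly_act_diff cayley_hamilton)
  qed (use u_bound n_pos in auto)
  then show ?thesis using ab xy by (simp add: u_def \<beta>_def m_assoc mult_ac)
qed

text \<open>With \<open>z = inv (b \<otimes> a) \<otimes> y\<close>, the words
  \<open>x a b z\<close> and \<open>x b a z\<close> become \<open>x c y\<close> and
  \<open>x y\<close> for the commutator \<open>c\<close>. The double differences for both orders of
  \<open>a\<close> and \<open>b\<close> share their lower terms, which cancel; this gives the factor
  \<open>2\<close>.\<close>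

lemma commutator_bound:
  assumes ab: "a \<in> carrier G" "b \<in> carrier G" and xy: "x \<in> carrier G" "y \<in> carrier G"
    and p: "\<And>i. i < n \<Longrightarrow> \<mu> a i = ee (p i)" and q: "\<And>i. i < n \<Longrightarrow> \<mu> b i = ee (q i)"
  shows "norm (chi (x \<otimes> (a \<otimes> b \<otimes> inv (b \<otimes> a)) \<otimes> y) - chi (x \<otimes> y))
    \<le> 2 * (\<Sum>i<n. norm (ee (p i) - 1)) * (\<Sum>i<n. norm (ee (q i) - 1)) * n"
proof -
  define \<alpha> where "\<alpha> = (\<Sum>i<n. norm (ee (p i) - 1))"
  define \<beta> where "\<beta> = (\<Sum>i<n. norm (ee (q i) - 1))"
  define z where "z = inv (b \<otimes> a) \<otimes> y"
  have z: "z \<in> carrier G" using ab xy by (simp add: z_def)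
  have 1: "norm ((chi (x \<otimes> a \<otimes> b \<otimes> z) - chi (x \<otimes> a \<otimes> z)) - (chi (x \<otimes> b \<otimes> z) - chi (x \<otimes> z))) \<le> \<alpha> * \<beta> * n"
    unfolding \<alpha>_def \<beta>_def by (rule double_difference_bound[OF ab xy(1) z p q])
  have 2: "norm ((chi (x \<otimes> b \<otimes> a \<otimes> z) - chi (x \<otimes> b \<otimes> z)) - (chi (x \<otimes> a \<otimes> z) - chi (x \<otimes> z))) \<le> \<beta> * \<alpha> * n"
    unfolding \<alpha>_def \<beta>_def by (rule double_difference_bound[OF ab(2,1) xy(1) z q p])
  have "x \<otimes> b \<otimes> a \<otimes> z = x \<otimes> y"
  proof -
    have "x \<otimes> b \<otimes> a \<otimes> z = x \<otimes> ((b \<otimes> a) \<otimes> inv (b \<otimes> a)) \<otimes> y"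
      using ab xy by (simp only: z_def m_assoc m_closed inv_closed)
    then show ?thesis using ab xy by (simp add: r_inv)
  qed
  moreover have "x \<otimes> a \<otimes> b \<otimes> z = x \<otimes> (a \<otimes> b \<otimes> inv (b \<otimes> a)) \<otimes> y"
    using ab xy by (simp only: z_def m_assoc m_closed inv_closed)
  moreover have "norm (chi (x \<otimes> a \<otimes> b \<otimes> z) - chi (x \<otimes> b \<otimes> a \<otimes> z)) \<le> \<alpha> * \<beta> * n + \<beta> * \<alpha> * n"
    using order.trans[OF norm_triangle_ineq4 add_mono[OF 1 2]] by (simp add: algebra_simps)
  ultimately show ?thesis by (simp add: \<alpha>_def \<beta>_def mult_ac)
qed

text \<open>Telescoping over the powers of the commutator. Linear growth in \<open>J\<close> against
  a product of two spreads is what the rescaling of \<open>h\<close> exploits later.\<close>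

lemma commutator_power_bound:
  assumes ab: "a \<in> carrier G" "b \<in> carrier G"
    and p: "\<And>i. i < n \<Longrightarrow> \<mu> a i = ee (p i)" and q: "\<And>i. i < n \<Longrightarrow> \<mu> b i = ee (q i)"
  shows "norm (chi ((a \<otimes> b \<otimes> inv (b \<otimes> a)) [^] (J::nat)) - n)
    \<le> J * (2 * (\<Sum>i<n. norm (ee (p i) - 1)) * (\<Sum>i<n. norm (ee (q i) - 1)) * n)"
proof (induction J)
  case 0
  then show ?case by (simp add: chi_one)
next
  case (Suc J)
  let ?c = "a \<otimes> b \<otimes> inv (b \<otimes> a)" and ?B = "2 * (\<Sum>i<n. norm (ee (p i) - 1)) * (\<Sum>i<n. norm (ee (q i) - 1)) * n"
  have c: "?c \<in> carrier G" using ab by simp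
  have "norm (chi (?c [^] J \<otimes> ?c \<otimes> \<one>) - chi (?c [^] J \<otimes> \<one>)) \<le> ?B"
    using c by (intro commutator_bound[OF ab _ _ p q]) auto
  then have "norm (chi (?c [^] Suc J) - chi (?c [^] J)) \<le> ?B" using c by simp
  with Suc have "norm (chi (?c [^] Suc J) - n) \<le> ?B + J * ?B"
    using norm_triangle_ineq[of "chi (?c [^] Suc J) - chi (?c [^] J)" "chi (?c [^] J) - n"] by simp
  then show ?case by (simp add: algebra_simps)
qed

text \<open>Equality in the triangle inequality: real parts of at most \<open>1\<close> that add up
  to \<open>n\<close> are all \<open>1\<close>.\<close>

lemma eigenvalues_one:
  assumes "\<gamma> \<in> carrier G" "chi \<gamma> = n" "i < n"
  shows "\<mu> \<gamma> i = 1"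
proof -
  have Re_le: "Re (\<mu> \<gamma> j) \<le> 1" if "j < n" for j
    using complex_Re_le_cmod[of "\<mu> \<gamma> j"] norm_eigenvalue[OF assms(1) that] by simp
  have "(\<Sum>j<n. 1 - Re (\<mu> \<gamma> j)) = n - Re (chi \<gamma>)" by (simp add: chi_def sum_subtractf)
  then have "(\<Sum>j<n. 1 - Re (\<mu> \<gamma> j)) = 0" using assms(2) by simp
  then have "1 - Re (\<mu> \<gamma> i) = 0" using Re_le assms(3)
    by (subst (asm) sum_nonneg_eq_0_iff) auto
  moreover have "(Re (\<mu> \<gamma> i))\<^sup>2 + (Im (\<mu> \<gamma> i))\<^sup>2 = 1"
    using norm_eigenvalue[OF assms(1,3)] by (metis cmod_power2 power_one)
  ultimately show ?thesis by (simp add: complex_eq_iff)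
qed

end

section \<open>Eigenvalue systems of torsion type\<close>

text \<open>Equal power sums give equal sums of any polynomial. One that vanishes at all values
  except \<open>y i0\<close> sums over the \<open>y i\<close> to a positive multiple of a nonzero
  number, but to \<open>0\<close> over the \<open>x i\<close> if these omit
  \<open>y i0\<close>.\<close>

lemma power_sums_eq_imp_mem:
  fixes x y :: "nat \<Rightarrow> complex"
  assumes eq: "\<And>j::nat. (\<Sum>i<n. x i ^ j) = (\<Sum>i<n. y i ^ j)" and i0: "i0 < n"
  shows "y i0 \<in> x ` {..<n}"
proof (rule ccontr)
  assume nin: "y i0 \<notin> x ` {..<n}"
  have poly_eq: "(\<Sum>i<n. poly r (x i)) = (\<Sum>i<n. poly r (y i))" for r
  proof -
    have "(\<Sum>i<n. poly r (w i)) = (\<Sum>j\<le>degree r. coeff r j * (\<Sum>i<n. w i ^ j))" for w :: "nat \<Rightarrow> complex"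
      unfolding poly_altdef by (subst sum.swap) (simp add: sum_distrib_left)
    then show ?thesis by (simp add: eq)
  qed
  define Z where "Z = (x ` {..<n} \<union> y ` {..<n}) - {y i0}"
  define r where "r = (\<Prod>w\<in>Z. [:- w, 1:])"
  have finZ: "finite Z" by (simp add: Z_def)
  have zero: "poly r w = 0" if "w \<in> Z" for w
    using that finZ by (auto simp: r_def poly_prod)
  have "poly r (y i0) \<noteq> 0" using finZ by (auto simp: r_def poly_prod Z_def)
  moreover have "(\<Sum>i<n. poly r (x i)) = 0"
    using nin by (intro sum.neutral ballI zero) (force simp: Z_def)
  moreover have "(\<Sum>i<n. poly r (y i)) = of_nat (card {i. i < n \<and> y i = y i0}) * poly r (y i0)"
  proof -
    have "(\<Sum>i<n. poly r (y i)) = (\<Sum>i\<in>{i. i < n \<and> y i = y i0}. poly r (y i))"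
      using zero by (intro sum.mono_neutral_right) (auto simp: Z_def)
    also have "\<dots> = (\<Sum>i\<in>{i. i < n \<and> y i = y i0}. poly r (y i0))" by (intro sum.cong) auto
    finally show ?thesis by simp
  qed
  ultimately have "card {i. i < n \<and> y i = y i0} = 0" using poly_eq[of r] by simp
  then show False using i0 by auto
qed

text \<open>The ring \<open>Z[\<zeta>]\<close> for \<open>\<zeta>\<close> of order \<open>M\<close>,
  given by integer polynomials so that conjugation can act on their argument.\<close>

definition root_ring :: "nat \<Rightarrow> complex set" where
  "root_ring M = {ipoly P (ee (1 / of_nat M)) | P. True}"

lemma root_ringI: "ipoly P (ee (1 / of_nat M)) \<in> root_ring M"
  by (auto simp: root_ring_def)

lemma root_ring_add: "x \<in> root_ring M \<Longrightarrow> y \<in> root_ring M \<Longrightarrow> x + y \<in> root_ring M"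
  unfolding root_ring_def by clarify (metis ipoly_add)

lemma root_ring_mult: "x \<in> root_ring M \<Longrightarrow> y \<in> root_ring M \<Longrightarrow> x * y \<in> root_ring M"
  unfolding root_ring_def by clarify (metis ipoly_mult)

lemma root_ring_of_int: "of_int c \<in> root_ring M"
  using root_ringI[of "[:c:]" M] by (simp add: ipoly_const)

lemma root_ring_0: "0 \<in> root_ring M" and root_ring_1: "1 \<in> root_ring M"
  using root_ring_of_int[of 0] root_ring_of_int[of 1] by simp_all

lemma root_ring_sum: "(\<And>i. i \<in> A \<Longrightarrow> f i \<in> root_ring M) \<Longrightarrow> sum f A \<in> root_ring M"
  by (induction A rule: infinite_finite_induct) (auto simp: root_ring_0 root_ring_add)

lemma root_ring_prod: "(\<And>i. i \<in> A \<Longrightarrow> f i \<in> root_ring M) \<Longrightarrow> prod f A \<in> root_ring M"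
  by (induction A rule: infinite_finite_induct) (auto simp: root_ring_1 root_ring_mult)

lemma root_ring_power: "x \<in> root_ring M \<Longrightarrow> x ^ k \<in> root_ring M"
  by (induction k) (auto simp: root_ring_1 root_ring_mult)

lemma root_ring_det:
  assumes A: "A \<in> carrier_mat d d" "\<And>i j. i < d \<Longrightarrow> j < d \<Longrightarrow> A $$ (i, j) \<in> root_ring M"
  shows "det A \<in> root_ring M"
  unfolding det_def'[OF A(1)]
proof (intro root_ring_sum root_ring_mult root_ring_prod)
  fix p assume "p \<in> {p. p permutes {0..<d}}"
  then have p: "p permutes {0..<d}" by simp
  show "signof p \<in> root_ring M" using root_ring_of_int[of 1 M] root_ring_of_int[of "-1" M]
    by (auto simp: sign_def)
  fix i assume "i \<in> {0..<d}"
  then show "A $$ (i, p i) \<in> root_ring M" using A(2)[of i "p i"] permutes_in_image[OF p, of i] by auto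
qed

lemma root_ring_adj_mat:
  assumes A: "A \<in> carrier_mat d d" "\<And>i j. i < d \<Longrightarrow> j < d \<Longrightarrow> A $$ (i, j) \<in> root_ring M"
    and ij: "i < d" "j < d"
  shows "adj_mat A $$ (i, j) \<in> root_ring M"
proof -
  have "det (mat_delete A j i) \<in> root_ring M"
  proof (rule root_ring_det)
    show "mat_delete A j i \<in> carrier_mat (d - 1) (d - 1)" using A(1) by (rule mat_delete_carrier)
    show "mat_delete A j i $$ (k, l) \<in> root_ring M" if "k < d - 1" "l < d - 1" for k l
      using that A by (auto simp: mat_delete_def)
  qed
  moreover have "((-1) ^ (j + i) :: complex) \<in> root_ring M"
    using root_ring_power[OF root_ring_of_int[of "-1"]] by simp
  ultimately show ?thesis using A ij by (auto simp: adj_mat_def cofactor_def intro: root_ring_mult)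
qed

lemma ee_eq_power:
  assumes "of_nat K * q \<in> (\<int> :: rat set)" "K > 0"
  obtains a :: nat where "ee q = ee (1 / of_nat K) ^ a"
proof -
  obtain z where z: "of_nat K * q = of_int z" using assms(1) by (auto elim: Ints_cases)
  define a where "a = nat (z mod int K)"
  have a: "int a = z mod int K" using assms(2) by (simp add: a_def)
  have "of_int z = (of_nat K * of_int (z div int K) + of_int (int a) :: rat)"
    unfolding a by (metis mult_div_mod_eq of_int_add of_int_mult of_int_of_nat_eq)
  then have "q = of_int (z div int K) + of_nat a * (1 / of_nat K)"
    using z assms(2) by (simp add: field_simps)
  then have "q - of_nat a * (1 / of_nat K) \<in> \<int>" by simp
  then have "ee q = ee (of_nat a * (1 / of_nat K))" by (simp only: ee_eq_iff)
  then have "ee q = ee (1 / of_nat K) ^ a" by (simp only: ee_of_nat_mult)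
  then show ?thesis by (rule that)
qed

lemma ee_in_root_ring:
  assumes "of_nat M * q \<in> (\<int> :: rat set)" "M > 0"
  shows "ee q \<in> root_ring M"
proof -
  obtain a where "ee q = ee (1 / of_nat M) ^ a" using ee_eq_power[OF assms] .
  then have "ee q = ipoly (monom 1 a) (ee (1 / of_nat M))" by (simp add: poly_monom)
  then show ?thesis using root_ringI by metis
qed

lemma denominator_dvd_mult_Ints:
  assumes "nat (snd (quotient_of q)) dvd M"
  shows "of_nat M * q \<in> (\<int> :: rat set)"
proof -
  obtain c where "M = nat (snd (quotient_of q)) * c" using assms by (auto simp: dvd_def)
  then have "of_nat M * q = of_nat c * (of_nat (nat (snd (quotient_of q))) * q)" by simp
  then show ?thesis by (simp only: Ints_mult Ints_of_nat denominator_mult_Ints)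
qed

text \<open>Galois conjugation over the cyclotomic ring fixes the power sums and hence permutes the roots
  of unity, which bounds their degrees.\<close>

lemma conjugate_orbit_bound:
  fixes q :: "nat \<Rightarrow> rat" and \<Delta> :: complex
  assumes M: "M > 0" and \<Delta>: "\<Delta> \<noteq> 0" "\<Delta> \<in> root_ring M"
    and sums: "\<And>j::nat. \<exists>l. \<Delta> ^ l * (\<Sum>i<n. ee (q i) ^ j) \<in> root_ring M" and i0: "i0 < n"
  shows "totient (nat (snd (quotient_of (q i0)))) \<le> M * n"
proof -
  define den where "den = (\<lambda>i. nat (snd (quotient_of (q i))))"
  define K where "K = M * (\<Prod>i<n. den i)"
  \<comment> \<open>All \<open>ee (q i)\<close> and the generator \<open>\<zeta>\<close> are powers
    of \<open>z\<close>, so that a conjugation is given by a single exponent.\<close>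
  define z where "z = ee (1 / of_nat K)"
  have den_pos: "den i > 0" for i using quotient_of_denom_pos'[of "q i"] by (simp add: den_def)
  have K: "K > 0" using M den_pos by (auto simp: K_def intro!: prod_pos)
  have den_K: "den i dvd K" if "i < n" for i
    unfolding K_def by (intro dvd_mult dvd_prodI) (use that in auto)
  have M_K: "M dvd K" by (simp add: K_def)
  have zK: "z ^ K = 1" using K by (simp add: z_def ee_of_nat_mult[symmetric] ee_eq_1_iff)
  define \<zeta> where "\<zeta> = ee (1 / of_nat M)"
  obtain N where N: "K = M * N" by (auto simp: K_def)
  have \<zeta>: "\<zeta> = z ^ N" using M K by (simp add: \<zeta>_def z_def ee_of_nat_mult[symmetric] N)
  have \<zeta>M: "\<zeta> ^ M = 1" using M by (simp add: \<zeta>_def ee_of_nat_mult[symmetric] ee_eq_1_iff)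
  have "\<exists>a. ee (q i) = z ^ a" if "i < n" for i
    using ee_eq_power[of K "q i"] denominator_dvd_mult_Ints[of "q i" K] den_K[OF that] K
    unfolding z_def den_def by metis
  then obtain a where a: "\<And>i. i < n \<Longrightarrow> ee (q i) = z ^ a i" by metis
  obtain D where D: "\<Delta> = ipoly D \<zeta>" using \<Delta>(2) by (auto simp: root_ring_def \<zeta>_def)
  \<comment> \<open>If a conjugate of \<open>\<Delta>\<close> vanished, conjugating with an inverse
    exponent modulo \<open>M\<close> would make \<open>\<Delta>\<close> vanish.\<close>
  have D_nz: "ipoly D (\<zeta> ^ m) \<noteq> 0" if m: "coprime m M" for m
  proof
    assume 0: "ipoly D (\<zeta> ^ m) = 0"
    obtain m' where m': "[m * m' = 1] (mod M)" using m cong_solve_coprime_nat by auto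
    have "coprime m' M" using m' by (metis cong_imp_coprime coprime_1_left coprime_mult_left_iff cong_sym)
    moreover have "(\<zeta> ^ m) ^ M = 1" using \<zeta>M by (metis power_mult power_one mult.commute)
    ultimately have "ipoly D ((\<zeta> ^ m) ^ m') = 0" using root_of_unity_conjugate[of "\<zeta> ^ m" M m' D] M 0 by blast
    moreover have "(\<zeta> ^ m) ^ m' = \<zeta>"
    proof -
      have "\<zeta> ^ (m * m') = \<zeta> ^ 1"
        unfolding \<zeta>_def ee_power_eq_iff
        using m' cong_dvd_modulus_nat[OF _ quotient_of_dvd[of M "1 / of_nat M"]] M by simp
      then show ?thesis by (simp add: power_mult)
    qed
    ultimately show False using \<Delta>(1) D by simp
  qed
  \<comment> \<open>Exponents congruent modulo \<open>M\<close> agree on \<open>root_ring M\<close>,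
    hence on the numerators and on \<open>\<Delta>\<close>, and after cancelling the nonzero power
    of \<open>\<Delta>\<close> also on the power sums.\<close>
  have key: "(\<Sum>i<n. (z ^ (a i * m)) ^ j) = (\<Sum>i<n. (z ^ (a i * m')) ^ j)"
    if m: "coprime m K" "coprime m' K" "[m = m'] (mod M)" for m m' j
  proof -
    obtain l where "\<Delta> ^ l * (\<Sum>i<n. ee (q i) ^ j) \<in> root_ring M" using sums by blast
    then obtain P where P: "\<Delta> ^ l * (\<Sum>i<n. ee (q i) ^ j) = ipoly P \<zeta>" by (auto simp: root_ring_def \<zeta>_def)
    define T where "T = (pcompose D (monom 1 N)) ^ l * (\<Sum>i<n. monom 1 (a i * j)) - pcompose P (monom 1 N)"
    have T: "ipoly T w = (ipoly D (w ^ N)) ^ l * (\<Sum>i<n. w ^ (a i * j)) - ipoly P (w ^ N)" for w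
      by (simp add: T_def ipoly_diff ipoly_mult ipoly_power of_int_hom.map_poly_pcompose poly_pcompose
          poly_monom of_int_poly_hom.hom_sum poly_sum)
    have "ipoly T z = 0" unfolding T using P a by (simp add: D \<zeta> power_mult)
    then have "ipoly T (z ^ m) = 0" if "coprime m K" for m using root_of_unity_conjugate[OF zK K that] by blast
    then have *: "(ipoly D (\<zeta> ^ m)) ^ l * (\<Sum>i<n. (z ^ (a i * m)) ^ j) = ipoly P (\<zeta> ^ m)" if "coprime m K" for m
    proof -
      have 1: "(z ^ m) ^ N = \<zeta> ^ m" unfolding \<zeta> by (simp add: power_mult[symmetric] mult.commute)
      have "(z ^ m) ^ (a i * j) = (z ^ (a i * m)) ^ j" for i by (simp add: power_mult[symmetric] mult_ac)
      then show ?thesis using \<open>\<And>m. coprime m K \<Longrightarrow> ipoly T (z ^ m) = 0\<close>[OF that] by (simp add: T 1)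
    qed
    have "\<zeta> ^ m = \<zeta> ^ m'" unfolding \<zeta>_def ee_power_eq_iff
      using cong_dvd_modulus_nat[OF m(3) quotient_of_dvd[of M "1 / of_nat M"]] M by simp
    then have "(ipoly D (\<zeta> ^ m)) ^ l * (\<Sum>i<n. (z ^ (a i * m)) ^ j) = (ipoly D (\<zeta> ^ m)) ^ l * (\<Sum>i<n. (z ^ (a i * m')) ^ j)"
      using *[OF m(1)] *[OF m(2)] by simp
    moreover have "coprime m M" using m(1) by (simp add: N)
    then have "(ipoly D (\<zeta> ^ m)) ^ l \<noteq> 0" using D_nz by simp
    ultimately show ?thesis by (metis mult_left_cancel)
  qed
  define R where "R = den i0"
  have R: "R > 0" "R dvd K" using den_pos den_K[OF i0] by (auto simp: R_def)
  have "\<exists>x. x < K \<and> coprime x K \<and> [x = c] (mod R)" if "c \<in> units_mod R" for c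
    using coprime_lift[OF R(2) K, of c] that by (auto simp: units_mod_def)
  then obtain L where L: "\<And>c. c \<in> units_mod R \<Longrightarrow> L c < K \<and> coprime (L c) K \<and> [L c = c] (mod R)" by metis
  define f where "f = (\<lambda>c. ee (q i0) ^ L c)"
  have inj: "inj_on f (units_mod R)"
  proof (rule inj_onI)
    fix c d assume cd: "c \<in> units_mod R" "d \<in> units_mod R" "f c = f d"
    then have "[L c = L d] (mod R)" by (simp add: f_def ee_power_eq_iff R_def den_def)
    then have "[c = d] (mod R)" using L[OF cd(1)] L[OF cd(2)] by (meson cong_sym cong_trans)
    then show "c = d" using cd by (simp add: Cong.cong_def units_mod_def)
  qed
  \<comment> \<open>One exponent for each residue \<open>e\<close> modulo \<open>M\<close> that
    occurs. All exponents with that residue send root \<open>i0\<close> into the same set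
    \<open>V e\<close> of at most \<open>n\<close> numbers, whence the bound
    \<open>M * n\<close>.\<close>
  define b where "b = (\<lambda>e. SOME c. c \<in> units_mod R \<and> L c mod M = e)"
  define V where "V = (\<lambda>e. (\<lambda>i. z ^ (a i * L (b e))) ` {..<n})"
  have "f ` units_mod R \<subseteq> (\<Union>e<M. V e)"
  proof
    fix y assume "y \<in> f ` units_mod R"
    then obtain c where c: "c \<in> units_mod R" "y = f c" by blast
    define e where "e = L c mod M"
    have be: "b e \<in> units_mod R" "L (b e) mod M = e"
      using someI[of "\<lambda>c. c \<in> units_mod R \<and> L c mod M = e" c] c by (auto simp: b_def e_def)
    have "z ^ (a i0 * L c) \<in> (\<lambda>i. z ^ (a i * L (b e))) ` {..<n}"
    proof (rule power_sums_eq_imp_mem[OF _ i0])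
      show "(\<Sum>i<n. (z ^ (a i * L (b e))) ^ j) = (\<Sum>i<n. (z ^ (a i * L c)) ^ j)" for j
        using L[OF c(1)] L[OF be(1)] be(2) by (intro key) (auto simp: Cong.cong_def e_def)
    qed
    moreover have "y = z ^ (a i0 * L c)" using a[OF i0] by (simp add: c f_def power_mult)
    moreover have "e < M" using M by (simp add: e_def)
    ultimately show "y \<in> (\<Union>e<M. V e)" by (auto simp: V_def)
  qed
  then have "card (f ` units_mod R) \<le> card (\<Union>e<M. V e)" by (intro card_mono) (auto simp: V_def)
  also have "\<dots> \<le> (\<Sum>e<M. card (V e))" by (rule card_UN_le) simp
  also have "\<dots> \<le> (\<Sum>e<M. n)" unfolding V_def by (intro sum_mono) (metis card_image_le card_lessThan finite_lessThan)
  finally have "card (f ` units_mod R) \<le> M * n" by simp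
  then show ?thesis using card_image[OF inj] card_units_mod[OF R(1)] by (simp add: R_def den_def)
qed

section \<open>Finiteness of characters whose eigenvalues are roots of unity\<close>

context spectral_system
begin

text \<open>Take \<open>d\<close> with a nonsingular Gram matrix of size \<open>d\<close> but none
  of size \<open>d + 1\<close>. Bordering it by \<open>x\<close> and \<open>y\<close> gives a
  singular matrix, and a kernel vector expresses \<open>chi (x \<otimes> y)\<close>. The adjugate
  instead of the inverse keeps all denominators in the one factor \<open>det\<close>.\<close>

lemma rank_formula:
  obtains d g h where "\<And>i. g i \<in> carrier G" "\<And>i. h i \<in> carrier G"
    "det (mat d d (\<lambda>(i, j). chi (g i \<otimes> h j))) \<noteq> 0"
    "\<And>x y. x \<in> carrier G \<Longrightarrow> y \<in> carrier G \<Longrightarrow> det (mat d d (\<lambda>(i, j). chi (g i \<otimes> h j))) * chi (x \<otimes> y) =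
      (\<Sum>j<d. chi (x \<otimes> h j) * (\<Sum>i<d. adj_mat (mat d d (\<lambda>(i, j). chi (g i \<otimes> h j))) $$ (j, i) * chi (g i \<otimes> y)))"
proof -
  define P where "P = (\<lambda>d. \<exists>g h. (\<forall>i. g i \<in> carrier G) \<and> (\<forall>i. h i \<in> carrier G) \<and>
    det (mat d d (\<lambda>(i, j). chi (g i \<otimes> h j))) \<noteq> 0)"
  have "P 0" unfolding P_def by (intro exI[of _ "\<lambda>_. \<one>"]) (simp add: det_def)
  moreover have "\<not> P (Suc (n * n))" unfolding P_def chi_def using gram_det by blast
  ultimately obtain d where d: "P d" "\<not> P (Suc d)"
    by (metis nat_induct)
  then obtain g h where gh: "\<And>i. g i \<in> carrier G" "\<And>i. h i \<in> carrier G"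
    "det (mat d d (\<lambda>(i, j). chi (g i \<otimes> h j))) \<noteq> 0" by (auto simp: P_def)
  define A where "A = mat d d (\<lambda>(i, j). chi (g i \<otimes> h j))"
  have A: "A \<in> carrier_mat d d" by (simp add: A_def)
  have "det A * chi (x \<otimes> y) = (\<Sum>j<d. chi (x \<otimes> h j) * (\<Sum>i<d. adj_mat A $$ (j, i) * chi (g i \<otimes> y)))"
    if xy: "x \<in> carrier G" "y \<in> carrier G" for x y
  proof -
    define B where "B = mat (Suc d) (Suc d) (\<lambda>(i, j). chi ((g(d := x)) i \<otimes> (h(d := y)) j))"
    have "det B = 0"
    proof (rule ccontr)
      assume "det B \<noteq> 0"
      then have "P (Suc d)" unfolding P_def B_def using gh(1,2) xy
        by (intro exI[of _ "g(d := x)"] exI[of _ "h(d := y)"]) auto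
      then show False using d by simp
    qed
    moreover have B: "B \<in> carrier_mat (Suc d) (Suc d)" by (simp add: B_def)
    ultimately obtain v where v: "v \<in> carrier_vec (Suc d)" "v \<noteq> 0\<^sub>v (Suc d)" "B *\<^sub>v v = 0\<^sub>v (Suc d)"
      using det_0_iff_vec_prod_zero by blast
    have row: "(\<Sum>j<d. chi ((g(d := x)) i \<otimes> h j) * v $ j) + chi ((g(d := x)) i \<otimes> y) * v $ d = 0" if i: "i < Suc d" for i
    proof -
      have "(B *\<^sub>v v) $ i = 0" using v(3) i by simp
      moreover have "(B *\<^sub>v v) $ i = (\<Sum>j<Suc d. B $$ (i, j) * v $ j)"
        using i v(1) B by (simp add: scalar_prod_def atLeast0LessThan)
      ultimately show ?thesis using i by (simp add: B_def)
    qed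
    have adj: "(\<Sum>i<d. adj_mat A $$ (j, i) * A $$ (i, k)) = (if j = k then det A else 0)" if "j < d" "k < d" for j k
    proof -
      have "(adj_mat A * A) $$ (j, k) = (\<Sum>i<d. adj_mat A $$ (j, i) * A $$ (i, k))"
        using that adj_mat(1)[OF A] A by (simp add: scalar_prod_def atLeast0LessThan)
      moreover have "(adj_mat A * A) $$ (j, k) = (if j = k then det A else 0)"
        unfolding adj_mat(3)[OF A] using that by simp
      ultimately show ?thesis by simp
    qed
    have sol: "det A * v $ j = - (\<Sum>i<d. adj_mat A $$ (j, i) * chi (g i \<otimes> y)) * v $ d" if j: "j < d" for j
    proof -
      have "det A * v $ j = (\<Sum>k<d. (if j = k then det A else 0) * v $ k)"
        using j by (simp add: if_distrib[of "\<lambda>x. x * _"] cong: if_cong)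
      also have "\<dots> = (\<Sum>k<d. (\<Sum>i<d. adj_mat A $$ (j, i) * A $$ (i, k)) * v $ k)"
        using j by (intro sum.cong) (auto simp: adj)
      also have "\<dots> = (\<Sum>i<d. adj_mat A $$ (j, i) * (\<Sum>k<d. A $$ (i, k) * v $ k))"
        by (simp add: sum_distrib_left sum_distrib_right mult.assoc) (rule sum.swap)
      also have "\<dots> = (\<Sum>i<d. adj_mat A $$ (j, i) * (- (chi (g i \<otimes> y) * v $ d)))"
      proof (intro sum.cong refl arg_cong2[where f = "(*)"])
        fix i assume "i \<in> {..<d}"
        then show "(\<Sum>k<d. A $$ (i, k) * v $ k) = - (chi (g i \<otimes> y) * v $ d)"
          using row[of i] by (simp add: A_def eq_neg_iff_add_eq_0)
      qed
      finally show ?thesis by (simp add: sum_distrib_right sum_negf mult.assoc)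
    qed
    \<comment> \<open>Otherwise \<open>v\<close> would be in the kernel of the nonsingular block
      \<open>A\<close>.\<close>
    have "v $ d \<noteq> 0"
    proof
      assume vd: "v $ d = 0"
      have "v $ j = 0" if "j < d" for j using sol[OF that] gh(3) vd by (simp add: A_def)
      then have "v = 0\<^sub>v (Suc d)" using v(1) vd by (intro eq_vecI) (auto simp: less_Suc_eq)
      then show False using v(2) by simp
    qed
    have "det A * chi (x \<otimes> y) * v $ d = - (\<Sum>j<d. chi (x \<otimes> h j) * (det A * v $ j))"
    proof -
      have "(\<Sum>j<d. chi (x \<otimes> h j) * v $ j) + chi (x \<otimes> y) * v $ d = 0" using row[of d] by simp
      then have "chi (x \<otimes> y) * v $ d = - (\<Sum>j<d. chi (x \<otimes> h j) * v $ j)"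
        by (simp add: eq_neg_iff_add_eq_0 add.commute)
      then have "det A * (chi (x \<otimes> y) * v $ d) = det A * - (\<Sum>j<d. chi (x \<otimes> h j) * v $ j)" by simp
      then show ?thesis by (simp add: sum_distrib_left mult_ac)
    qed
    also have "\<dots> = (\<Sum>j<d. chi (x \<otimes> h j) * (\<Sum>i<d. adj_mat A $$ (j, i) * chi (g i \<otimes> y))) * v $ d"
      by (simp add: sol sum_negf sum_distrib_right mult.assoc)
    finally show ?thesis using \<open>v $ d \<noteq> 0\<close> by simp
  qed
  then show ?thesis using that gh unfolding A_def by blast
qed

text \<open>By the rank formula a translate is determined by the \<open>d\<close> values
  \<open>chi (g i \<otimes> \<gamma>)\<close>.\<close>

lemma finitely_many_translates:
  assumes "finite (chi ` carrier G)"
  shows "finite ((\<lambda>\<gamma>. \<lambda>x\<in>carrier G. chi (x \<otimes> \<gamma>)) ` carrier G)"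
proof -
  obtain d g h where gh: "\<And>i. g i \<in> carrier G" "\<And>i. h i \<in> carrier G"
    and nz: "det (mat d d (\<lambda>(i, j). chi (g i \<otimes> h j))) \<noteq> 0"
    and formula: "\<And>x y. x \<in> carrier G \<Longrightarrow> y \<in> carrier G \<Longrightarrow> det (mat d d (\<lambda>(i, j). chi (g i \<otimes> h j))) * chi (x \<otimes> y) =
      (\<Sum>j<d. chi (x \<otimes> h j) * (\<Sum>i<d. adj_mat (mat d d (\<lambda>(i, j). chi (g i \<otimes> h j))) $$ (j, i) * chi (g i \<otimes> y)))"
    by (rule rank_formula) blast
  define A where "A = mat d d (\<lambda>(i, j). chi (g i \<otimes> h j))"
  define \<Psi> where "\<Psi> = (\<lambda>f. \<lambda>x\<in>carrier G. (\<Sum>j<d. chi (x \<otimes> h j) * (\<Sum>i<d. adj_mat A $$ (j, i) * f i)) / det A)"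
  have "(\<lambda>\<gamma>. \<lambda>x\<in>carrier G. chi (x \<otimes> \<gamma>)) ` carrier G \<subseteq> \<Psi> ` (PiE {..<d} (\<lambda>_. chi ` carrier G))"
  proof clarify
    fix \<gamma> assume \<gamma>: "\<gamma> \<in> carrier G"
    have "(\<lambda>x\<in>carrier G. chi (x \<otimes> \<gamma>)) = \<Psi> (\<lambda>i\<in>{..<d}. chi (g i \<otimes> \<gamma>))"
    proof (rule ext)
      fix x
      show "(\<lambda>x\<in>carrier G. chi (x \<otimes> \<gamma>)) x = \<Psi> (\<lambda>i\<in>{..<d}. chi (g i \<otimes> \<gamma>)) x"
        using formula[of x \<gamma>] \<gamma> nz by (simp add: \<Psi>_def A_def field_simps)
    qed
    moreover have "(\<lambda>i\<in>{..<d}. chi (g i \<otimes> \<gamma>)) \<in> PiE {..<d} (\<lambda>_. chi ` carrier G)"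
      using gh \<gamma> by auto
    ultimately show "(\<lambda>x\<in>carrier G. chi (x \<otimes> \<gamma>)) \<in> \<Psi> ` (PiE {..<d} (\<lambda>_. chi ` carrier G))" by blast
  qed
  moreover have "finite (PiE {..<d} (\<lambda>_. chi ` carrier G))" using assms by (intro finite_PiE) auto
  ultimately show ?thesis by (meson finite_imageI finite_subset)
qed

text \<open>The rank formula breaks words into generators, so up to powers of one
  \<open>\<Delta>\<close> all values of \<open>chi\<close> lie in one \<open>root_ring M\<close>. So
  do the power sums of the eigenvalues of each element; the orbit bound then limits the orders
  uniformly.\<close>

lemma finite_chi_of_torsion:
  assumes S: "finite S" "S \<subseteq> carrier G" "generate G S = carrier G"
    and q: "\<And>\<gamma> i. \<gamma> \<in> carrier G \<Longrightarrow> i < n \<Longrightarrow> \<mu> \<gamma> i = ee (q \<gamma> i)"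
  shows "finite (chi ` carrier G)"
proof -
  obtain d g h where gh: "\<And>i. g i \<in> carrier G" "\<And>i. h i \<in> carrier G"
    and nz: "det (mat d d (\<lambda>(i, j). chi (g i \<otimes> h j))) \<noteq> 0"
    and formula: "\<And>x y. x \<in> carrier G \<Longrightarrow> y \<in> carrier G \<Longrightarrow> det (mat d d (\<lambda>(i, j). chi (g i \<otimes> h j))) * chi (x \<otimes> y) =
      (\<Sum>j<d. chi (x \<otimes> h j) * (\<Sum>i<d. adj_mat (mat d d (\<lambda>(i, j). chi (g i \<otimes> h j))) $$ (j, i) * chi (g i \<otimes> y)))"
    by (rule rank_formula) blast
  define A where "A = mat d d (\<lambda>(i, j). chi (g i \<otimes> h j))"
  define \<Delta> where "\<Delta> = det A"
  \<comment> \<open>The arguments that remain when a word is broken up completely: at most one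
    letter between some \<open>g i\<close> and some \<open>h j\<close>.\<close>
  define \<Gamma> where "\<Gamma> = g ` {..<d} \<union> h ` {..<d} \<union> (\<lambda>(i, j). g i \<otimes> h j) ` ({..<d} \<times> {..<d})
    \<union> (\<lambda>(s, i, j). g i \<otimes> s \<otimes> h j) ` ((S \<union> m_inv G ` S) \<times> {..<d} \<times> {..<d})"
  have \<Gamma>: "finite \<Gamma>" "\<Gamma> \<subseteq> carrier G" using S gh by (auto simp: \<Gamma>_def)
  have \<Gamma>_word: "g i \<otimes> s \<otimes> h j \<in> \<Gamma>" if "s \<in> S \<union> m_inv G ` S" "i < d" "j < d" for s i j
  proof -
    have "(s, i, j) \<in> (S \<union> m_inv G ` S) \<times> {..<d} \<times> {..<d}" using that by auto
    then show ?thesis unfolding \<Gamma>_def by (metis (mono_tags, lifting) UnI2 case_prod_conv image_eqI)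
  qed
  define M where "M = (\<Prod>(\<gamma>, i)\<in>\<Gamma> \<times> {..<n}. nat (snd (quotient_of (q \<gamma> i))))"
  have M: "M > 0" unfolding M_def using quotient_of_denom_pos' by (intro prod_pos) auto
  have \<Gamma>_ring: "chi \<gamma> \<in> root_ring M" if "\<gamma> \<in> \<Gamma>" for \<gamma>
    unfolding chi_def
  proof (rule root_ring_sum)
    fix i assume "i \<in> {..<n}"
    then have "nat (snd (quotient_of (q \<gamma> i))) dvd M"
      unfolding M_def using dvd_prodI[of "\<Gamma> \<times> {..<n}" "(\<gamma>, i)" "\<lambda>(\<gamma>, i). nat (snd (quotient_of (q \<gamma> i)))"] that \<Gamma>(1) by simp
    then have "ee (q \<gamma> i) \<in> root_ring M" using M by (intro ee_in_root_ring denominator_dvd_mult_Ints)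
    moreover have "\<mu> \<gamma> i = ee (q \<gamma> i)" using q \<open>i \<in> {..<n}\<close> that \<Gamma>(2) by auto
    ultimately show "\<mu> \<gamma> i \<in> root_ring M" by simp
  qed
  have A: "A \<in> carrier_mat d d" "\<And>i j. i < d \<Longrightarrow> j < d \<Longrightarrow> A $$ (i, j) \<in> root_ring M"
    by (auto simp: A_def \<Gamma>_def intro!: \<Gamma>_ring)
  have adj_ring: "adj_mat A $$ (j, i) \<in> root_ring M" if "i < d" "j < d" for i j
    using root_ring_adj_mat[OF A that(2,1)] .
  have \<Delta>_ring: "\<Delta> \<in> root_ring M" unfolding \<Delta>_def using A by (rule root_ring_det)
  have formula': "\<Delta> ^ (k + l + 1) * chi (x \<otimes> y) =
      (\<Sum>j<d. (\<Delta> ^ k * chi (x \<otimes> h j)) * (\<Sum>i<d. adj_mat A $$ (j, i) * (\<Delta> ^ l * chi (g i \<otimes> y))))"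
    if "x \<in> carrier G" "y \<in> carrier G" for x y k l
  proof -
    have "\<Delta> ^ (k + l + 1) * chi (x \<otimes> y) = \<Delta> ^ k * \<Delta> ^ l * (\<Delta> * chi (x \<otimes> y))" by (simp add: power_add mult_ac)
    also have "\<dots> = \<Delta> ^ k * \<Delta> ^ l * (\<Sum>j<d. chi (x \<otimes> h j) * (\<Sum>i<d. adj_mat A $$ (j, i) * chi (g i \<otimes> y)))"
      unfolding \<Delta>_def A_def formula[OF that] ..
    finally show ?thesis by (simp add: sum_distrib_left mult_ac)
  qed
  have formula_ring: "\<Delta> ^ (k + l + 1) * chi (x \<otimes> y) \<in> root_ring M"
    if "x \<in> carrier G" "y \<in> carrier G" "\<And>j. j < d \<Longrightarrow> \<Delta> ^ k * chi (x \<otimes> h j) \<in> root_ring M"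
      "\<And>i. i < d \<Longrightarrow> \<Delta> ^ l * chi (g i \<otimes> y) \<in> root_ring M" for x y k l
    unfolding formula'[OF that(1,2)]
    by (rule root_ring_sum, rule root_ring_mult, use that(3) in simp, rule root_ring_sum,
        rule root_ring_mult, use adj_ring in simp, use that(4) in simp)
  \<comment> \<open>The values of \<open>chi\<close> between the \<open>g i\<close> and the
    \<open>h j\<close> multiply like matrix entries, and each product costs one more power of
    \<open>\<Delta>\<close>.\<close>
  have word: "\<exists>l. \<forall>i<d. \<forall>j<d. \<Delta> ^ l * chi (g i \<otimes> \<gamma> \<otimes> h j) \<in> root_ring M" if "\<gamma> \<in> generate G S" for \<gamma>
    using that
  proof induction
    case one
    have "\<forall>i<d. \<forall>j<d. \<Delta> ^ 0 * chi (g i \<otimes> \<one> \<otimes> h j) \<in> root_ring M"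
      using gh by (auto intro!: \<Gamma>_ring simp: \<Gamma>_def)
    then show ?case by blast
  next
    case (incl s)
    have "\<forall>i<d. \<forall>j<d. \<Delta> ^ 0 * chi (g i \<otimes> s \<otimes> h j) \<in> root_ring M"
      using incl by (auto intro!: \<Gamma>_ring \<Gamma>_word)
    then show ?case by blast
  next
    case (inv s)
    have "\<forall>i<d. \<forall>j<d. \<Delta> ^ 0 * chi (g i \<otimes> inv s \<otimes> h j) \<in> root_ring M"
      using inv by (auto intro!: \<Gamma>_ring \<Gamma>_word)
    then show ?case by blast
  next
    case (eng a b)
    then obtain k l where kl: "\<And>i j. i < d \<Longrightarrow> j < d \<Longrightarrow> \<Delta> ^ k * chi (g i \<otimes> a \<otimes> h j) \<in> root_ring M"
      "\<And>i j. i < d \<Longrightarrow> j < d \<Longrightarrow> \<Delta> ^ l * chi (g i \<otimes> b \<otimes> h j) \<in> root_ring M" by blast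
    have ab: "a \<in> carrier G" "b \<in> carrier G" using eng S(3) by auto
    have "\<Delta> ^ (k + l + 1) * chi (g i \<otimes> (a \<otimes> b) \<otimes> h j) \<in> root_ring M" if "i < d" "j < d" for i j
    proof -
      have "g i \<otimes> (a \<otimes> b) \<otimes> h j = (g i \<otimes> a) \<otimes> (b \<otimes> h j)" using ab gh by (simp add: m_assoc)
      moreover have "g p \<otimes> (b \<otimes> h j) = g p \<otimes> b \<otimes> h j" for p using ab gh by (simp add: m_assoc)
      ultimately show ?thesis using formula_ring[of "g i \<otimes> a" "b \<otimes> h j" k l] ab gh kl that by simp
    qed
    then show ?case by blast
  qed
  have all: "\<exists>l. \<Delta> ^ l * chi \<gamma> \<in> root_ring M" if \<gamma>: "\<gamma> \<in> carrier G" for \<gamma>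
  proof -
    have "\<gamma> \<in> generate G S" using \<gamma> S(3) by simp
    from word[OF this] obtain l where "\<forall>i<d. \<forall>j<d. \<Delta> ^ l * chi (g i \<otimes> \<gamma> \<otimes> h j) \<in> root_ring M" ..
    then have l: "\<Delta> ^ l * chi (g i \<otimes> \<gamma> \<otimes> h j) \<in> root_ring M" if "i < d" "j < d" for i j
      using that by simp
    have gh_ring: "chi (g i) \<in> root_ring M" "chi (h i) \<in> root_ring M" if "i < d" for i
      using that by (auto intro!: \<Gamma>_ring simp: \<Gamma>_def)
    \<comment> \<open>Using the formula with \<open>\<one>\<close> on the right and then on the left
      strips off the factors \<open>h j\<close> and \<open>g i\<close>.\<close>
    have 1: "\<Delta> ^ (l + 0 + 1) * chi (g i \<otimes> \<gamma>) \<in> root_ring M" if "i < d" for i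
    proof -
      have "\<Delta> ^ (l + 0 + 1) * chi ((g i \<otimes> \<gamma>) \<otimes> \<one>) \<in> root_ring M"
        by (rule formula_ring) (use gh \<gamma> that l gh_ring in auto)
      then show ?thesis using gh \<gamma> by simp
    qed
    have "\<Delta> ^ (0 + (l + 0 + 1) + 1) * chi (\<one> \<otimes> \<gamma>) \<in> root_ring M"
      by (rule formula_ring) (use gh \<gamma> 1 gh_ring in auto)
    then show ?thesis using \<gamma> by (metis l_one)
  qed
  \<comment> \<open>From \<open>2 * R ^ 3 \<le> 27 * totient R ^ 4\<close>,
    \<open>totient R \<le> M * n\<close> and \<open>R \<le> R ^ 3\<close>.\<close>
  define C where "C = 27 * (M * n) ^ 4"
  have order: "nat (snd (quotient_of (q \<gamma> i))) \<le> C" if \<gamma>: "\<gamma> \<in> carrier G" and i: "i < n" for \<gamma> i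
  proof -
    define R where "R = nat (snd (quotient_of (q \<gamma> i)))"
    have R: "R > 0" using quotient_of_denom_pos'[of "q \<gamma> i"] by (simp add: R_def)
    have "totient R \<le> M * n" unfolding R_def
    proof (rule conjugate_orbit_bound[OF M _ \<Delta>_ring _ i])
      show "\<Delta> \<noteq> 0" using nz by (simp add: \<Delta>_def A_def)
      show "\<exists>l. \<Delta> ^ l * (\<Sum>i<n. ee (q \<gamma> i) ^ j) \<in> root_ring M" for j
        using all[of "\<gamma> [^] j"] \<gamma> by (simp add: chi_pow q)
    qed
    then have "totient R ^ 4 \<le> (M * n) ^ 4" by (rule power_mono) simp
    then have "27 * totient R ^ 4 \<le> C" by (simp add: C_def)
    moreover have "real (2 * R ^ 3) \<le> real (27 * totient R ^ 4)"
      using totient_lower_bound[OF R] by simp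
    then have "2 * R ^ 3 \<le> 27 * totient R ^ 4" by (simp only: of_nat_le_iff)
    moreover have "R ^ 1 \<le> R ^ 3" using R by (intro power_increasing) auto
    ultimately have "R \<le> C" by simp
    then show ?thesis by (simp only: R_def)
  qed
  define U where "U = (\<Union>b\<in>{1..C}. {z::complex. z ^ b = 1})"
  have "finite U" unfolding U_def
    by (intro finite_UN_I) (auto intro!: finite_roots_unity)
  moreover have "chi ` carrier G \<subseteq> (\<lambda>f. \<Sum>i<n. f i) ` (PiE {..<n} (\<lambda>_. U))"
  proof clarify
    fix \<gamma> assume \<gamma>: "\<gamma> \<in> carrier G"
    have "\<mu> \<gamma> i \<in> U" if "i < n" for i
    proof -
      have "\<mu> \<gamma> i ^ nat (snd (quotient_of (q \<gamma> i))) = 1"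
        using q[OF \<gamma> that] denominator_mult_Ints[of "q \<gamma> i"] by (simp add: ee_of_nat_mult[symmetric] ee_eq_1_iff)
      moreover have "nat (snd (quotient_of (q \<gamma> i))) \<in> {1..C}"
        using order[OF \<gamma> that] quotient_of_denom_pos'[of "q \<gamma> i"] by simp
      ultimately show ?thesis by (auto simp: U_def)
    qed
    then have in_PiE: "restrict (\<mu> \<gamma>) {..<n} \<in> PiE {..<n} (\<lambda>_. U)" by auto
    show "chi \<gamma> \<in> (\<lambda>f. \<Sum>i<n. f i) ` (PiE {..<n} (\<lambda>_. U))"
    proof (rule image_eqI[where x = "restrict (\<mu> \<gamma>) {..<n}"])
      show "chi \<gamma> = (\<Sum>i<n. restrict (\<mu> \<gamma>) {..<n} i)"
        unfolding chi_def by (rule sum.cong) simp_all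
    qed (rule in_PiE)
  qed
  moreover have "finite (PiE {..<n} (\<lambda>_. U))" using \<open>finite U\<close> by (intro finite_PiE) simp_all
  ultimately show ?thesis using finite_subset[OF _ finite_imageI] by blast
qed

end

section \<open>Limits of conjugated eigenvalues\<close>

lemma coeff_linear_mult:
  "coeff (p * [:- w, 1:]) j = (if j = 0 then 0 else coeff p (j - 1)) - w * coeff p j" for w :: complex
proof -
  have "p * [:- w, 1:] = pCons 0 p - smult w p" by (simp add: algebra_simps)
  then show ?thesis by (cases j) auto
qed

lemma degree_prod_linear_le: "degree (\<Prod>i<n. [:- w i, 1:]) \<le> n" for w :: "nat \<Rightarrow> complex"
proof -
  have "degree (\<Prod>i<n. [:- w i, 1:]) \<le> (\<Sum>i<n. degree [:- w i, 1:])" 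
    using degree_prod_sum_le[of "{..<n}" "\<lambda>i. [:- w i, 1:]"] by (simp add: o_def)
  then show ?thesis by simp
qed

text \<open>The polynomials \<open>c j\<close> do not depend on \<open>z\<close>, so they evaluate
  the coefficients at \<open>z\<close> and at its conjugate \<open>z ^ m\<close> alike.\<close>

lemma coeff_prod_linear_ipoly:
  "\<exists>c. \<forall>z j. coeff (\<Prod>i<n. [:- (z ^ e i), 1:]) j = ipoly (c j) z" for e :: "nat \<Rightarrow> nat"
proof (induction n)
  case 0
  have "\<forall>z j. coeff (\<Prod>i<(0::nat). [:- (z ^ e i), 1:]) j = ipoly (if j = 0 then 1 else 0) z"
    by auto
  then show ?case by (rule exI[where x = "\<lambda>j. if j = 0 then 1 else 0"])
next
  case (Suc n)
  then obtain c where c: "\<And>z j. coeff (\<Prod>i<n. [:- (z ^ e i), 1:]) j = ipoly (c j) z" by blast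
  define c' where "c' = (\<lambda>j. (if j = 0 then 0 else c (j - 1)) - monom 1 (e n) * c j)"
  have "coeff (\<Prod>i<Suc n. [:- (z ^ e i), 1:]) j = ipoly (c' j) z" for z j
    unfolding prod.lessThan_Suc coeff_linear_mult c by (simp add: c'_def ipoly_diff ipoly_mult poly_monom)
  then show ?case by blast
qed

lemma ipoly_sum: "ipoly (sum f A) z = (\<Sum>i\<in>A. ipoly (f i) z)"
  by (induction A rule: infinite_finite_induct) (auto simp: ipoly_add)

lemma conjugate_power_sum:
  fixes z :: complex and n :: nat
  assumes z: "z ^ N = 1" "N > 0" "coprime m N" and eq: "(\<Sum>i<n. z ^ b i) = (\<Sum>i<n. (z ^ a i) ^ j)"
  shows "(\<Sum>i<n. (z ^ m) ^ b i) = (\<Sum>i<n. ((z ^ m) ^ a i) ^ j)"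
proof -
  define T where "T = (\<Sum>i<n. monom (1::int) (b i)) - (\<Sum>i<n. monom 1 (a i * j))"
  have T: "ipoly T w = (\<Sum>i<n. w ^ b i) - (\<Sum>i<n. (w ^ a i) ^ j)" for w
    by (simp add: T_def ipoly_diff ipoly_sum poly_monom power_mult)
  show ?thesis using root_of_unity_conjugate[OF z, of T] eq by (simp add: T)
qed

lemma conjugate_cayley_hamilton:
  fixes z :: complex and n :: nat
  assumes z: "z ^ N = 1" "N > 0" "coprime m N"
    and eq: "poly_act (\<Prod>i<n. [:- (z ^ e i), 1:]) (\<lambda>k. \<Sum>l<n. z ^ f k l) 0 = 0"
  shows "poly_act (\<Prod>i<n. [:- ((z ^ m) ^ e i), 1:]) (\<lambda>k. \<Sum>l<n. (z ^ m) ^ f k l) 0 = 0"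
proof -
  obtain c where c: "\<And>z j. coeff (\<Prod>i<n. [:- (z ^ e i), 1:]) j = ipoly (c j) z"
    using coeff_prod_linear_ipoly[where n = n and e = e] by blast
  define T where "T = (\<Sum>j\<le>n. c j * (\<Sum>l<n. monom 1 (f j l)))"
  have T: "ipoly T w = poly_act (\<Prod>i<n. [:- (w ^ e i), 1:]) (\<lambda>k. \<Sum>l<n. w ^ f k l) 0" for w
    unfolding poly_act_bound[OF degree_prod_linear_le] c
    by (simp add: T_def ipoly_sum ipoly_mult poly_monom)
  show ?thesis using root_of_unity_conjugate[OF z, of T] eq by (simp add: T)
qed

lemma conjugate_gram_det:
  fixes z :: complex and n :: nat
  assumes z: "z ^ N = 1" "N > 0" "coprime m N"
    and eq: "det (mat d d (\<lambda>(i, j). \<Sum>l<n. z ^ e i j l)) = 0"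
  shows "det (mat d d (\<lambda>(i, j). \<Sum>l<n. (z ^ m) ^ e i j l)) = 0"
proof -
  define T where "T = det (mat d d (\<lambda>(i, j). \<Sum>l<n. monom (1::int) (e i j l)))"
  have T: "ipoly T w = det (mat d d (\<lambda>(i, j). \<Sum>l<n. w ^ e i j l))" for w
  proof -
    interpret ev: comm_ring_hom "\<lambda>p. ipoly p w" by (rule comm_ring_hom_ipoly)
    have "map_mat (\<lambda>p. ipoly p w) (mat d d (\<lambda>(i, j). \<Sum>l<n. monom (1::int) (e i j l)))
        = mat d d (\<lambda>(i, j). \<Sum>l<n. w ^ e i j l)"
      by (intro eq_matI) (auto simp: ipoly_sum poly_monom)
    then show ?thesis unfolding T_def by (metis ev.hom_det)
  qed
  show ?thesis using root_of_unity_conjugate[OF z, of T] eq by (simp add: T)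
qed

section \<open>Passage to the limit in the identities\<close>

lemma tendsto_coeff_prod_linear:
  fixes f :: "'b \<Rightarrow> nat \<Rightarrow> complex"
  assumes "\<And>i. i < n \<Longrightarrow> ((\<lambda>k. f k i) \<longlongrightarrow> w i) F"
  shows "((\<lambda>k. coeff (\<Prod>i<n. [:- f k i, 1:]) j) \<longlongrightarrow> coeff (\<Prod>i<n. [:- w i, 1:]) j) F"
  using assms
proof (induction n arbitrary: j)
  case (Suc n)
  have IH: "((\<lambda>k. coeff (\<Prod>i<n. [:- f k i, 1:]) j) \<longlongrightarrow> coeff (\<Prod>i<n. [:- w i, 1:]) j) F" for j
    using Suc by simp
  have "((\<lambda>k. f k n) \<longlongrightarrow> w n) F" using Suc.prems by simp
  then have "((\<lambda>k. f k n * coeff (\<Prod>i<n. [:- f k i, 1:]) j) \<longlongrightarrow> w n * coeff (\<Prod>i<n. [:- w i, 1:]) j) F"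
    using IH by (rule tendsto_mult)
  then show ?case unfolding prod.lessThan_Suc coeff_linear_mult
    by (cases "j = 0") (auto intro!: tendsto_diff IH tendsto_minus)
qed simp

lemma tendsto_det:
  fixes f :: "'b \<Rightarrow> nat \<Rightarrow> nat \<Rightarrow> complex"
  assumes "\<And>i j. ((\<lambda>k. f k i j) \<longlongrightarrow> w i j) F"
  shows "((\<lambda>k. det (mat d d (\<lambda>(i, j). f k i j))) \<longlongrightarrow> det (mat d d (\<lambda>(i, j). w i j))) F"
proof -
  have det: "det (mat d d (\<lambda>(i, j). g i j)) = (\<Sum>p\<in>{p. p permutes {0..<d}}. signof p * (\<Prod>i = 0..<d. g i (p i)))"
    for g :: "nat \<Rightarrow> nat \<Rightarrow> complex"
  proof -
    have "det (mat d d (\<lambda>(i, j). g i j)) = (\<Sum>p\<in>{p. p permutes {0..<d}}. signof p * (\<Prod>i = 0..<d. mat d d (\<lambda>(i, j). g i j) $$ (i, p i)))"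
      by (rule det_def') simp
    also have "\<dots> = (\<Sum>p\<in>{p. p permutes {0..<d}}. signof p * (\<Prod>i = 0..<d. g i (p i)))"
    proof (intro sum.cong refl arg_cong2[where f = "(*)"] prod.cong)
      fix p i assume "p \<in> {p. p permutes {0..<d}}" "i \<in> {0..<d}"
      then show "mat d d (\<lambda>(i, j). g i j) $$ (i, p i) = g i (p i)"
        using permutes_in_image[of p "{0..<d}" i] by auto
    qed
    finally show ?thesis .
  qed
  show ?thesis unfolding det by (intro tendsto_sum tendsto_mult tendsto_const tendsto_prod assms)
qed

lemma (in group) mat_hom_pow:
  assumes carrier: "\<And>x. x \<in> carrier G \<Longrightarrow> \<rho> x \<in> carrier_mat n n"
    and mult: "\<And>x y. x \<in> carrier G \<Longrightarrow> y \<in> carrier G \<Longrightarrow> \<rho> (x \<otimes> y) = \<rho> x * \<rho> y"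
    and one: "\<rho> \<one> = 1\<^sub>m n" and x: "x \<in> carrier G"
  shows "\<rho> (x [^] (j::nat)) = \<rho> x ^\<^sub>m j"
proof (induction j)
  case 0
  then show ?case using one carrier[OF x] by simp
next
  case (Suc j)
  then show ?case using x by (simp add: mult)
qed

text \<open>An identity involves finitely many group elements, which lie in \<open>B k\<close> for
  almost all \<open>k\<close>. There it holds for the eigenvalues themselves; being an integer
  polynomial identity in one root of unity it passes to the conjugates, and by continuity to the
  limits.\<close>

lemma (in seq_ultrafilter) limit_spectral_system:
  fixes G (structure) and \<rho> :: "nat \<Rightarrow> 'a \<Rightarrow> complex mat" and \<theta> :: "nat \<Rightarrow> 'a \<Rightarrow> nat \<Rightarrow> rat"
  assumes G: "group G" and n: "n > 0"
    and B: "\<And>\<gamma>. \<gamma> \<in> carrier G \<Longrightarrow> eventually (\<lambda>k. \<gamma> \<in> B k) \<omega>" "\<And>k. B k \<subseteq> carrier G"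
    and carrier: "\<And>k x. x \<in> carrier G \<Longrightarrow> \<rho> k x \<in> carrier_mat n n"
    and mult: "\<And>k x y. x \<in> carrier G \<Longrightarrow> y \<in> carrier G \<Longrightarrow> \<rho> k (x \<otimes> y) = \<rho> k x * \<rho> k y"
    and one: "\<And>k. \<rho> k \<one> = 1\<^sub>m n"
    and trace: "\<And>k \<gamma> j. \<gamma> \<in> B k \<Longrightarrow> mtrace (\<rho> k \<gamma> ^\<^sub>m j) = (\<Sum>i<n. ee (\<theta> k \<gamma> i) ^ j)"
    and char: "\<And>k \<gamma>. \<gamma> \<in> B k \<Longrightarrow> char_prod (\<rho> k \<gamma>) (\<lambda>i. ee (\<theta> k \<gamma> i)) n = 0\<^sub>m n n"
    and N: "\<And>k. N k > 0" "\<And>k \<gamma> i. \<gamma> \<in> B k \<Longrightarrow> i < n \<Longrightarrow> of_nat (N k) * \<theta> k \<gamma> i \<in> \<int>"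
    and m: "\<And>k. coprime (m k) (N k)"
    and lim: "\<And>\<gamma> i. \<gamma> \<in> carrier G \<Longrightarrow> i < n \<Longrightarrow> ((\<lambda>k. ee (of_nat (m k) * \<theta> k \<gamma> i)) \<longlongrightarrow> \<mu> \<gamma> i) \<omega>"
  shows "spectral_system G n \<mu>"
proof -
  interpret group G by fact
  have "\<exists>a. \<forall>\<gamma>\<in>B k. \<forall>i<n. ee (\<theta> k \<gamma> i) = ee (1 / of_nat (N k)) ^ a \<gamma> i" for k
  proof -
    have "\<exists>a. ee (\<theta> k \<gamma> i) = ee (1 / of_nat (N k)) ^ a" if "\<gamma> \<in> B k" "i < n" for \<gamma> i
      using ee_eq_power[OF N(2)[OF that] N(1)] by metis
    then have "\<forall>\<gamma> i. \<exists>a. \<gamma> \<in> B k \<longrightarrow> i < n \<longrightarrow> ee (\<theta> k \<gamma> i) = ee (1 / of_nat (N k)) ^ a" by blast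
    then show ?thesis by metis
  qed
  then obtain a where a: "\<And>k \<gamma> i. \<gamma> \<in> B k \<Longrightarrow> i < n \<Longrightarrow> ee (\<theta> k \<gamma> i) = ee (1 / of_nat (N k)) ^ a k \<gamma> i" by metis
  define z where "z = (\<lambda>k. ee (1 / of_nat (N k)))"
  define \<nu> where "\<nu> = (\<lambda>k \<gamma> i. ee (of_nat (m k) * \<theta> k \<gamma> i))"
  have z: "z k ^ N k = 1" for k using N(1)[of k] by (simp add: z_def ee_of_nat_mult[symmetric] ee_eq_1_iff)
  have \<theta>: "ee (\<theta> k \<gamma> i) = z k ^ a k \<gamma> i" if "\<gamma> \<in> B k" "i < n" for k \<gamma> i
    using a[OF that] by (simp add: z_def)
  have \<nu>: "\<nu> k \<gamma> i = (z k ^ m k) ^ a k \<gamma> i" if "\<gamma> \<in> B k" "i < n" for k \<gamma> i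
    using \<theta>[OF that] by (simp add: \<nu>_def ee_of_nat_mult power_mult[symmetric] mult.commute)
  have lim': "((\<lambda>k. \<nu> k \<gamma> i) \<longlongrightarrow> \<mu> \<gamma> i) \<omega>" if "\<gamma> \<in> carrier G" "i < n" for \<gamma> i
    using lim[OF that] by (simp add: \<nu>_def)
  have trace1: "mtrace (\<rho> k \<gamma>) = (\<Sum>i<n. z k ^ a k \<gamma> i)" if "\<gamma> \<in> B k" for k \<gamma>
    using trace[OF that, of 1] carrier[of \<gamma> k] B(2) that by (auto simp: \<theta>)
  have hom_pow: "\<rho> k (x [^] j) = \<rho> k x ^\<^sub>m j" if "x \<in> carrier G" for k x and j :: nat
    by (rule mat_hom_pow[of "\<rho> k"]) (use carrier mult one that in auto)
  have sum_lim: "((\<lambda>k. \<Sum>i<n. \<nu> k \<gamma> i) \<longlongrightarrow> (\<Sum>i<n. \<mu> \<gamma> i)) \<omega>" if "\<gamma> \<in> carrier G" for \<gamma>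
    using lim'[OF that] by (intro tendsto_sum) auto
  show ?thesis
  proof (unfold_locales)
    show "n > 0" by fact
  next
    fix \<gamma> i assume "\<gamma> \<in> carrier G" "i < n"
    from tendsto_norm[OF lim'[OF this]] have "((\<lambda>k. 1) \<longlongrightarrow> norm (\<mu> \<gamma> i)) \<omega>" by (simp add: \<nu>_def)
    then show "norm (\<mu> \<gamma> i) = 1" using tendsto_unique[OF nonbot _ tendsto_const] by blast
  next
    fix \<gamma> and j :: nat assume \<gamma>: "\<gamma> \<in> carrier G"
    have "eventually (\<lambda>k. \<gamma> \<in> B k \<and> \<gamma> [^] j \<in> B k) \<omega>"
      using \<gamma> by (intro eventually_conj B) auto
    then have "eventually (\<lambda>k. (\<Sum>i<n. \<nu> k (\<gamma> [^] j) i) = (\<Sum>i<n. \<nu> k \<gamma> i ^ j)) \<omega>"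
    proof eventually_elim
      case (elim k)
      have "(\<Sum>i<n. z k ^ a k (\<gamma> [^] j) i) = (\<Sum>i<n. (z k ^ a k \<gamma> i) ^ j)"
        using trace1[of "\<gamma> [^] j" k] trace[of \<gamma> k j] elim hom_pow[OF \<gamma>] by (simp add: \<theta>)
      from conjugate_power_sum[OF z N(1) m this] show ?case using elim by (simp add: \<nu>)
    qed
    moreover have "((\<lambda>k. \<Sum>i<n. \<nu> k \<gamma> i ^ j) \<longlongrightarrow> (\<Sum>i<n. \<mu> \<gamma> i ^ j)) \<omega>"
      using lim'[OF \<gamma>] by (intro tendsto_sum tendsto_power) auto
    ultimately have "((\<lambda>k. \<Sum>i<n. \<nu> k (\<gamma> [^] j) i) \<longlongrightarrow> (\<Sum>i<n. \<mu> \<gamma> i ^ j)) \<omega>"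
      using tendsto_cong by fast
    then show "(\<Sum>i<n. \<mu> (\<gamma> [^] j) i) = (\<Sum>i<n. \<mu> \<gamma> i ^ j)"
      using tendsto_unique[OF nonbot] sum_lim[of "\<gamma> [^] j"] \<gamma> by blast
  next
    fix x \<gamma> y assume xy: "x \<in> carrier G" "\<gamma> \<in> carrier G" "y \<in> carrier G"
    \<comment> \<open>The polynomial has degree at most \<open>n\<close>, so these elements are all
      that the recurrence at \<open>0\<close> involves.\<close>
    have "eventually (\<lambda>k. \<gamma> \<in> B k \<and> (\<forall>j\<in>{..n}. x \<otimes> \<gamma> [^] j \<otimes> y \<in> B k)) \<omega>"
      using xy by (intro eventually_conj B(1) eventually_ball_finite ballI) auto
    then have "eventually (\<lambda>k. (\<Sum>j\<le>n. coeff (\<Prod>i<n. [:- \<nu> k \<gamma> i, 1:]) j * (\<Sum>l<n. \<nu> k (x \<otimes> \<gamma> [^] j \<otimes> y) l)) = 0) \<omega>"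
    proof eventually_elim
      case (elim k)
      define \<phi> where "\<phi> = (\<lambda>M. mtrace (\<rho> k x * M * \<rho> k y))"
      have X: "\<rho> k x \<in> carrier_mat n n" and Y: "\<rho> k y \<in> carrier_mat n n" and A: "\<rho> k \<gamma> \<in> carrier_mat n n"
        using carrier xy by auto
      have \<phi>_add: "\<phi> (M + M') = \<phi> M + \<phi> M'" if "M \<in> carrier_mat n n" "M' \<in> carrier_mat n n" for M M'
        using that X Y mtrace_add[of "\<rho> k x * M * \<rho> k y" n "\<rho> k x * M' * \<rho> k y"]
        by (simp add: \<phi>_def mult_add_distrib_mat[of _ n n _ n] add_mult_distrib_mat[of _ n n _ _ n])
      have \<phi>_scale: "\<phi> (c \<cdot>\<^sub>m M) = c * \<phi> M" if "M \<in> carrier_mat n n" for c M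
        using that X Y mtrace_smult[of "\<rho> k x * M * \<rho> k y" n c]
        by (simp add: \<phi>_def mult_smult_distrib[of _ n n _ n] mult_smult_assoc_mat[of _ n n _ n])
      have \<phi>_eq: "\<phi> (\<rho> k \<gamma> ^\<^sub>m j) = (\<Sum>l<n. z k ^ a k (x \<otimes> \<gamma> [^] j \<otimes> y) l)" if "j \<le> n" for j
        using trace1[of "x \<otimes> \<gamma> [^] j \<otimes> y" k] elim that xy hom_pow[OF xy(2), of k j]
        by (simp add: \<phi>_def mult)
      have "(\<Sum>j\<le>n. coeff (\<Prod>i<n. [:- (z k ^ a k \<gamma> i), 1:]) j * (\<Sum>l<n. z k ^ a k (x \<otimes> \<gamma> [^] j \<otimes> y) l)) =
        poly_act (\<Prod>i<n. [:- ee (\<theta> k \<gamma> i), 1:]) (\<lambda>j. \<phi> (\<rho> k \<gamma> ^\<^sub>m j)) 0"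
        unfolding poly_act_bound[OF degree_prod_linear_le] using elim by (simp add: \<phi>_eq \<theta>)
      also have "\<dots> = \<phi> (0\<^sub>m n n * \<rho> k \<gamma> ^\<^sub>m 0)"
        using poly_act_char_prod[OF A \<phi>_add \<phi>_scale, of "\<lambda>i. ee (\<theta> k \<gamma> i)" n] char[of \<gamma> k] elim by simp
      also have "\<dots> = 0" using A X Y by (simp add: \<phi>_def mtrace_def)
      finally have "poly_act (\<Prod>i<n. [:- (z k ^ a k \<gamma> i), 1:]) (\<lambda>j. \<Sum>l<n. z k ^ a k (x \<otimes> \<gamma> [^] j \<otimes> y) l) 0 = 0"
        unfolding poly_act_bound[OF degree_prod_linear_le] by simp
      from conjugate_cayley_hamilton[OF z N(1) m this] show ?case
        unfolding poly_act_bound[OF degree_prod_linear_le] using elim by (simp add: \<nu>)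
    qed
    moreover have "((\<lambda>k. \<Sum>j\<le>n. coeff (\<Prod>i<n. [:- \<nu> k \<gamma> i, 1:]) j * (\<Sum>l<n. \<nu> k (x \<otimes> \<gamma> [^] j \<otimes> y) l)) \<longlongrightarrow>
       (\<Sum>j\<le>n. coeff (\<Prod>i<n. [:- \<mu> \<gamma> i, 1:]) j * (\<Sum>l<n. \<mu> (x \<otimes> \<gamma> [^] j \<otimes> y) l))) \<omega>"
      using xy by (intro tendsto_sum[where I = "{..n}"] tendsto_mult tendsto_coeff_prod_linear sum_lim lim') auto
    ultimately have "((\<lambda>k. 0) \<longlongrightarrow> (\<Sum>j\<le>n. coeff (\<Prod>i<n. [:- \<mu> \<gamma> i, 1:]) j * (\<Sum>l<n. \<mu> (x \<otimes> \<gamma> [^] j \<otimes> y) l))) \<omega>"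
      using tendsto_cong by fast
    then have "(\<Sum>j\<le>n. coeff (\<Prod>i<n. [:- \<mu> \<gamma> i, 1:]) j * (\<Sum>l<n. \<mu> (x \<otimes> \<gamma> [^] j \<otimes> y) l)) = 0"
      using tendsto_unique[OF nonbot _ tendsto_const] by blast
    then show "poly_act (\<Prod>i<n. [:- \<mu> \<gamma> i, 1:]) (\<lambda>k. \<Sum>i<n. \<mu> (x \<otimes> \<gamma> [^] k \<otimes> y) i) 0 = 0"
      unfolding poly_act_bound[OF degree_prod_linear_le] by simp
  next
    fix g h :: "nat \<Rightarrow> 'a" assume gh: "\<And>i. g i \<in> carrier G" "\<And>i. h i \<in> carrier G"
    let ?D = "Suc (n * n)"
    have "eventually (\<lambda>k. \<forall>i\<in>{..<?D}. \<forall>j\<in>{..<?D}. g i \<otimes> h j \<in> B k) \<omega>"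
      using gh by (intro eventually_ball_finite ballI B) auto
    then have "eventually (\<lambda>k. det (mat ?D ?D (\<lambda>(i, j). \<Sum>l<n. \<nu> k (g i \<otimes> h j) l)) = 0) \<omega>"
    proof eventually_elim
      case (elim k)
      have "mat ?D ?D (\<lambda>(i, j). \<Sum>l<n. z k ^ a k (g i \<otimes> h j) l) = mat ?D ?D (\<lambda>(i, j). mtrace (\<rho> k (g i) * \<rho> k (h j)))"
        using elim gh by (intro eq_matI) (auto simp: trace1[symmetric] mult)
      then have "det (mat ?D ?D (\<lambda>(i, j). \<Sum>l<n. z k ^ a k (g i \<otimes> h j) l)) = 0"
        using det_trace_form_zero[of "\<lambda>i. \<rho> k (g i)" n "\<lambda>j. \<rho> k (h j)"] gh carrier by simp
      from conjugate_gram_det[OF z N(1) m this]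
      have "det (mat ?D ?D (\<lambda>(i, j). \<Sum>l<n. (z k ^ m k) ^ a k (g i \<otimes> h j) l)) = 0" .
      moreover have "mat ?D ?D (\<lambda>(i, j). \<Sum>l<n. \<nu> k (g i \<otimes> h j) l) = mat ?D ?D (\<lambda>(i, j). \<Sum>l<n. (z k ^ m k) ^ a k (g i \<otimes> h j) l)"
        using elim by (intro eq_matI) (auto simp: \<nu>)
      ultimately show ?case by simp
    qed
    moreover have "((\<lambda>k. det (mat ?D ?D (\<lambda>(i, j). \<Sum>l<n. \<nu> k (g i \<otimes> h j) l))) \<longlongrightarrow>
      det (mat ?D ?D (\<lambda>(i, j). \<Sum>l<n. \<mu> (g i \<otimes> h j) l))) \<omega>"
      using gh by (intro tendsto_det sum_lim) auto
    ultimately have "((\<lambda>k. 0) \<longlongrightarrow> det (mat ?D ?D (\<lambda>(i, j). \<Sum>l<n. \<mu> (g i \<otimes> h j) l))) \<omega>"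
      using tendsto_cong by fast
    then show "det (mat ?D ?D (\<lambda>(i, j). \<Sum>l<n. \<mu> (g i \<otimes> h j) l)) = 0"
      using tendsto_unique[OF nonbot _ tendsto_const] by blast
  qed
qed

section \<open>Burnside sets\<close>

context group
begin

lemma finite_generate_commuting:
  assumes "finite Y" "Y \<subseteq> carrier G" "\<And>a b. a \<in> Y \<Longrightarrow> b \<in> Y \<Longrightarrow> a \<otimes> b = b \<otimes> a"
    "\<And>a. a \<in> Y \<Longrightarrow> torsion G a"
  shows "finite (generate G Y)"
  using assms
proof (induction Y rule: finite_induct)
  case empty
  then show ?case by (simp add: generate_empty)
next
  case (insert y Y)
  let ?H = "generate G Y"
  have y: "y \<in> carrier G" and Y: "Y \<subseteq> carrier G" using insert by auto
  have H: "?H \<subseteq> carrier G" using Y by (rule generate_incl)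
  have finH: "finite ?H" using insert by auto
  obtain N :: nat where N: "N > 0" "y [^] N = \<one>" using insert.prems(3)[of y] by (auto simp: torsion_def)
  have comm: "z \<otimes> y = y \<otimes> z" if "z \<in> ?H" for z
    using that
  proof induction
    case (inv h)
    then have h: "h \<in> carrier G" "h \<otimes> y = y \<otimes> h" using Y insert.prems(2) by auto
    have "inv h \<otimes> y = inv h \<otimes> (y \<otimes> h) \<otimes> inv h" using h y by (simp add: m_assoc)
    also have "\<dots> = y \<otimes> inv h" using h y by (simp add: h(2)[symmetric] m_assoc[symmetric])
    finally show ?case .
  next
    case (eng a b)
    then have "a \<in> carrier G" "b \<in> carrier G" using H by auto
    then show ?case using eng y by (metis m_assoc)
  qed (use y insert.prems(2) in auto)
  have pow_mod: "y [^] (j mod N) = y [^] j" for j :: nat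
  proof -
    have "y [^] j = y [^] (N * (j div N) + j mod N)" by simp
    also have "\<dots> = y [^] (j mod N)" using y N by (simp only: nat_pow_mult[symmetric] nat_pow_pow[symmetric]) simp
    finally show ?thesis ..
  qed
  have pow_comm: "z \<otimes> y [^] (j::nat) = y [^] j \<otimes> z" if "z \<in> ?H" for z j
  proof -
    have "z \<in> carrier G" using that H by auto
    then show ?thesis using y comm[OF that] by (induction j) (auto, metis m_assoc nat_pow_closed)
  qed
  define K where "K = (\<lambda>(j, z). y [^] (j::nat) \<otimes> z) ` ({..<N} \<times> ?H)"
  have K: "y [^] j \<otimes> z \<in> K" if "z \<in> ?H" for j :: nat and z
  proof -
    have "y [^] j \<otimes> z = y [^] (j mod N) \<otimes> z" by (simp add: pow_mod)
    then show ?thesis using that N by (auto simp: K_def intro!: rev_image_eqI[of "(j mod N, z)"])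
  qed
  have one_H: "\<one> \<in> ?H" by (rule generate.one)
  have "generate G (insert y Y) \<subseteq> K"
  proof
    fix x assume "x \<in> generate G (insert y Y)"
    then show "x \<in> K"
    proof induction
      case one
      then show ?case using K[OF one_H, of 0] by simp
    next
      case (incl h)
      show ?case
      proof (cases "h = y")
        case True
        then show ?thesis using K[OF one_H, of 1] y by simp
      next
        case False
        then have "h \<in> ?H" using incl by (auto intro: generate.incl)
        then show ?thesis using K[of h 0] H by auto
      qed
    next
      case (inv h)
      show ?case
      proof (cases "h = y")
        case True
        have "y [^] (N - 1) \<otimes> y = \<one>" using N y by (metis Suc_diff_1 nat_pow_Suc)
        then have "inv y = y [^] (N - 1)" using y by (metis inv_equality nat_pow_closed)
        then show ?thesis using K[OF one_H, of "N - 1"] y True by simp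
      next
        case False
        then have "inv h \<in> ?H" using inv by (auto intro: generate.inv)
        then show ?thesis using K[of "inv h" 0] H by auto
      qed
    next
      case (eng a b)
      then obtain i j :: nat and u v where uv: "u \<in> ?H" "v \<in> ?H" "a = y [^] i \<otimes> u" "b = y [^] j \<otimes> v" by (auto simp: K_def)
      have c: "u \<in> carrier G" "v \<in> carrier G" using uv H by auto
      have "a \<otimes> b = y [^] i \<otimes> (u \<otimes> y [^] j) \<otimes> v" using uv c y by (simp add: m_assoc)
      also have "\<dots> = y [^] i \<otimes> y [^] j \<otimes> (u \<otimes> v)" using c y by (simp add: pow_comm[OF uv(1)] m_assoc)
      also have "\<dots> = y [^] (i + j) \<otimes> (u \<otimes> v)" using y by (simp add: nat_pow_mult)
      finally show ?case using K[of "u \<otimes> v"] uv by (simp add: generate.eng)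
    qed
  qed
  moreover have "finite K" using finH by (simp add: K_def)
  ultimately show ?case by (rule finite_subset)
qed

text \<open>Schreier's argument: for a letter \<open>s\<close> and a representative
  \<open>t\<close>, the product \<open>s t\<close> is a representative times a member of
  \<open>Y\<close>. So the set \<open>X\<close> of all \<open>t \<otimes> y\<close> is stable under
  left multiplication by letters, and as it contains \<open>\<one>\<close> it is everything.\<close>

lemma schreier_generators:
  assumes S: "finite S" "S \<subseteq> carrier G" "generate G S = carrier G"
    and T: "finite (r ` carrier G)" "\<And>\<gamma>. \<gamma> \<in> carrier G \<Longrightarrow> r \<gamma> \<in> carrier G"
    and F1: "\<And>\<gamma>. \<gamma> \<in> carrier G \<Longrightarrow> inv (r \<gamma>) \<otimes> \<gamma> \<in> F1"
  obtains Y where "finite Y" "Y \<subseteq> F1" "Y \<subseteq> carrier G"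
    "\<And>\<gamma>. \<gamma> \<in> carrier G \<Longrightarrow> \<exists>t\<in>r ` carrier G. \<exists>y\<in>generate G Y. \<gamma> = t \<otimes> y"
proof -
  define S' where "S' = S \<union> m_inv G ` S"
  define \<sigma> where "\<sigma> = (\<lambda>\<gamma>. inv (r \<gamma>) \<otimes> \<gamma>)"
  \<comment> \<open>\<open>\<sigma> \<one>\<close> is included because the representative of
    \<open>\<one>\<close> may differ from \<open>\<one>\<close>.\<close>
  define Y where "Y = insert (\<sigma> \<one>) (\<sigma> ` (\<lambda>(s, t). s \<otimes> t) ` (S' \<times> r ` carrier G))"
  have S': "S' \<subseteq> carrier G" "finite S'" using S by (auto simp: S'_def)
  have finY: "finite Y" using S' T by (simp add: Y_def)
  have \<sigma>: "\<sigma> \<gamma> \<in> F1" "\<sigma> \<gamma> \<in> carrier G" if "\<gamma> \<in> carrier G" for \<gamma>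
    using that F1 T(2) by (auto simp: \<sigma>_def)
  have Y_sub: "Y \<subseteq> F1" "Y \<subseteq> carrier G" using S' T(2) by (auto simp: Y_def intro!: \<sigma>)
  have split: "\<gamma> = r \<gamma> \<otimes> \<sigma> \<gamma>" if "\<gamma> \<in> carrier G" for \<gamma>
    using that T(2)[OF that] by (simp add: \<sigma>_def m_assoc[symmetric])
  define X where "X = {t \<otimes> y | t y. t \<in> r ` carrier G \<and> y \<in> generate G Y}"
  have gY: "generate G Y \<subseteq> carrier G" using Y_sub(2) by (rule generate_incl)
  have one_X: "\<one> \<in> X" using split[of \<one>] generate.incl[of "\<sigma> \<one>" Y G] by (auto simp: X_def Y_def)
  have step: "s \<otimes> x \<in> X" if s: "s \<in> S'" and x: "x \<in> X" for s x
  proof -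
    obtain t y where ty: "t \<in> r ` carrier G" "y \<in> generate G Y" "x = t \<otimes> y" using x by (auto simp: X_def)
    have c: "s \<in> carrier G" "t \<in> carrier G" "y \<in> carrier G" using s S' ty T(2) gY by auto
    have "\<sigma> (s \<otimes> t) \<in> Y" using s ty(1) by (auto simp: Y_def)
    then have y': "\<sigma> (s \<otimes> t) \<otimes> y \<in> generate G Y" using ty(2) by (auto intro: generate.eng generate.incl)
    have \<sigma>c: "\<sigma> (s \<otimes> t) \<in> carrier G" "r (s \<otimes> t) \<in> carrier G" using c T(2) by (auto simp: \<sigma>_def)
    have "s \<otimes> x = (s \<otimes> t) \<otimes> y" using c ty by (simp add: m_assoc)
    also have "\<dots> = (r (s \<otimes> t) \<otimes> \<sigma> (s \<otimes> t)) \<otimes> y" using split[of "s \<otimes> t"] c by simp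
    also have "\<dots> = r (s \<otimes> t) \<otimes> (\<sigma> (s \<otimes> t) \<otimes> y)" using \<sigma>c c by (simp add: m_assoc)
    finally show ?thesis using y' c by (auto simp: X_def)
  qed
  have X_sub: "X \<subseteq> carrier G" using T(2) gY by (auto simp: X_def)
  have mult: "\<gamma> \<otimes> x \<in> X" if "\<gamma> \<in> generate G S" "x \<in> X" for \<gamma> x
    using that
  proof (induction arbitrary: x)
    case (eng a b)
    have "a \<in> carrier G" "b \<in> carrier G" "x \<in> carrier G" using eng X_sub S(3) by auto
    then show ?case using eng by (simp add: m_assoc)
  qed (use X_sub step in \<open>auto simp: S'_def\<close>)
  show ?thesis
  proof (rule that[OF finY Y_sub])
    fix \<gamma> assume \<gamma>: "\<gamma> \<in> carrier G"
    then have "\<gamma> \<in> X" using mult[OF _ one_X, of \<gamma>] S(3) by simp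
    then show "\<exists>t\<in>r ` carrier G. \<exists>y\<in>generate G Y. \<gamma> = t \<otimes> y" by (auto simp: X_def)
  qed
qed

lemma torsion_if_finite_powers:
  assumes x: "x \<in> carrier G" and fin: "finite (range (\<lambda>j::nat. x [^] j))"
  shows "torsion G x"
proof -
  have "\<not> inj (\<lambda>j::nat. x [^] j)" using fin finite_imageD by blast
  then obtain i j :: nat where ij: "x [^] i = x [^] j" "i < j"
    unfolding inj_def by (metis linorder_neqE_nat)
  have "i + (j - i) = j" using ij(2) by simp
  then have "x [^] i \<otimes> x [^] (j - i) = x [^] j" using x by (simp only: nat_pow_mult)
  then have "x [^] i \<otimes> x [^] (j - i) = x [^] i" using ij(1) by simp
  then have "x [^] (j - i) = \<one>" using x by (simp only: l_cancel_one nat_pow_closed)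
  then show ?thesis using ij(2) unfolding torsion_def by (intro exI[of _ "j - i"]) simp
qed

end

section \<open>Matrices of finite order and their angles\<close>

lemma char_prod_cong: "(\<And>i. i < m \<Longrightarrow> z i = z' i) \<Longrightarrow> char_prod A z m = char_prod A z' m"
  by (induction m) auto

lemma root_of_unity_ee:
  assumes "z ^ N = 1" "N > 0"
  obtains q where "z = ee q"
proof -
  have "z \<in> (\<lambda>k. cis (2 * pi * real k / real N)) ` {..<N}"
    using Complex.bij_betw_roots_unity[OF assms(2)] assms(1) by (auto simp: bij_betw_def)
  then obtain k where "z = cis (2 * pi * real k / real N)" by blast
  then have "z = ee (of_nat k / of_nat N)" by (simp add: ee_def of_rat_divide)
  then show ?thesis by (rule that)
qed

lemma GL_mult: "x \<otimes>\<^bsub>GL n\<^esub> y = x * y" and GL_one: "\<one>\<^bsub>GL n\<^esub> = 1\<^sub>m n"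
  by (simp_all add: GL_def units_of_mult units_of_one ring_mat_def)

lemma GL_pow:
  assumes "x \<in> carrier_mat n n"
  shows "x [^]\<^bsub>GL n\<^esub> (j::nat) = x ^\<^sub>m j"
  using assms by (induction j) (simp_all add: nat_pow_def GL_mult GL_one)

text \<open>The situation of the putative counterexamples, without their infinite images: what is
  derived from it is that some image is finite.\<close>

locale torsion_sequence = group G + seq_ultrafilter \<omega> for G (structure) and \<omega> +
  fixes S :: "'a set" and n :: nat and B :: "nat \<Rightarrow> 'a set" and \<rho> :: "nat \<Rightarrow> 'a \<Rightarrow> complex mat"
    and \<theta> :: "nat \<Rightarrow> 'a \<Rightarrow> nat \<Rightarrow> rat"
  assumes S: "finite S" "S \<subseteq> carrier G" "generate G S = carrier G"
    and n_pos: "n > 0"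
    and B: "\<And>k. finite (B k)" "\<And>k. B k \<subseteq> carrier G" "\<And>\<gamma>. \<gamma> \<in> carrier G \<Longrightarrow> eventually (\<lambda>k. \<gamma> \<in> B k) \<omega>"
    and hom: "\<And>k. \<rho> k \<in> hom G (GL n)"
    and torsion: "\<And>k \<gamma>. \<gamma> \<in> B k \<Longrightarrow> torsion (GL n) (\<rho> k \<gamma>)"
    and trace: "\<And>k \<gamma> j. \<gamma> \<in> B k \<Longrightarrow> mtrace (\<rho> k \<gamma> ^\<^sub>m j) = (\<Sum>i<n. ee (\<theta> k \<gamma> i) ^ j)"
    and char: "\<And>k \<gamma>. \<gamma> \<in> B k \<Longrightarrow> char_prod (\<rho> k \<gamma>) (\<lambda>i. ee (\<theta> k \<gamma> i)) n = 0\<^sub>m n n"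
begin

lemma rho_carrier: "x \<in> carrier G \<Longrightarrow> \<rho> k x \<in> carrier_mat n n"
  using hom[of k] by (auto simp: hom_def carrier_GL)

lemma rho_mult: "x \<in> carrier G \<Longrightarrow> y \<in> carrier G \<Longrightarrow> \<rho> k (x \<otimes> y) = \<rho> k x * \<rho> k y"
  using hom[of k] by (auto simp: hom_def GL_mult)

lemma group_hom_rho: "group_hom G (GL n) (\<rho> k)"
  by (intro group_hom.intro group_hom_axioms.intro group_axioms group_GL hom)

lemma rho_one: "\<rho> k \<one> = 1\<^sub>m n"
  using group_hom.hom_one[OF group_hom_rho] by (simp add: GL_one)

abbreviation angle :: "'a \<Rightarrow> nat \<Rightarrow> nat \<Rightarrow> rat" where
  "angle \<gamma> i \<equiv> (\<lambda>k. \<theta> k \<gamma> i)"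

lemma countable_carrier: "countable (carrier G)"
proof -
  have "carrier G \<subseteq> (\<Union>k. B k)"
  proof
    fix \<gamma> assume "\<gamma> \<in> carrier G"
    then have "eventually (\<lambda>k. \<gamma> \<in> B k) \<omega>" by (rule B(3))
    then have "\<exists>k. \<gamma> \<in> B k" using nonbot eventually_happens' by blast
    then show "\<gamma> \<in> (\<Union>k. B k)" by blast
  qed
  moreover have "countable (\<Union>k. B k)" using B(1) by (auto intro: countable_finite)
  ultimately show ?thesis by (rule countable_subset)
qed

text \<open>The density lemma treats the angles minus their torsion parts. For the latter, the
  ultrafilter makes \<open>m k\<close> constant modulo each denominator, so that they are multiplied
  by a fixed residue \<open>r\<close>, which is a unit.\<close>

lemma conjugate_system:
  assumes \<tau>: "\<And>w. w \<in> tors \<Longrightarrow> eventually (\<lambda>k. w k - \<tau> w \<in> \<int>) \<omega>"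
    "\<And>(r::nat) e w. \<tau> (\<lambda>k. \<Sum>j<r. of_int (e j) * w j k) - (\<Sum>j<r. of_int (e j) * \<tau> (w j)) \<in> \<int>"
    and h: "\<And>v. v \<in> tors \<Longrightarrow> h v = 0"
    "\<And>(r::nat) e v. h (\<lambda>k. \<Sum>j<r. of_int (e j) * v j k) = (\<Sum>j<r. of_int (e j) * h (v j))"
  obtains q where "spectral_system G n (\<lambda>\<gamma> i. ee (q \<gamma> i))"
    "\<And>\<gamma> i. \<gamma> \<in> carrier G \<Longrightarrow> i < n \<Longrightarrow> \<tau> (angle \<gamma> i) \<in> \<int> \<Longrightarrow> ee (q \<gamma> i) = ee (h (angle \<gamma> i))"
    "\<And>\<gamma> i. \<gamma> \<in> carrier G \<Longrightarrow> i < n \<Longrightarrow> h (angle \<gamma> i) = 0 \<Longrightarrow> ee (q \<gamma> i) = 1 \<Longrightarrow> \<tau> (angle \<gamma> i) \<in> \<int>"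
proof -
  define den where "den = (\<lambda>x. nat (snd (quotient_of x)))"
  have den_pos: "den x > 0" for x using quotient_of_denom_pos'[of x] by (simp add: den_def)
  \<comment> \<open>All angles are enumerated in one sequence, as the density lemma requires; the
    carrier is countable as it is exhausted by the finite sets \<open>B k\<close>.\<close>
  define f where "f = from_nat_into (carrier G \<times> {..<n})"
  have f: "\<exists>j. f j = (\<gamma>, i)" if "\<gamma> \<in> carrier G" "i < n" for \<gamma> i
    using that countable_carrier n_pos unfolding f_def
    by (metis SigmaI countable_SIGMA countable_finite finite_lessThan from_nat_into_surj lessThan_iff)
  \<comment> \<open>The denominators of the torsion parts are included in order that
    \<open>m k\<close> be a unit modulo them as well.\<close>
  define N where "N = (\<lambda>k. \<Prod>(\<gamma>, i)\<in>B k \<times> {..<n}. den (\<theta> k \<gamma> i) * den (\<tau> (angle \<gamma> i)))"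
  have N: "N k > 0" for k unfolding N_def using den_pos by (intro prod_pos) auto
  have N_dvd: "den (\<theta> k \<gamma> i) dvd N k" "den (\<tau> (angle \<gamma> i)) dvd N k" if "\<gamma> \<in> B k" "i < n" for k \<gamma> i
  proof -
    have "(case (\<gamma>, i) of (\<gamma>, i) \<Rightarrow> den (\<theta> k \<gamma> i) * den (\<tau> (angle \<gamma> i))) dvd N k"
      unfolding N_def by (rule dvd_prodI) (use B(1) that in auto)
    then show "den (\<theta> k \<gamma> i) dvd N k" "den (\<tau> (angle \<gamma> i)) dvd N k"
      by (auto intro: dvd_mult_left dvd_mult_right)
  qed
  obtain m where m: "\<And>k. coprime (m k) (N k)"
    and lim: "\<And>j. ((\<lambda>k. ee (of_nat (m k) * (angle (fst (f j)) (snd (f j)) k - \<tau> (angle (fst (f j)) (snd (f j))))))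
      \<longlongrightarrow> ee (h (angle (fst (f j)) (snd (f j))))) \<omega>"
  proof (rule conjugates_dense[where \<tau> = \<tau> and h = h and w = "\<lambda>j. angle (fst (f j)) (snd (f j))", OF \<tau> h N])
    fix m assume "\<And>k. coprime (m k) (N k)"
      "\<And>j. ((\<lambda>k. ee (of_nat (m k) * (angle (fst (f j)) (snd (f j)) k - \<tau> (angle (fst (f j)) (snd (f j))))))
      \<longlongrightarrow> ee (h (angle (fst (f j)) (snd (f j))))) \<omega>"
    then show thesis by (rule that)
  qed
  have res: "\<exists>r<den x. eventually (\<lambda>k. m k mod den x = r) \<omega>" for x
  proof -
    have "eventually (\<lambda>k. \<exists>r\<in>{..<den x}. m k mod den x = r) \<omega>" using den_pos[of x] by simp
    then show ?thesis using eventually_finite_cases[of "{..<den x}" "\<lambda>r k. m k mod den x = r"] by auto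
  qed
  then obtain r where r: "\<And>x. r x < den x" "\<And>x. eventually (\<lambda>k. m k mod den x = r x) \<omega>" by metis
  define q where "q = (\<lambda>\<gamma> i. h (angle \<gamma> i) + of_nat (r (\<tau> (angle \<gamma> i))) * \<tau> (angle \<gamma> i))"
  have pow_r: "eventually (\<lambda>k. ee (of_nat (m k) * x) = ee (of_nat (r x) * x)) \<omega>" for x
    using r(2)[of x]
  proof eventually_elim
    case (elim k)
    then have "[m k = r x] (mod den x)" using r(1)[of x] by (simp add: Cong.cong_def)
    then show ?case by (simp add: ee_of_nat_mult ee_power_eq_iff den_def)
  qed
  have lim': "((\<lambda>k. ee (of_nat (m k) * \<theta> k \<gamma> i)) \<longlongrightarrow> ee (q \<gamma> i)) \<omega>" if \<gamma>: "\<gamma> \<in> carrier G" "i < n" for \<gamma> i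
  proof -
    let ?t = "\<tau> (angle \<gamma> i)"
    obtain j where "f j = (\<gamma>, i)" using f[OF \<gamma>] by blast
    then have 1: "((\<lambda>k. ee (of_nat (m k) * (\<theta> k \<gamma> i - ?t))) \<longlongrightarrow> ee (h (angle \<gamma> i))) \<omega>" using lim[of j] by simp
    have 2: "((\<lambda>k. ee (of_nat (m k) * ?t)) \<longlongrightarrow> ee (of_nat (r ?t) * ?t)) \<omega>"
      using pow_r[of ?t] by (rule tendsto_eventually)
    have "((\<lambda>k. ee (of_nat (m k) * (\<theta> k \<gamma> i - ?t)) * ee (of_nat (m k) * ?t)) \<longlongrightarrow> ee (h (angle \<gamma> i)) * ee (of_nat (r ?t) * ?t)) \<omega>"
      by (rule tendsto_mult[OF 1 2])
    moreover have "ee (of_nat (m k) * (\<theta> k \<gamma> i - ?t)) * ee (of_nat (m k) * ?t) = ee (of_nat (m k) * \<theta> k \<gamma> i)" for k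
      by (simp flip: ee_add add: right_diff_distrib)
    ultimately show ?thesis by (simp add: q_def ee_add)
  qed
  have N_Ints: "of_nat (N k) * \<theta> k \<gamma> i \<in> \<int>" if "\<gamma> \<in> B k" "i < n" for k \<gamma> i
    using denominator_dvd_mult_Ints[of "\<theta> k \<gamma> i" "N k"] N_dvd(1)[OF that] by (simp add: den_def)
  have system: "spectral_system G n (\<lambda>\<gamma> i. ee (q \<gamma> i))"
    by (rule limit_spectral_system[where B = B and \<rho> = \<rho> and \<theta> = \<theta> and N = N and m = m])
      (use group_axioms n_pos B(2,3) rho_carrier rho_mult rho_one trace char N N_Ints m lim' in auto)
  show ?thesis
  proof (rule that[OF system])
    fix \<gamma> i assume \<gamma>: "\<gamma> \<in> carrier G" "i < n"
    let ?t = "\<tau> (angle \<gamma> i)"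
    show "ee (q \<gamma> i) = ee (h (angle \<gamma> i))" if "?t \<in> \<int>"
    proof -
      have "of_nat (r ?t) * ?t \<in> \<int>" using that by (intro Ints_mult) auto
      then have "ee (of_nat (r ?t) * ?t) = 1" by (simp only: ee_eq_1_iff)
      then show ?thesis by (simp add: q_def ee_add)
    qed
    \<comment> \<open>A unit residue divisible by the denominator of \<open>?t\<close> forces this
      denominator to be \<open>1\<close>.\<close>
    show "?t \<in> \<int>" if "h (angle \<gamma> i) = 0" "ee (q \<gamma> i) = 1"
    proof -
      have "ee ?t ^ r ?t = ee ?t ^ 0" using that by (simp add: q_def ee_of_nat_mult)
      then have "[r ?t = 0] (mod den ?t)" by (simp only: ee_power_eq_iff den_def)
      then have r0: "r ?t = 0" using r(1)[of ?t] by (simp add: Cong.cong_def)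
      have "eventually (\<lambda>k. \<gamma> \<in> B k \<and> m k mod den ?t = r ?t) \<omega>" using B(3)[OF \<gamma>(1)] r(2) by (rule eventually_conj)
      then obtain k where k: "\<gamma> \<in> B k" "m k mod den ?t = r ?t" using nonbot eventually_happens' by blast
      have "den ?t dvd m k" using k(2) r0 by (simp add: mod_eq_0_iff_dvd)
      moreover have "den ?t dvd N k" using N_dvd(2)[OF k(1) \<gamma>(2)] .
      ultimately have "den ?t = 1" using m[of k] by (metis coprime_common_divisor_nat One_nat_def)
      then show ?thesis using denominator_mult_Ints[of ?t] by (simp add: den_def)
    qed
  qed
qed

lemma commutators_trivial:
  assumes \<tau>: "\<And>w. w \<in> tors \<Longrightarrow> eventually (\<lambda>k. w k - \<tau> w \<in> \<int>) \<omega>"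
    "\<And>(r::nat) e w. \<tau> (\<lambda>k. \<Sum>j<r. of_int (e j) * w j k) - (\<Sum>j<r. of_int (e j) * \<tau> (w j)) \<in> \<int>"
    and ab: "a \<in> carrier G" "b \<in> carrier G"
    and \<tau>_Ints: "\<And>i. i < n \<Longrightarrow> \<tau> (angle a i) \<in> \<int>" "\<And>i. i < n \<Longrightarrow> \<tau> (angle b i) \<in> \<int>"
      "\<And>i. i < n \<Longrightarrow> \<tau> (angle (a \<otimes> b \<otimes> inv (b \<otimes> a)) i) \<in> \<int>"
  shows "eventually (\<lambda>k. \<rho> k (a \<otimes> b) = \<rho> k (b \<otimes> a)) \<omega>"
proof -
  define c where "c = a \<otimes> b \<otimes> inv (b \<otimes> a)"
  have c: "c \<in> carrier G" using ab by (simp add: c_def)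
  have tors: "angle c i0 \<in> tors" if i0: "i0 < n" for i0
  proof (rule ccontr)
    assume "angle c i0 \<notin> tors"
    from nontorsion_functional[OF this] obtain h :: "(nat \<Rightarrow> rat) \<Rightarrow> rat" where
      h: "\<And>v. v \<in> tors \<Longrightarrow> h v = 0" "h (angle c i0) = 1 / 2"
      "\<And>(r::nat) e v. h (\<lambda>k. \<Sum>j<r. of_int (e j) * v j k) = (\<Sum>j<r. of_int (e j) * h (v j))" by blast
    define \<alpha> where "\<alpha> = (\<Sum>i<n. 2 * pi * \<bar>of_rat (h (angle a i))\<bar> :: real)"
    define \<beta> where "\<beta> = (\<Sum>i<n. 2 * pi * \<bar>of_rat (h (angle b i))\<bar> :: real)"
    have ab0: "\<alpha> \<ge> 0" "\<beta> \<ge> 0" by (auto simp: \<alpha>_def \<beta>_def intro!: sum_nonneg)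
    \<comment> \<open>This brings the bound \<open>2 * \<alpha> * \<beta> * n / J\<close> for the
      trace of the \<open>J\<close>-th power below \<open>2\<close>.\<close>
    obtain J :: nat where J: "real J > \<alpha> * \<beta> * n" using reals_Archimedean2 by blast
    have "0 \<le> \<alpha> * \<beta> * n" using ab0 by simp
    then have J0: "J > 0" using J by (intro Nat.gr0I) auto
    define h' where "h' = (\<lambda>v. h v / of_nat J)"
    have h'_tors: "h' v = 0" if "v \<in> tors" for v using h(1)[OF that] by (simp add: h'_def)
    have h'_sum: "h' (\<lambda>k. \<Sum>j<r. of_int (e j) * v j k) = (\<Sum>j<r. of_int (e j) * h' (v j))" for r :: nat and e v
      unfolding h'_def h(3) by (simp add: sum_divide_distrib)
    obtain q where sys: "spectral_system G n (\<lambda>\<gamma> i. ee (q \<gamma> i))"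
      and q: "\<And>\<gamma> i. \<gamma> \<in> carrier G \<Longrightarrow> i < n \<Longrightarrow> \<tau> (angle \<gamma> i) \<in> \<int> \<Longrightarrow> ee (q \<gamma> i) = ee (h' (angle \<gamma> i))"
    proof (rule conjugate_system[where \<tau> = \<tau> and h = h', OF \<tau> h'_tors h'_sum])
      fix q assume "spectral_system G n (\<lambda>\<gamma> i. ee (q \<gamma> i))"
        "\<And>\<gamma> i. \<gamma> \<in> carrier G \<Longrightarrow> i < n \<Longrightarrow> \<tau> (angle \<gamma> i) \<in> \<int> \<Longrightarrow> ee (q \<gamma> i) = ee (h' (angle \<gamma> i))"
      then show thesis by (rule that)
    qed
    interpret X: spectral_system G n "\<lambda>\<gamma> i. ee (q \<gamma> i)" by fact
    have small: "(\<Sum>i<n. norm (ee (h' (angle x i)) - 1)) \<le> (\<Sum>i<n. 2 * pi * \<bar>of_rat (h (angle x i))\<bar>) / J" for x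
    proof -
      have "norm (ee (h' (angle x i)) - 1) \<le> 2 * pi * \<bar>of_rat (h (angle x i))\<bar> / J" for i
        using norm_ee_minus_1_le[of "h' (angle x i)"] by (simp add: h'_def of_rat_divide)
      then show ?thesis unfolding sum_divide_distrib by (intro sum_mono) auto
    qed
    have "norm (X.chi (c [^] J) - n) \<le> J * (2 * (\<Sum>i<n. norm (ee (h' (angle a i)) - 1)) * (\<Sum>i<n. norm (ee (h' (angle b i)) - 1)) * n)"
      unfolding c_def by (rule X.commutator_power_bound[OF ab]) (use q ab \<tau>_Ints in auto)
    also have "\<dots> \<le> J * (2 * (\<alpha> / J) * (\<beta> / J) * n)"
      using small[of a] small[of b] ab0
      by (intro mult_left_mono mult_right_mono mult_mono) (auto simp: \<alpha>_def \<beta>_def intro!: sum_nonneg)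
    also have "\<dots> = 2 * (\<alpha> * \<beta> * n) / J" using J0 by (simp add: field_simps)
    also have "\<dots> < 2" using J J0 by (simp add: field_simps)
    finally have lt: "norm (X.chi (c [^] J) - n) < 2" .
    have pow: "ee (q c i) ^ J = ee (h (angle c i))" if "i < n" for i
    proof -
      have "ee (q c i) ^ J = ee (of_nat J * h' (angle c i))"
        using q[OF c that] \<tau>_Ints(3)[OF that] by (simp add: c_def ee_of_nat_mult)
      then show ?thesis using J0 by (simp add: h'_def)
    qed
    \<comment> \<open>Eigenvalue \<open>i0\<close> of \<open>c ^ J\<close> is \<open>- 1\<close> and
      the others have real part at most \<open>1\<close>, so the trace has real part at most
      \<open>n - 2\<close>.\<close>
    have "Re (X.chi (c [^] J)) = (\<Sum>i<n. Re (ee (h (angle c i))))" using c by (simp add: X.chi_pow pow)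
    also have "\<dots> = Re (ee (h (angle c i0))) + (\<Sum>i\<in>{..<n} - {i0}. Re (ee (h (angle c i))))"
      using i0 by (subst sum.remove[of _ i0]) auto
    also have "Re (ee (h (angle c i0))) = -1" by (simp add: h(2) ee_def of_rat_divide)
    also have "(\<Sum>i\<in>{..<n} - {i0}. Re (ee (h (angle c i)))) \<le> (\<Sum>i\<in>{..<n} - {i0}. 1)"
      by (intro sum_mono) (metis complex_Re_le_cmod norm_ee)
    also have "(\<Sum>i\<in>{..<n} - {i0}. 1) = real n - 1" using i0 by simp
    finally have "Re (X.chi (c [^] J) - n) \<le> -2" by simp
    then have "norm (X.chi (c [^] J) - n) \<ge> 2" using abs_Re_le_cmod[of "X.chi (c [^] J) - n"] by linarith
    then show False using lt by simp
  qed
  \<comment> \<open>The angles of \<open>c\<close> now equal their integral torsion parts modulo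
    integers, so for almost all \<open>k\<close> the matrix \<open>\<rho> k c\<close> is unipotent;
    having finite order, it is \<open>1\<close>.\<close>
  have "eventually (\<lambda>k. \<theta> k c i - \<tau> (angle c i) \<in> \<int>) \<omega>" if "i < n" for i
    using \<tau>(1)[OF tors[OF that]] .
  then have "eventually (\<lambda>k. \<forall>i\<in>{..<n}. \<theta> k c i - \<tau> (angle c i) \<in> \<int>) \<omega>"
    by (intro eventually_ball_finite) auto
  with B(3)[OF c] show ?thesis
  proof eventually_elim
    case (elim k)
    have "ee (\<theta> k c i) = 1" if "i < n" for i
    proof -
      have "\<theta> k c i - \<tau> (angle c i) \<in> \<int>" using elim(2) that by blast
      then have "\<theta> k c i - \<tau> (angle c i) + \<tau> (angle c i) \<in> \<int>"
        by (rule Ints_add) (use \<tau>_Ints(3)[OF that] in \<open>simp add: c_def\<close>)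
      then show ?thesis by (simp add: ee_eq_1_iff)
    qed
    then have "char_prod (\<rho> k c) (\<lambda>_. 1) n = 0\<^sub>m n n"
      using char[OF elim(1)] char_prod_cong[of n "\<lambda>i. ee (\<theta> k c i)" "\<lambda>_. 1" "\<rho> k c"] by simp
    moreover obtain N :: nat where "N > 0" "\<rho> k c ^\<^sub>m N = 1\<^sub>m n"
      using torsion[OF elim(1)] rho_carrier[OF c, of k] by (auto simp: torsion_def GL_pow GL_one)
    ultimately have one: "\<rho> k c = 1\<^sub>m n" using torsion_unipotent_mat[OF rho_carrier[OF c]] by blast
    have "a \<otimes> b = c \<otimes> (b \<otimes> a)" using ab by (simp add: c_def m_assoc)
    then have "\<rho> k (a \<otimes> b) = \<rho> k c * \<rho> k (b \<otimes> a)" using c ab by (simp only: rho_mult m_closed)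
    then show ?case using one rho_carrier[of "b \<otimes> a" k] ab by simp
  qed
qed

lemma some_image_finite: "\<exists>k. finite (\<rho> k ` carrier G)"
proof -
  obtain \<tau> :: "(nat \<Rightarrow> rat) \<Rightarrow> rat" where \<tau>: "\<And>w. w \<in> tors \<Longrightarrow> eventually (\<lambda>k. w k - \<tau> w \<in> \<int>) \<omega>"
    "\<And>(r::nat) e w. \<tau> (\<lambda>k. \<Sum>j<r. of_int (e j) * w j k) - (\<Sum>j<r. of_int (e j) * \<tau> (w j)) \<in> \<int>"
    using torsion_part_exists by blast
  obtain q where sys: "spectral_system G n (\<lambda>\<gamma> i. ee (q \<gamma> i))"
    and q: "\<And>\<gamma> i. \<gamma> \<in> carrier G \<Longrightarrow> i < n \<Longrightarrow> ee (q \<gamma> i) = 1 \<Longrightarrow> \<tau> (angle \<gamma> i) \<in> \<int>"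
  proof (rule conjugate_system[where \<tau> = \<tau> and h = "\<lambda>_. 0", OF \<tau>])
    fix q assume "spectral_system G n (\<lambda>\<gamma> i. ee (q \<gamma> i))"
      "\<And>\<gamma> i. \<gamma> \<in> carrier G \<Longrightarrow> i < n \<Longrightarrow> (0::rat) = 0 \<Longrightarrow> ee (q \<gamma> i) = 1 \<Longrightarrow> \<tau> (angle \<gamma> i) \<in> \<int>"
    then show thesis by (intro that) auto
  qed auto
  interpret X: spectral_system G n "\<lambda>\<gamma> i. ee (q \<gamma> i)" by fact
  define \<Omega> where "\<Omega> = (\<lambda>\<gamma>. \<lambda>x\<in>carrier G. X.chi (x \<otimes> \<gamma>)) ` carrier G"
  have fin\<Omega>: "finite \<Omega>" unfolding \<Omega>_def
    by (rule X.finitely_many_translates[OF X.finite_chi_of_torsion[OF S, of q]]) simp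
  \<comment> \<open>The operation of \<open>\<gamma>\<close> on the finite set of translates,
    restricted to it so that only finitely many functions occur. Elements with the same operation
    differ by a member of \<open>F1\<close>.\<close>
  define \<Theta> where "\<Theta> = (\<lambda>\<gamma>. \<lambda>f\<in>\<Omega>. \<lambda>x\<in>carrier G. f (x \<otimes> \<gamma>) :: complex)"
  have \<Theta>_eq: "\<Theta> \<gamma> (\<lambda>x\<in>carrier G. X.chi (x \<otimes> y)) = (\<lambda>x\<in>carrier G. X.chi (x \<otimes> \<gamma> \<otimes> y))"
    if "\<gamma> \<in> carrier G" "y \<in> carrier G" for \<gamma> y
    using that by (auto simp: \<Theta>_def \<Omega>_def fun_eq_iff)
  have "\<Theta> ` carrier G \<subseteq> PiE \<Omega> (\<lambda>_. \<Omega>)"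
  proof clarify
    fix \<gamma> assume \<gamma>: "\<gamma> \<in> carrier G"
    have "\<Theta> \<gamma> f \<in> \<Omega>" if f: "f \<in> \<Omega>" for f
    proof -
      obtain y where y: "y \<in> carrier G" "f = (\<lambda>x\<in>carrier G. X.chi (x \<otimes> y))" using f by (auto simp: \<Omega>_def)
      have "\<Theta> \<gamma> f = (\<lambda>x\<in>carrier G. X.chi (x \<otimes> (\<gamma> \<otimes> y)))"
        unfolding y(2) \<Theta>_eq[OF \<gamma> y(1)] using \<gamma> y(1) by (auto simp: m_assoc fun_eq_iff)
      then show ?thesis using \<gamma> y by (auto simp: \<Omega>_def)
    qed
    then show "\<Theta> \<gamma> \<in> PiE \<Omega> (\<lambda>_. \<Omega>)" by (auto simp: \<Theta>_def)
  qed
  then have fin\<Theta>: "finite (\<Theta> ` carrier G)" by (rule finite_subset) (intro finite_PiE fin\<Omega>)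
  define r where "r = (\<lambda>\<gamma>. inv_into (carrier G) \<Theta> (\<Theta> \<gamma>))"
  have r: "r \<gamma> \<in> carrier G" "\<Theta> (r \<gamma>) = \<Theta> \<gamma>" if "\<gamma> \<in> carrier G" for \<gamma>
    using that by (auto simp: r_def inv_into_into f_inv_into_f)
  have fin_r: "finite (r ` carrier G)"
    using fin\<Theta> by (auto simp: r_def image_image[symmetric] simp del: image_image)
  \<comment> \<open>The kernel of the limit character: its members can be deleted from any word
    under \<open>X.chi\<close>. In particular their limit eigenvalues are \<open>1\<close>, which
    makes their torsion parts integral.\<close>
  define F1 where "F1 = {\<gamma> \<in> carrier G. \<forall>x\<in>carrier G. \<forall>y\<in>carrier G. X.chi (x \<otimes> \<gamma> \<otimes> y) = X.chi (x \<otimes> y)}"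
  have F1: "inv (r \<gamma>) \<otimes> \<gamma> \<in> F1" if \<gamma>: "\<gamma> \<in> carrier G" for \<gamma>
  proof -
    have "X.chi (x \<otimes> (inv (r \<gamma>) \<otimes> \<gamma>) \<otimes> y) = X.chi (x \<otimes> y)" if xy: "x \<in> carrier G" "y \<in> carrier G" for x y
    proof -
      have c: "r \<gamma> \<in> carrier G" using r \<gamma> by simp
      have "(\<lambda>x\<in>carrier G. X.chi (x \<otimes> r \<gamma> \<otimes> y)) (x \<otimes> inv (r \<gamma>)) = (\<lambda>x\<in>carrier G. X.chi (x \<otimes> \<gamma> \<otimes> y)) (x \<otimes> inv (r \<gamma>))"
        unfolding \<Theta>_eq[OF c xy(2), symmetric] \<Theta>_eq[OF \<gamma> xy(2), symmetric] r(2)[OF \<gamma>] ..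
      then have "X.chi (x \<otimes> inv (r \<gamma>) \<otimes> r \<gamma> \<otimes> y) = X.chi (x \<otimes> inv (r \<gamma>) \<otimes> \<gamma> \<otimes> y)"
        using c xy by simp
      then show ?thesis using c xy \<gamma> by (simp add: m_assoc)
    qed
    then show ?thesis using \<gamma> r by (auto simp: F1_def)
  qed
  have F1_D: "X.chi (x \<otimes> \<gamma> \<otimes> y) = X.chi (x \<otimes> y)" if "\<gamma> \<in> F1" "x \<in> carrier G" "y \<in> carrier G" for x \<gamma> y
    using that by (auto simp: F1_def)
  have F1_Ints: "\<tau> (angle \<gamma> i) \<in> \<int>" if "\<gamma> \<in> F1" "i < n" for \<gamma> i
  proof -
    have \<gamma>: "\<gamma> \<in> carrier G" using that by (simp add: F1_def)
    have "X.chi \<gamma> = n" using F1_D[OF that(1), of \<one> \<one>] \<gamma> by (simp add: X.chi_one)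
    then show ?thesis using q[OF \<gamma> that(2)] X.eigenvalues_one[OF \<gamma> _ that(2)] by blast
  qed
  have F1_comm: "a \<otimes> b \<otimes> inv (b \<otimes> a) \<in> F1" if "a \<in> F1" "b \<in> F1" for a b
  proof -
    have ab: "a \<in> carrier G" "b \<in> carrier G" using that by (auto simp: F1_def)
    have inv: "X.chi (x \<otimes> (inv \<gamma> \<otimes> y)) = X.chi (x \<otimes> y)" if "\<gamma> \<in> F1" "x \<in> carrier G" "y \<in> carrier G" for \<gamma> x y
    proof -
      have \<gamma>: "\<gamma> \<in> carrier G" using that by (simp add: F1_def)
      have "X.chi (x \<otimes> inv \<gamma> \<otimes> \<gamma> \<otimes> y) = X.chi (x \<otimes> inv \<gamma> \<otimes> y)" using that \<gamma> by (intro F1_D) auto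
      then show ?thesis using that \<gamma> by (simp add: m_assoc)
    qed
    have "X.chi (x \<otimes> (a \<otimes> b \<otimes> inv (b \<otimes> a)) \<otimes> y) = X.chi (x \<otimes> y)" if xy: "x \<in> carrier G" "y \<in> carrier G" for x y
    proof -
      have "X.chi (x \<otimes> (a \<otimes> b \<otimes> inv (b \<otimes> a)) \<otimes> y) = X.chi (x \<otimes> a \<otimes> (b \<otimes> (inv a \<otimes> (inv b \<otimes> y))))"
        using ab xy by (simp add: m_assoc inv_mult_group)
      also have "\<dots> = X.chi (x \<otimes> b \<otimes> (inv a \<otimes> (inv b \<otimes> y)))"
        using ab xy that(1) F1_D[of a x "b \<otimes> (inv a \<otimes> (inv b \<otimes> y))"] \<open>a \<in> F1\<close> by (simp add: m_assoc)
      also have "\<dots> = X.chi (x \<otimes> (inv a \<otimes> (inv b \<otimes> y)))"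
        using ab xy \<open>b \<in> F1\<close> by (intro F1_D) auto
      also have "\<dots> = X.chi (x \<otimes> y)" using ab xy \<open>a \<in> F1\<close> \<open>b \<in> F1\<close> by (simp add: inv)
      finally show ?thesis .
    qed
    then show ?thesis using ab by (auto simp: F1_def)
  qed
  obtain Y where Y: "finite Y" "Y \<subseteq> F1" "Y \<subseteq> carrier G"
    "\<And>\<gamma>. \<gamma> \<in> carrier G \<Longrightarrow> \<exists>t\<in>r ` carrier G. \<exists>y\<in>generate G Y. \<gamma> = t \<otimes> y"
    using schreier_generators[OF S fin_r r(1) F1] by blast
  have "eventually (\<lambda>k. \<rho> k (a \<otimes> b) = \<rho> k (b \<otimes> a)) \<omega>" if "a \<in> Y" "b \<in> Y" for a b
  proof (rule commutators_trivial[where \<tau> = \<tau>, OF \<tau>])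
    have ab: "a \<in> F1" "b \<in> F1" using that Y(2) by auto
    show "\<tau> (angle a i) \<in> \<int>" "\<tau> (angle b i) \<in> \<int>" "\<tau> (angle (a \<otimes> b \<otimes> inv (b \<otimes> a)) i) \<in> \<int>" if "i < n" for i
      by (rule F1_Ints[OF _ that], fact ab F1_comm[OF ab])+
  qed (use that Y(3) in auto)
  \<comment> \<open>\<open>Y\<close> is finite, so one \<open>k\<close> makes all pairs commute and
    has all of \<open>Y\<close> in \<open>B k\<close>.\<close>
  then have "eventually (\<lambda>k. (\<forall>a\<in>Y. \<forall>b\<in>Y. \<rho> k (a \<otimes> b) = \<rho> k (b \<otimes> a)) \<and> (\<forall>a\<in>Y. a \<in> B k)) \<omega>"
    using Y B(3) by (intro eventually_conj eventually_ball_finite ballI) auto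
  then obtain k where k: "\<And>a b. a \<in> Y \<Longrightarrow> b \<in> Y \<Longrightarrow> \<rho> k (a \<otimes> b) = \<rho> k (b \<otimes> a)" "Y \<subseteq> B k"
    using nonbot eventually_happens' by blast
  interpret gh: group_hom G "GL n" "\<rho> k" by (rule group_hom_rho)
  have "finite (generate (GL n) (\<rho> k ` Y))"
  proof (rule gh.H.finite_generate_commuting)
    show "\<rho> k ` Y \<subseteq> carrier (GL n)" using Y(3) by auto
    show "u \<otimes>\<^bsub>GL n\<^esub> v = v \<otimes>\<^bsub>GL n\<^esub> u" if uv: "u \<in> \<rho> k ` Y" "v \<in> \<rho> k ` Y" for u v
    proof -
      obtain a b where ab: "a \<in> Y" "b \<in> Y" "u = \<rho> k a" "v = \<rho> k b" using uv by blast
      then have "a \<in> carrier G" "b \<in> carrier G" using Y(3) by auto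
      then show ?thesis using k(1)[OF ab(1,2)] by (simp add: ab GL_mult rho_mult)
    qed
  qed (use Y(1) k(2) torsion in auto)
  then have fin: "finite (\<rho> k ` generate G Y)" using gh.generate_img[OF Y(3)] by simp
  have "\<rho> k ` carrier G \<subseteq> (\<lambda>(t, u). t * u) ` (\<rho> k ` r ` carrier G \<times> \<rho> k ` generate G Y)"
  proof clarify
    fix \<gamma> assume "\<gamma> \<in> carrier G"
    then obtain t y where ty: "t \<in> r ` carrier G" "y \<in> generate G Y" "\<gamma> = t \<otimes> y" using Y(4) by blast
    have "t \<in> carrier G" "y \<in> carrier G" using ty r(1) generate_incl[OF Y(3)] by auto
    then have "\<rho> k \<gamma> = \<rho> k t * \<rho> k y" using ty by (simp add: rho_mult)
    then show "\<rho> k \<gamma> \<in> (\<lambda>(t, u). t * u) ` (\<rho> k ` r ` carrier G \<times> \<rho> k ` generate G Y)" using ty by auto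
  qed
  then have "finite (\<rho> k ` carrier G)" using fin fin_r by (meson finite_SigmaI finite_imageI finite_subset)
  then show ?thesis ..
qed

end

theorem theorem1p3:
  fixes F :: "('a, 'c) monoid_scheme" and n :: nat
  assumes "group F" and "finitely_generated F" and "n \<ge> 1"
  shows "\<exists>L \<subseteq> carrier F. finite L \<and> burnside_set F (Hom F (GL n)) L"
proof (rule ccontr)
  assume contra: "\<not> ?thesis"
  interpret group F by fact
  obtain S where S: "finite S" "S \<subseteq> carrier F" "generate F S = carrier F"
    using assms(2) by (auto simp: finitely_generated_def)
  \<comment> \<open>Each step doubles the admissible word length; the presence of
    \<open>\<one>\<close> makes the sequence increasing.\<close>
  define B where "B = rec_nat ({\<one>\<^bsub>F\<^esub>} \<union> S \<union> m_inv F ` S) (\<lambda>_ W. (\<lambda>(x, y). x \<otimes>\<^bsub>F\<^esub> y) ` (W \<times> W))"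
  have B0: "B 0 = {\<one>\<^bsub>F\<^esub>} \<union> S \<union> m_inv F ` S" and B_Suc: "\<And>k. B (Suc k) = (\<lambda>(x, y). x \<otimes>\<^bsub>F\<^esub> y) ` (B k \<times> B k)"
    by (simp_all add: B_def)
  have B_fin: "finite (B k)" for k by (induction k) (use S in \<open>auto simp: B0 B_Suc\<close>)
  have B_sub: "B k \<subseteq> carrier F" for k by (induction k) (use S in \<open>auto simp: B0 B_Suc\<close>)
  have B_one: "\<one>\<^bsub>F\<^esub> \<in> B k" for k by (induction k) (auto simp: B0 B_Suc intro!: rev_image_eqI[of "(\<one>\<^bsub>F\<^esub>, \<one>\<^bsub>F\<^esub>)"])
  have "B k \<subseteq> B (Suc k)" for k
  proof
    fix x assume x: "x \<in> B k"
    then have "x \<in> carrier F" using B_sub[of k] by blast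
    then have "x = x \<otimes>\<^bsub>F\<^esub> \<one>\<^bsub>F\<^esub>" by simp
    then show "x \<in> B (Suc k)" using x B_one[of k]
      by (auto simp: B_Suc intro!: rev_image_eqI[of "(x, \<one>\<^bsub>F\<^esub>)"])
  qed
  then have B_mono: "B k \<subseteq> B l" if "k \<le> l" for k l using that by (rule lift_Suc_mono_le)
  have B_exh: "\<exists>k. \<gamma> \<in> B k" if "\<gamma> \<in> generate F S" for \<gamma>
    using that
  proof induction
    case (eng a b)
    then obtain k l where "a \<in> B k" "b \<in> B l" by blast
    then have "a \<in> B (max k l)" "b \<in> B (max k l)" using B_mono[of k "max k l"] B_mono[of l "max k l"] by auto
    then have "a \<otimes>\<^bsub>F\<^esub> b \<in> B (Suc (max k l))" by (auto simp: B_Suc)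
    then show ?case ..
  qed (auto intro!: exI[of _ 0] simp: B0)
  have "\<exists>\<rho>\<in>hom F (GL n). (\<forall>\<gamma>\<in>B k. torsion (GL n) (\<rho> \<gamma>)) \<and> infinite (\<rho> ` carrier F)" for k
  proof -
    have "\<not> burnside_set F (Hom F (GL n)) (B k)" using contra B_fin B_sub by blast
    then obtain \<rho> where \<rho>: "\<rho> \<in> hom F (GL n)"
      "\<not> ((\<forall>\<gamma>\<in>B k. torsion (GL n) (\<rho> \<gamma>)) \<longleftrightarrow> finite (\<rho> ` carrier F))"
      using B_sub by (auto simp: burnside_set_def Hom_def)
    \<comment> \<open>Finite image always implies torsion, so the equivalence can fail only by
      torsion on \<open>B k\<close> together with an infinite image.\<close>
    have "torsion (GL n) (\<rho> \<gamma>)" if fin: "finite (\<rho> ` carrier F)" and "\<gamma> \<in> B k" for \<gamma>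
    proof -
      interpret gh: group_hom F "GL n" \<rho>
        by (intro group_hom.intro group_hom_axioms.intro group_axioms group_GL \<rho>(1))
      have \<gamma>: "\<gamma> \<in> carrier F" using that B_sub by auto
      have "range (\<lambda>j::nat. \<rho> \<gamma> [^]\<^bsub>GL n\<^esub> j) \<subseteq> \<rho> ` carrier F"
        using \<gamma> by (auto simp flip: gh.hom_nat_pow)
      then show ?thesis using fin \<gamma> by (intro gh.H.torsion_if_finite_powers) (auto intro: finite_subset)
    qed
    then show ?thesis using \<rho> by blast
  qed
  then obtain \<rho> where \<rho>: "\<And>k. \<rho> k \<in> hom F (GL n)" "\<And>k \<gamma>. \<gamma> \<in> B k \<Longrightarrow> torsion (GL n) (\<rho> k \<gamma>)"
    "\<And>k. infinite (\<rho> k ` carrier F)" by metis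
  have "\<exists>\<theta>. (\<forall>j. mtrace (\<rho> k \<gamma> ^\<^sub>m j) = (\<Sum>i<n. ee (\<theta> i) ^ j)) \<and> char_prod (\<rho> k \<gamma>) (\<lambda>i. ee (\<theta> i)) n = 0\<^sub>m n n"
    if \<gamma>: "\<gamma> \<in> B k" for k \<gamma>
  proof -
    have A: "\<rho> k \<gamma> \<in> carrier_mat n n" using \<rho>(1)[of k] \<gamma> B_sub[of k] by (auto simp: hom_def carrier_GL)
    obtain z where z: "\<And>j. mtrace (\<rho> k \<gamma> ^\<^sub>m j) = (\<Sum>i<n. z i ^ j)" "char_prod (\<rho> k \<gamma>) z n = 0\<^sub>m n n"
      "\<And>N i. \<rho> k \<gamma> ^\<^sub>m N = 1\<^sub>m n \<Longrightarrow> i < n \<Longrightarrow> z i ^ N = 1"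
      using eigenvalues_exist[OF A] by blast
    obtain N :: nat where N: "N > 0" "\<rho> k \<gamma> ^\<^sub>m N = 1\<^sub>m n"
      using \<rho>(2)[OF \<gamma>] A by (auto simp: torsion_def GL_pow GL_one)
    have "\<exists>q. z i = ee q" if "i < n" for i using root_of_unity_ee[OF z(3)[OF N(2) that] N(1)] by metis
    then obtain \<theta> where \<theta>: "\<And>i. i < n \<Longrightarrow> z i = ee (\<theta> i)" by metis
    have "char_prod (\<rho> k \<gamma>) (\<lambda>i. ee (\<theta> i)) n = 0\<^sub>m n n"
      using z(2) char_prod_cong[of n z "\<lambda>i. ee (\<theta> i)" "\<rho> k \<gamma>"] \<theta> by simp
    then show ?thesis using z(1) \<theta> by (intro exI[of _ \<theta>]) simp
  qed
  then have "\<forall>k \<gamma>. \<exists>\<theta>. \<gamma> \<in> B k \<longrightarrow> (\<forall>j. mtrace (\<rho> k \<gamma> ^\<^sub>m j) = (\<Sum>i<n. ee (\<theta> i) ^ j)) \<and> char_prod (\<rho> k \<gamma>) (\<lambda>i. ee (\<theta> i)) n = 0\<^sub>m n n"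
    by blast
  then obtain \<theta> where \<theta>: "\<And>k \<gamma> j. \<gamma> \<in> B k \<Longrightarrow> mtrace (\<rho> k \<gamma> ^\<^sub>m j) = (\<Sum>i<n. ee (\<theta> k \<gamma> i) ^ j)"
    "\<And>k \<gamma>. \<gamma> \<in> B k \<Longrightarrow> char_prod (\<rho> k \<gamma>) (\<lambda>i. ee (\<theta> k \<gamma> i)) n = 0\<^sub>m n n" by metis
  obtain \<omega> where \<omega>: "seq_ultrafilter \<omega>" using seq_ultrafilter_exists by blast
  interpret U: seq_ultrafilter \<omega> by fact
  have "eventually (\<lambda>k. \<gamma> \<in> B k) \<omega>" if \<gamma>: "\<gamma> \<in> carrier F" for \<gamma>
  proof -
    obtain k0 where "\<gamma> \<in> B k0" using B_exh \<gamma> S(3) by blast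
    then have "eventually (\<lambda>k. \<gamma> \<in> B k) sequentially"
      using B_mono unfolding eventually_sequentially by blast
    then show ?thesis using U.le_sequentially by (rule filter_leD[rotated])
  qed
  then interpret torsion_sequence F \<omega> S n B \<rho> \<theta>
    using S assms(3) B_fin B_sub \<rho>(1,2) \<theta> by unfold_locales auto
  show False using some_image_finite \<rho>(3) by blast
qed

end
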